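(* Let $r$ be any integer with $1\le r<\infty$. Then there exist an open rectangle $D\subset\mathbb{R}^2$, a one-parameter family of piecewise $\mathcal C^r$ expanding maps $F_\sigma:D\to D$ $(0<\sigma<1)$ which $\mathcal C^r$-converge to another piecewise expanding map on $D$ as $\sigma\to 0$, and a constant $\rho>0$ independent of $\sigma$, such that each $F_\sigma$ admits a wandering (open) rectangle $R_\sigma\subset D$ with the following property: for Lebesgue-almost every $x\in R_\sigma$ and every non-zero $\boldsymbol{v}\in T_xD=\mathbb{R}^2$, (1) the $\omega$-limit set $\omega(\mathcal{A}_{F_\sigma}(x,\boldsymbol{v}))$ is a non-trivial closed interval (i.e. a closed interval that is not a one-point set), and this interval converges to a one-point set as $\sigma\to 0$; (2) $\inf\omega(\mathcal{A}_{F_\sigma}(x,\boldsymbol{v}))\ge\rho$.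
   Context: Piecewise expanding maps. Let $D\subset\mathbb{R}^2$ be a bounded region whose topological boundary $\partial D$ consists of finitely many simple regular $\mathcal C^r$-curves of finite length with mutually disjoint interiors (here $D$ is an open rectangle). Let $\alpha_1,\dots,\alpha_u$ be simple regular $\mathcal C^r$-curves in $\overline D=D\cup\partial D$ with mutually disjoint interiors such that $\alpha_1\cup\dots\cup\alpha_u$ is a graph in $\overline D$ every degree-one vertex of which lies in $\partial D$. Let $D_1,\dots,D_p$ be the connected components of $D'=D\setminus(\alpha_1\cup\dots\cup\alpha_u)$. A $\mathcal C^r$-map $F:D'\to D$ is a piecewise $\mathcal C^r$ expanding map on $D$ (written $F:D\to D$) if there are a constant $\lambda>1$ and, for each $i=1,\dots,p$, an open neighborhood $\mathcal N(\overline D_i)$ of $\overline D_i$ in $\mathbb{R}^2$ such that $F|_{D_i}$ extends to a $\mathcal C^r$-diffeomorphism (onto its image) $F_i:\mathcal N(\overline D_i)\to\mathbb{R}^2$ with $\|DF_i(x)\boldsymbol{v}\|\ge\lambda\|\boldsymbol{v}\|$ for all $x\in\mathcal N(\overline D_i)$ and all tangent vectors $\boldsymbol{v}$ at $x$. For $x\in\bigcap_{n\ge0}F^{-n}(D')$ (a set of full Lebesgue measure in $D$) and non-zero $\boldsymbol{v}\in T_xD$, $\mathcal{A}_F(x,\boldsymbol{v})$ is the sequence $\bigl(\frac1n\log\|DF^n(x)\boldsymbol{v}\|\bigr)_{n\ge1}$. For a real sequence $A=(a_n)_{n\ge1}$, $\omega(A)$ is the set of all $a\in\mathbb{R}$ such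 that for every $\varepsilon>0$ and every $n_0$ there is $n>n_0$ with $a_n\in(a-\varepsilon,a+\varepsilon)$. A connected open set $U$ is a wandering domain of $F$ if $F^m(U)\cap F^n(U)=\emptyset$ for all $m\ne n$ in $\mathbb{N}$ (where $F^n(U)$ is the image of the points of $U$ at which $F^n$ is defined); a wandering rectangle is an open rectangle that is a wandering domain. Convergence conventions. "$F_\sigma$ $\mathcal C^r$-converges to $F_0$ as $\sigma\to0$" means that the pieces of the partitions of $D$ for $F_\sigma$ can be labelled consistently with those of $F_0$ so that the curves bounding the pieces converge in the $\mathcal C^r$ topology and the extended branches converge in the $\mathcal C^r$ topology. "The interval converges to a one-point set as $\sigma\to0$" means that for any choice of points $x_\sigma$ (in the full-measure subset of $R_\sigma$ in question) and non-zero vectors $\boldsymbol{v}_\sigma$, both endpoints of $\omega(\mathcal{A}_{F_\sigma}(x_\sigma,\boldsymbol{v}_\sigma))$ converge to one common real number as $\sigma\to0$. *)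

theory Defs
  imports "HOL-Analysis.Analysis"
begin

(* Used on open sets S only; by finite dimensionality, requiring every directional derivative
   to be of class C^n is the same as requiring this of the Frechet derivative. *)
primrec Cr_on :: "nat \<Rightarrow> ('a::euclidean_space \<Rightarrow> 'b::euclidean_space) \<Rightarrow> 'a set \<Rightarrow> bool" where
  "Cr_on 0 f S \<longleftrightarrow> continuous_on S f"
| "Cr_on (Suc n) f S \<longleftrightarrow>
     (\<forall>x\<in>S. f differentiable (at x)) \<and>
     (\<forall>v. Cr_on n (\<lambda>x. frechet_derivative f (at x) v) S)"

definition Cr_diffeo_onto_image ::
    "nat \<Rightarrow> ('a::euclidean_space \<Rightarrow> 'b::euclidean_space) \<Rightarrow> 'a set \<Rightarrow> bool" where
  "Cr_diffeo_onto_image r f S \<longleftrightarrow>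
     open S \<and> open (f ` S) \<and> inj_on f S \<and> Cr_on r f S \<and> Cr_on r (inv_into S f) (f ` S)"

primrec iter_deriv ::
    "'a::euclidean_space list \<Rightarrow> ('a \<Rightarrow> 'b::euclidean_space) \<Rightarrow> 'a \<Rightarrow> 'b" where
  "iter_deriv [] f = f"
| "iter_deriv (v # vs) f = iter_deriv vs (\<lambda>x. frechet_derivative f (at x) v)"

(* All partial derivatives of order at most r converge uniformly on S as the parameter
   decreases to 0. *)
definition Cr_tendsto ::
    "nat \<Rightarrow> 'a set \<Rightarrow> (real \<Rightarrow> 'a::euclidean_space \<Rightarrow> 'b::euclidean_space) \<Rightarrow> ('a \<Rightarrow> 'b) \<Rightarrow> bool" where
  "Cr_tendsto r S f f0 \<longleftrightarrow>
     (\<forall>vs. set vs \<subseteq> Basis \<and> length vs \<le> r \<longrightarrow>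
        uniform_limit S (\<lambda>\<sigma>. iter_deriv vs (f \<sigma>)) (iter_deriv vs f0) (at_right 0))"

(* A curve is parametrised by {0..1}; being C^r up to the end points means having a C^r
   extension to an open neighbourhood of {0..1}, and the function c includes such an extension.
   Values of c and its derivatives on {0..1} do not depend on the extension chosen. *)
definition simple_regular_curve :: "nat \<Rightarrow> (real \<Rightarrow> real^2) \<Rightarrow> bool" where
  "simple_regular_curve r c \<longleftrightarrow>
     (\<exists>U. open U \<and> {0..1} \<subseteq> U \<and> Cr_on r c U) \<and>
     simple_path c \<and>
     (\<forall>t\<in>{0..1}. vector_derivative c (at t) \<noteq> 0)"

(* Rectangles need not have sides parallel to the axes. *)
definition open_rectangle :: "(real^2) set \<Rightarrow> bool" where
  "open_rectangle S \<longleftrightarrow>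
     (\<exists>(f :: real^2 \<Rightarrow> real^2) a b. orthogonal_transformation f \<and> box a b \<noteq> {} \<and> S = f ` box a b)"

record pw_data =
  num_curves :: nat
  curve :: "nat \<Rightarrow> real \<Rightarrow> real^2"
  num_pieces :: nat
  piece :: "nat \<Rightarrow> (real^2) set"
  nbhd :: "nat \<Rightarrow> (real^2) set"
  branch :: "nat \<Rightarrow> real^2 \<Rightarrow> real^2"

(* Since the curves are finitely many and have disjoint interiors, two of them meet in finitely
   many points, so their union is automatically a graph.  A degree-one vertex of it is an end
   point of a non-closed curve that lies on no other curve. *)
definition curve_system :: "nat \<Rightarrow> (real^2) set \<Rightarrow> nat \<Rightarrow> (nat \<Rightarrow> real \<Rightarrow> real^2) \<Rightarrow> bool" where
  "curve_system r D u \<alpha> \<longleftrightarrow>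
     (\<forall>j<u. simple_regular_curve r (\<alpha> j) \<and> path_image (\<alpha> j) \<subseteq> closure D) \<and>
     (\<forall>i<u. \<forall>j<u. i \<noteq> j \<longrightarrow> \<alpha> i ` {0<..<1} \<inter> \<alpha> j ` {0<..<1} = {}) \<and>
     (\<forall>j<u. \<forall>z\<in>{pathstart (\<alpha> j), pathfinish (\<alpha> j)}.
        pathstart (\<alpha> j) \<noteq> pathfinish (\<alpha> j) \<and>
        (\<forall>i<u. i \<noteq> j \<longrightarrow> z \<notin> path_image (\<alpha> i)) \<longrightarrow> z \<in> frontier D)"

(* X is the domain D' of the map: F is a total function, but only its values on X matter. *)
definition pw_expanding_with ::
    "nat \<Rightarrow> (real^2) set \<Rightarrow> (real^2) set \<Rightarrow> (real^2 \<Rightarrow> real^2) \<Rightarrow> pw_data \<Rightarrow> bool" where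
  "pw_expanding_with r D X F d \<longleftrightarrow>
     curve_system r D (num_curves d) (curve d) \<and>
     X = D - (\<Union>j<num_curves d. path_image (curve d j)) \<and>
     bij_betw (piece d) {..<num_pieces d} (components X) \<and>
     F ` X \<subseteq> D \<and> Cr_on r F X \<and>
     (\<exists>l>1. \<forall>i<num_pieces d.
        closure (piece d i) \<subseteq> nbhd d i \<and>
        Cr_diffeo_onto_image r (branch d i) (nbhd d i) \<and>
        (\<forall>x\<in>piece d i. branch d i x = F x) \<and>
        (\<forall>x\<in>nbhd d i. \<forall>v. norm (frechet_derivative (branch d i) (at x) v) \<ge> l * norm v))"

definition pw_expanding ::
    "nat \<Rightarrow> (real^2) set \<Rightarrow> (real^2) set \<Rightarrow> (real^2 \<Rightarrow> real^2) \<Rightarrow> bool" where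
  "pw_expanding r D X F \<longleftrightarrow> (\<exists>d. pw_expanding_with r D X F d)"

(* The two conditions on pieces say that equally labelled pieces correspond to each other:
   piece i for parameter \<sigma> eventually contains every compact part of the limit piece i and
   is eventually contained in every neighbourhood of its closure.
   The domains of the extended branches depend on \<sigma>; their convergence is uniform C^r
   convergence on a common neighbourhood of the closure of the limit piece. *)
definition pw_data_tendsto :: "nat \<Rightarrow> (real \<Rightarrow> pw_data) \<Rightarrow> pw_data \<Rightarrow> bool" where
  "pw_data_tendsto r d d0 \<longleftrightarrow>
     (\<forall>\<^sub>F \<sigma> in at_right 0. num_curves (d \<sigma>) = num_curves d0 \<and> num_pieces (d \<sigma>) = num_pieces d0) \<and>
     (\<forall>j<num_curves d0. Cr_tendsto r {0..1} (\<lambda>\<sigma>. curve (d \<sigma>) j) (curve d0 j)) \<and>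
     (\<forall>i<num_pieces d0.
        (\<forall>K. compact K \<and> K \<subseteq> piece d0 i \<longrightarrow> (\<forall>\<^sub>F \<sigma> in at_right 0. K \<subseteq> piece (d \<sigma>) i)) \<and>
        (\<forall>V. open V \<and> closure (piece d0 i) \<subseteq> V \<longrightarrow>
           (\<forall>\<^sub>F \<sigma> in at_right 0. closure (piece (d \<sigma>) i) \<subseteq> V)) \<and>
        (\<exists>N. open N \<and> closure (piece d0 i) \<subseteq> N \<and> N \<subseteq> nbhd d0 i \<and>
           (\<forall>\<^sub>F \<sigma> in at_right 0. N \<subseteq> nbhd (d \<sigma>) i) \<and>
           Cr_tendsto r N (\<lambda>\<sigma>. branch (d \<sigma>) i) (branch d0 i)))"

definition pw_Cr_converges ::
    "nat \<Rightarrow> (real^2) set \<Rightarrow> (real \<Rightarrow> (real^2) set) \<Rightarrow> (real \<Rightarrow> real^2 \<Rightarrow> real^2) \<Rightarrow>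
     (real^2) set \<Rightarrow> (real^2 \<Rightarrow> real^2) \<Rightarrow> bool" where
  "pw_Cr_converges r D X F X0 F0 \<longleftrightarrow>
     (\<exists>d d0. (\<forall>\<sigma>\<in>{0<..<1}. pw_expanding_with r D (X \<sigma>) (F \<sigma>) (d \<sigma>)) \<and>
        pw_expanding_with r D X0 F0 d0 \<and> pw_data_tendsto r d d0)"

definition regular_points :: "(real^2) set \<Rightarrow> (real^2 \<Rightarrow> real^2) \<Rightarrow> (real^2) set" where
  "regular_points X F = {x. \<forall>n. (F ^^ n) x \<in> X}"

(* Near a point of regular_points X F the iterates of F only use values of F on the open set X,
   so the derivative below does not depend on F outside X.  The value at n = 0 is irrelevant. *)
definition lyap_seq :: "(real^2 \<Rightarrow> real^2) \<Rightarrow> real^2 \<Rightarrow> real^2 \<Rightarrow> nat \<Rightarrow> real" where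
  "lyap_seq F x v n = (1 / real n) * ln (norm (frechet_derivative (F ^^ n) (at x) v))"

definition omega_set :: "(nat \<Rightarrow> real) \<Rightarrow> real set" where
  "omega_set A = {a. \<forall>\<epsilon>>0. \<forall>n0. \<exists>n>n0. A n \<in> {a - \<epsilon><..<a + \<epsilon>}}"

definition pw_image :: "(real^2) set \<Rightarrow> (real^2 \<Rightarrow> real^2) \<Rightarrow> nat \<Rightarrow> (real^2) set \<Rightarrow> (real^2) set" where
  "pw_image X F n U = (F ^^ n) ` {x \<in> U. \<forall>k<n. (F ^^ k) x \<in> X}"

definition wandering_domain :: "(real^2) set \<Rightarrow> (real^2 \<Rightarrow> real^2) \<Rightarrow> (real^2) set \<Rightarrow> bool" where
  "wandering_domain X F U \<longleftrightarrow>
     open U \<and> connected U \<and> (\<forall>m n. m \<noteq> n \<longrightarrow> pw_image X F m U \<inter> pw_image X F n U = {})"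

definition nontrivial_closed_interval :: "real set \<Rightarrow> bool" where
  "nontrivial_closed_interval I \<longleftrightarrow> (\<exists>a b. a < b \<and> I = {a..b})"

end

theory Submission
  imports Defs
begin

text \<open>The map expands by $\lambda$ and $\mu > \lambda$ in the two coordinate directions near a fixed
  point $p = (0,0)$ on the boundary of the rectangle and folds the plane there along the horizontal
  cut, $F(x,y) = (\lambda x, g(x) - \mu |y|)$; further to the right it exchanges the coordinates,
  $F(x,y) = (\lambda |y|, \lambda (x - 1))$. A small box near $p$ centred on the cut
  is folded into two halves with the same image, so its height shrinks by the factor $\mu/2$,
  while its width grows by $\lambda$; the exchange at the end of the stay lets the next stay shrink
  the other side. If stays have lengths $k_n$ with $k_{n+1} = K k_n$ and $\lambda$ is close to 1, both
  sides tend to 0 super-exponentially. Near $x = \lambda^{-j}$ the function $g$ is constant: it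
  recentres the folded box on the cut for $k_n < j \le k_{n+1}$, and at $j = k_n + 1$ it kicks the box off
  the cut. The kicks are summed in such a way that the box leaves the stay exactly at the height that makes the next
  stay last $k_{n+2}$ steps. As $k_{n+1} \ge 2 (r + 1) k_n$, these kicks are small enough for $g$ to
  be of class $C^r$ at 0.

  Along the orbit the derivative is diagonal or antidiagonal. As stay lengths grow
  geometrically and $\lambda \ne \mu$, the growth rate of every vector oscillates between values in
  $[\log \lambda, \log \mu]$. With $\mu = \lambda^{1+\sigma}$ and $g = O(\sigma)$ this interval
  shrinks to $\log \lambda$.\<close>

section \<open>Functions of class $C^n$ on the line\<close>

text \<open>Every branch enlarges areas, so a box that was never folded would outgrow the rectangle;
  folding is what makes a wandering box possible. The obstacle is that \<open>g\<close> is a single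
  function of x: its value near \<lambda>^-j is met in every stay that starts further left, although
  each stay needs its own correction. The way out is that each j lies in the folding range k_n < j
  \<le> k_{n+1} of at most one stay, and that all later stays pass j below the cut, where the map is
  affine. There \<open>g\<close> only translates the box and, in rescaled height, the sum Y + P_j is
  conserved. As P_0 = 0, whatever other stays required of \<open>g\<close> has cancelled when the
  box reaches the exit, and the exit height can be prescribed freely for each stay. Keeping
  \<open>g\<close> constant near each \<lambda>^-j has a second purpose: along the orbit the two
  coordinates never mix, so the shape of the box and the derivative are known exactly.\<close>

primrec Ck :: "nat \<Rightarrow> (real \<Rightarrow> real) \<Rightarrow> bool" where
  "Ck 0 f \<longleftrightarrow> continuous_on UNIV f"
| "Ck (Suc n) f \<longleftrightarrow> (\<forall>x. f differentiable (at x)) \<and> Ck n (deriv f)"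

lemma Ck_SucI:
  assumes "\<And>x. (f has_real_derivative f' x) (at x)" "Ck n f'"
  shows "Ck (Suc n) f"
proof -
  have "deriv f = f'" using assms(1) by (auto intro: DERIV_imp_deriv)
  then show ?thesis using assms by (auto simp: real_differentiable_def)
qed

lemma Ck_SucD:
  assumes "Ck (Suc n) f"
  shows "(f has_real_derivative deriv f x) (at x)"
  using assms by (metis Ck.simps(2) DERIV_deriv_iff_real_differentiable)

lemma Ck_continuous: "Ck n f \<Longrightarrow> continuous_on UNIV f"
proof (cases n)
  case (Suc m)
  assume "Ck n f"
  then show ?thesis
    using Suc by (metis Ck_SucD DERIV_isCont continuous_at_imp_continuous_on)
qed simp

lemma Ck_Suc_imp: "Ck (Suc n) f \<Longrightarrow> Ck n f"
proof (induction n arbitrary: f)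
  case 0
  then show ?case using Ck_continuous[of "Suc 0" f] by simp
qed simp

lemma Ck_mono:
  assumes "Ck n f" "m \<le> n"
  shows "Ck m f"
  using assms(2,1) by (induction rule: inc_induct) (auto intro: Ck_Suc_imp simp del: Ck.simps)

lemma Ck_const [simp]: "Ck n (\<lambda>x. c)"
  by (induction n arbitrary: c) auto

lemma Ck_id: "Ck n (\<lambda>x. x)"
  by (cases n) (auto intro: continuous_intros)

lemma Ck_add: "Ck n f \<Longrightarrow> Ck n g \<Longrightarrow> Ck n (\<lambda>x. f x + g x)"
proof (induction n arbitrary: f g)
  case 0
  then show ?case by (auto intro: continuous_intros)
next
  case (Suc n)
  then show ?case
    by (intro Ck_SucI[OF DERIV_add[OF Ck_SucD Ck_SucD]]) auto
qed

lemma Ck_mult: "Ck n f \<Longrightarrow> Ck n g \<Longrightarrow> Ck n (\<lambda>x. f x * g x)"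
proof (induction n arbitrary: f g)
  case 0
  then show ?case by (auto intro: continuous_intros)
next
  case (Suc n)
  have "Ck n (\<lambda>x. deriv f x * g x + deriv g x * f x)"
    using Suc Ck_Suc_imp by (intro Ck_add Suc.IH) auto
  then show ?case
    by (rule Ck_SucI[rotated]) (rule DERIV_mult[OF Ck_SucD[OF Suc.prems(1)] Ck_SucD[OF Suc.prems(2)]])
qed

lemma Ck_compose: "Ck n f \<Longrightarrow> Ck n g \<Longrightarrow> Ck n (\<lambda>x. f (g x))"
proof (induction n arbitrary: f g)
  case 0
  then show ?case by (auto intro: continuous_on_compose2)
next
  case (Suc n)
  have "Ck n (\<lambda>x. deriv f (g x) * deriv g x)"
    using Suc.IH[of "deriv f" g] Suc.prems Ck_Suc_imp[OF Suc.prems(2)] by (intro Ck_mult) auto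
  then show ?case
    by (rule Ck_SucI[rotated]) (rule DERIV_chain2[OF Ck_SucD[OF Suc.prems(1)] Ck_SucD[OF Suc.prems(2)]])
qed

text \<open>As r is finite, truncated powers can serve as building blocks of cut-off functions.
  Differentiation turns the exponent n + 2 into n + 1, which matches the induction; at 0 the
  difference quotient is again a truncated power.\<close>

lemma Ck_max_power: "Ck n (\<lambda>t. (max 0 t) ^ Suc n)"
proof (induction n)
  case 0
  then show ?case by (auto intro: continuous_intros)
next
  case (Suc n)
  have "((\<lambda>t. (max 0 t) ^ Suc (Suc n)) has_real_derivative real (Suc (Suc n)) * (max 0 x) ^ Suc n) (at x)" for x :: real
  proof -
    have pos: "((\<lambda>t. (max 0 t) ^ Suc (Suc n)) has_real_derivative real (Suc (Suc n)) * (max 0 x) ^ Suc n) (at x)"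
      if "x > 0"
    proof (rule has_field_derivative_transform_within_open[of "\<lambda>t. t ^ Suc (Suc n)" _ _ "{0<..}"])
      show "((\<lambda>t. t ^ Suc (Suc n)) has_real_derivative real (Suc (Suc n)) * (max 0 x) ^ Suc n) (at x)"
        using DERIV_pow[of "Suc (Suc n)" x] that by (simp add: max_def)
    qed (use that in auto)
    have neg: "((\<lambda>t. (max 0 t) ^ Suc (Suc n)) has_real_derivative real (Suc (Suc n)) * (max 0 x) ^ Suc n) (at x)"
      if "x < 0"
    proof (rule has_field_derivative_transform_within_open[of "\<lambda>t. 0" _ _ "{..<0}"])
      show "((\<lambda>t. 0) has_real_derivative real (Suc (Suc n)) * (max 0 x) ^ Suc n) (at x)"
        using that by (auto intro!: derivative_eq_intros simp: max_def)
    qed (use that in auto)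
    have zero: "((\<lambda>t. (max 0 t) ^ Suc (Suc n)) has_real_derivative 0) (at (0::real))"
    proof -
      have "(\<lambda>h::real. (max 0 h) ^ Suc n * (if h > 0 then 1 else 0)) \<midarrow>0\<rightarrow> 0"
      proof (rule Lim_null_comparison)
        show "\<forall>\<^sub>F h::real in at 0. norm ((max 0 h) ^ Suc n * (if h > 0 then 1 else 0)) \<le> (max 0 h) ^ Suc n"
          by (intro always_eventually) auto
        have "isCont (\<lambda>h::real. (max 0 h) ^ Suc n) 0" by (intro continuous_intros)
        then show "(\<lambda>h::real. (max 0 h) ^ Suc n) \<midarrow>0\<rightarrow> 0" by (simp add: isCont_def)
      qed
      moreover have "((max 0 (0 + h)) ^ Suc (Suc n) - (max 0 0) ^ Suc (Suc n)) / h
          = (max 0 h) ^ Suc n * (if h > 0 then 1 else 0)" for h :: real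
        by (auto simp: max_def)
      ultimately show ?thesis unfolding DERIV_def by presburger
    qed
    show ?thesis using pos neg zero by (cases "x = 0"; cases "x > 0") auto
  qed
  moreover have "Ck n (\<lambda>x. real (Suc (Suc n)) * (max 0 x) ^ Suc n)"
    using Suc by (intro Ck_mult) auto
  ultimately show ?case by (rule Ck_SucI)
qed

text \<open>The quadratic \<open>?u\<close> is at most 0 for |t - 1| \<le> d and at least 3 for |t -
  1| \<ge> 2d. With the truncated power m, the expression 1 - m(u) is therefore 1 in the first
  region and nonpositive in the second, and the outer m replaces negative values by 0.\<close>

lemma Ck_plateau:
  assumes "d > 0"
  obtains \<psi> where "Ck n \<psi>" "\<And>t. \<bar>t - 1\<bar> \<le> d \<Longrightarrow> \<psi> t = 1" "\<And>t. \<bar>t - 1\<bar> \<ge> 2 * d \<Longrightarrow> \<psi> t = 0"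
proof
  let ?m = "\<lambda>t::real. (max 0 t) ^ Suc n"
  let ?u = "\<lambda>t. ((t - 1) * (t - 1) + - (d * d)) * (1 / (d * d))"
  let ?\<psi> = "\<lambda>t. ?m (1 + (-1) * ?m (?u t))"
  have m: "Ck n ?m" by (rule Ck_max_power)
  have "Ck n (\<lambda>t. t - 1)" using Ck_add[OF Ck_id, of n "\<lambda>x. -1"] by simp
  then have "Ck n ?u" by (intro Ck_mult Ck_add) auto
  from Ck_compose[OF m this] have "Ck n (\<lambda>t. 1 + (-1) * ?m (?u t))"
    by (intro Ck_mult Ck_add) auto
  from Ck_compose[OF m this] show "Ck n ?\<psi>" .
  show "?\<psi> t = 1" if "\<bar>t - 1\<bar> \<le> d" for t
  proof -
    have "(t - 1) * (t - 1) \<le> d * d" using that assms by (metis abs_le_square_iff abs_of_pos power2_eq_square)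
    then have "?u t \<le> 0" by (intro mult_nonpos_nonneg) auto
    then have "?m (?u t) = 0" by (simp only: max_absorb1) simp
    then show ?thesis by (simp only:) simp
  qed
  show "?\<psi> t = 0" if "\<bar>t - 1\<bar> \<ge> 2 * d" for t
  proof -
    have "(2 * d)\<^sup>2 \<le> (t - 1)\<^sup>2" using that assms by (metis abs_le_square_iff abs_of_pos mult_pos_pos zero_less_numeral)
    then have "(t - 1) * (t - 1) \<ge> 4 * (d * d)" by (simp add: power2_eq_square)
    then have "?u t \<ge> (3 * (d * d)) * (1 / (d * d))" by (intro mult_right_mono) auto
    moreover have "(3 * (d * d)) * (1 / (d * d)) = 3" using assms by simp
    ultimately have "?u t \<ge> 1" by linarith
    then have "max 0 (?u t) \<ge> 1" by simp
    then have "?m (?u t) \<ge> 1" by (rule one_le_power)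
    then have "max 0 (1 + (-1) * ?m (?u t)) = 0" by linarith
    then show ?thesis by (simp only:) simp
  qed
qed

section \<open>Derivatives of higher order and series of bumps\<close>

lemma Ck_deriv_pow: "Ck n f \<Longrightarrow> i \<le> n \<Longrightarrow> Ck (n - i) ((deriv ^^ i) f)"
proof (induction i)
  case (Suc i)
  then have "Ck (Suc (n - Suc i)) ((deriv ^^ i) f)" by (simp add: Suc_diff_Suc del: Ck.simps)
  then show ?case by simp
qed simp

lemma Ck_deriv_pow_DERIV:
  "Ck n f \<Longrightarrow> i < n \<Longrightarrow> ((deriv ^^ i) f has_real_derivative (deriv ^^ Suc i) f x) (at x)"
  using Ck_deriv_pow[of n f i] Ck_SucD[of "n - Suc i" "(deriv ^^ i) f" x]
  by (simp add: Suc_diff_Suc del: Ck.simps)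

lemma deriv_pow_chain:
  assumes "\<And>i x. i < n \<Longrightarrow> (D i has_real_derivative D (Suc i) x) (at x)"
  shows "i \<le> n \<Longrightarrow> (deriv ^^ i) (D 0) = D i"
  by (induction i) (use assms in \<open>auto intro!: ext DERIV_imp_deriv\<close>)

text \<open>For a function given as a series the derivatives are known only as candidate sums; here
  they can be supplied as the sequence \<open>D\<close>.\<close>

lemma Ck_chain:
  assumes "\<And>i x. i < n \<Longrightarrow> (D i has_real_derivative D (Suc i) x) (at x)" "continuous_on UNIV (D n)"
  shows "Ck n (D 0)"
proof -
  have "Ck (n - i) (D i)" if "i \<le> n" for i
    using that
  proof (induction rule: inc_induct)
    case base
    then show ?case using assms by simp
  next
    case (step m)
    then have "Ck (Suc (n - Suc m)) (D m)" using assms(1) by (intro Ck_SucI) auto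
    then show ?case using step by (simp add: Suc_diff_Suc del: Ck.simps)
  qed
  from this[of 0] show ?thesis by simp
qed

lemma deriv_pow_zero_on_open:
  assumes "open S" "\<And>x. x \<in> S \<Longrightarrow> f x = 0" "x \<in> S"
  shows "(deriv ^^ i) f x = 0"
  using assms(3)
proof (induction i arbitrary: x)
  case (Suc i)
  have "((deriv ^^ i) f has_field_derivative 0) (at x)"
    by (rule has_field_derivative_transform_within_open[of "\<lambda>_. 0" _ _ S])
       (use assms(1) Suc in auto)
  then show ?case by (simp add: DERIV_imp_deriv)
qed (use assms in auto)

lemma Ck_compact_support_bounded:
  assumes "Ck n f" "\<And>t. t \<notin> {a..b} \<Longrightarrow> f t = 0"
  obtains B where "B > 0" "\<And>i t. i \<le> n \<Longrightarrow> \<bar>(deriv ^^ i) f t\<bar> \<le> B"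
proof -
  have "\<exists>B. \<forall>t. \<bar>(deriv ^^ i) f t\<bar> \<le> B" if "i \<le> n" for i
  proof -
    have "continuous_on UNIV ((deriv ^^ i) f)"
      using Ck_deriv_pow[OF assms(1) that] Ck_continuous by blast
    then have "continuous_on {a..b} ((deriv ^^ i) f)" using continuous_on_subset by blast
    then have "bounded ((deriv ^^ i) f ` {a..b})"
      by (intro compact_imp_bounded compact_continuous_image) auto
    then obtain B where B: "\<And>t. t \<in> {a..b} \<Longrightarrow> \<bar>(deriv ^^ i) f t\<bar> \<le> B"
      unfolding bounded_iff real_norm_def by blast
    have "(deriv ^^ i) f t = 0" if "t \<notin> {a..b}" for t
      by (rule deriv_pow_zero_on_open[of "- {a..b}"]) (use assms that in \<open>auto intro: open_Compl\<close>)
    then have "\<bar>(deriv ^^ i) f t\<bar> \<le> max B 0" for t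
      using B[of t] by (cases "t \<in> {a..b}") auto
    then show ?thesis by blast
  qed
  then obtain B where B: "\<And>i t. i \<le> n \<Longrightarrow> \<bar>(deriv ^^ i) f t\<bar> \<le> B i" by metis
  show thesis
  proof (rule that[of "1 + (\<Sum>i\<le>n. \<bar>B i\<bar>)"])
    fix i t assume i: "i \<le> n"
    have "B i \<le> \<bar>B i\<bar>" by simp
    also have "\<dots> \<le> (\<Sum>i\<le>n. \<bar>B i\<bar>)" using i by (intro member_le_sum) auto
    finally show "\<bar>(deriv ^^ i) f t\<bar> \<le> 1 + (\<Sum>i\<le>n. \<bar>B i\<bar>)" using B[OF i, of t] by linarith
  qed (simp add: add_pos_nonneg sum_nonneg)
qed

text \<open>The $i$-th derivative of $b_j \psi(\lambda^j x)$ has size $b_j \lambda^{ij}$, so decay of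
  $b_j$ faster than $\lambda^{-nj}$ keeps the sum of class $C^n$ at the accumulation point 0.\<close>

lemma Ck_bump_series:
  fixes lam :: real and b :: "nat \<Rightarrow> real"
  assumes psi: "Ck n \<psi>" and B: "\<And>i t. i \<le> n \<Longrightarrow> \<bar>(deriv ^^ i) \<psi> t\<bar> \<le> B"
    and lam: "lam > 1" and b: "\<And>j. \<bar>b j\<bar> \<le> C * (1 / lam) ^ (Suc n * j)"
  defines "f \<equiv> \<lambda>x. \<Sum>j. b j * \<psi> (lam ^ j * x)"
  shows "Ck n f"
    and "\<And>i x. i \<le> n \<Longrightarrow> \<bar>(deriv ^^ i) f x\<bar> \<le> C * B * (\<Sum>j. (1 / lam) ^ j)"
proof -
  define D where "D i x = (\<Sum>j. b j * lam ^ (i * j) * (deriv ^^ i) \<psi> (lam ^ j * x))" for i x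
  \<comment> \<open>Of the decay exponent \<open>Suc n * j\<close>, the part \<open>n * j\<close>
    pays for the factors produced by differentiation; the remaining j leaves a geometric
    majorant.\<close>
  let ?M = "\<lambda>j. C * B * (1 / lam) ^ j"
  have C: "C \<ge> 0" using b[of 0] by auto
  have B0: "B \<ge> 0" using B[of 0 0] by auto
  have bnd: "norm (b j * lam ^ (i * j) * (deriv ^^ i) \<psi> (lam ^ j * x)) \<le> ?M j" if "i \<le> n" for i j x
  proof -
    have "\<bar>b j * lam ^ (i * j)\<bar> \<le> C * (1 / lam) ^ (Suc n * j) * lam ^ (n * j)"
      unfolding abs_mult using lam that
      by (intro mult_mono b) (auto simp: power_increasing intro!: mult_nonneg_nonneg C)
    also have "\<dots> = C * (1 / lam) ^ j"
      using lam by (simp add: power_add power_divide field_simps)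
    finally have "\<bar>b j * lam ^ (i * j)\<bar> \<le> C * (1 / lam) ^ j" .
    then have "\<bar>b j * lam ^ (i * j)\<bar> * \<bar>(deriv ^^ i) \<psi> (lam ^ j * x)\<bar> \<le> (C * (1 / lam) ^ j) * B"
      using B[OF that] lam C by (intro mult_mono) auto
    then show ?thesis by (simp add: abs_mult algebra_simps)
  qed
  have geo: "summable (\<lambda>j. (1 / lam) ^ j)" using lam by (intro summable_geometric) auto
  have sM: "summable ?M" using geo by (intro summable_mult) 
  have unif: "uniform_limit UNIV (\<lambda>m x. \<Sum>j<m. b j * lam ^ (i * j) * (deriv ^^ i) \<psi> (lam ^ j * x)) (D i) sequentially"
    if "i \<le> n" for i
    unfolding D_def by (rule Weierstrass_m_test[OF _ sM]) (use bnd[OF that] in auto)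
  have der: "(D i has_real_derivative D (Suc i) x) (at x)" if "i < n" for i x
  proof -
    have "((\<lambda>x. \<Sum>j. b j * lam ^ (i * j) * (deriv ^^ i) \<psi> (lam ^ j * x)) has_real_derivative
            (\<Sum>j. b j * lam ^ (Suc i * j) * (deriv ^^ Suc i) \<psi> (lam ^ j * x))) (at x)"
    proof (rule has_field_derivative_series'(2)[where S = "UNIV :: real set" and ?x0.0 = 0
          and f = "\<lambda>j x. b j * lam ^ (i * j) * (deriv ^^ i) \<psi> (lam ^ j * x)"
          and f' = "\<lambda>j x. b j * lam ^ (Suc i * j) * (deriv ^^ Suc i) \<psi> (lam ^ j * x)"])
      fix j x
      have "((\<lambda>x. (deriv ^^ i) \<psi> (lam ^ j * x)) has_real_derivative (deriv ^^ Suc i) \<psi> (lam ^ j * x) * lam ^ j) (at x)"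
        by (rule DERIV_chain2[OF Ck_deriv_pow_DERIV[OF psi that]]) (auto intro!: derivative_eq_intros)
      from DERIV_cmult[OF this, of "b j * lam ^ (i * j)"]
      show "((\<lambda>x. b j * lam ^ (i * j) * (deriv ^^ i) \<psi> (lam ^ j * x)) has_real_derivative
          b j * lam ^ (Suc i * j) * (deriv ^^ Suc i) \<psi> (lam ^ j * x)) (at x within UNIV)"
        by (simp add: power_add mult_ac)
    next
      show "uniformly_convergent_on UNIV (\<lambda>m x. \<Sum>j<m. b j * lam ^ (Suc i * j) * (deriv ^^ Suc i) \<psi> (lam ^ j * x))"
        using unif[of "Suc i"] that unfolding uniformly_convergent_on_def by auto
      show "summable (\<lambda>j. b j * lam ^ (i * j) * (deriv ^^ i) \<psi> (lam ^ j * 0))"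
        using bnd[OF less_imp_le[OF that], of _ 0] by (intro summable_comparison_test'[OF sM, of 0]) auto
    qed auto
    then show ?thesis unfolding D_def .
  qed
  have cont: "continuous_on UNIV (D n)"
  proof (rule uniform_limit_theorem[OF _ unif])
    have "continuous_on UNIV ((deriv ^^ n) \<psi>)"
      using Ck_deriv_pow[OF psi, of n] by simp
    then have "continuous_on UNIV (\<lambda>x. (deriv ^^ n) \<psi> (lam ^ j * x))" for j
      by (rule continuous_on_compose2) (auto intro: continuous_intros)
    then show "\<forall>\<^sub>F m in sequentially. continuous_on UNIV (\<lambda>x. \<Sum>j<m. b j * lam ^ (n * j) * (deriv ^^ n) \<psi> (lam ^ j * x))"
      by (intro always_eventually allI continuous_on_sum continuous_on_mult continuous_on_const)
  qed auto
  have f: "f = D 0" unfolding f_def D_def by simp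
  show "Ck n f" unfolding f by (rule Ck_chain[where D = D, OF der cont])
  fix i x assume i: "i \<le> n"
  have "(deriv ^^ i) f x = D i x" unfolding f using deriv_pow_chain[where D = D, OF der i] by simp
  moreover have "\<bar>D i x\<bar> \<le> (\<Sum>j. ?M j)"
    unfolding D_def using norm_suminf_le[OF bnd[OF i] sM] by simp
  moreover have "(\<Sum>j. ?M j) = C * B * (\<Sum>j. (1 / lam) ^ j)" using geo by (rule suminf_mult)
  ultimately show "\<bar>(deriv ^^ i) f x\<bar> \<le> C * B * (\<Sum>j. (1 / lam) ^ j)" by simp
qed

section \<open>Shears and swaps of the plane\<close>

lemma vec2_eq_iff: "(z :: 'a^2) = w \<longleftrightarrow> z $ 1 = w $ 1 \<and> z $ 2 = w $ 2"
  by (simp add: vec_eq_iff forall_2)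

lemma norm_vec2: "norm (z :: real^2) = sqrt ((z $ 1)\<^sup>2 + (z $ 2)\<^sup>2)"
  by (simp add: norm_vec_def L2_set_def UNIV_2)

lemma Cr_on_cong:
  assumes "Cr_on n f S" "open S" "\<And>x. x \<in> S \<Longrightarrow> f x = h x"
  shows "Cr_on n h S"
  using assms(1,3)
proof (induction n arbitrary: f h)
  case 0
  then show ?case by (simp cong: continuous_on_cong)
next
  case (Suc n)
  have der: "(h has_derivative frechet_derivative f (at x)) (at x)" if "x \<in> S" for x
  proof (rule has_derivative_transform_within_open[OF _ assms(2) that])
    show "(f has_derivative frechet_derivative f (at x)) (at x)"
      using Suc.prems(1) that by (simp add: frechet_derivative_works[symmetric])
  qed (use Suc.prems(2) in auto)
  have eq: "frechet_derivative h (at x) = frechet_derivative f (at x)" if "x \<in> S" for x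
    by (rule frechet_derivative_at[OF der[OF that], symmetric])
  have "Cr_on n (\<lambda>x. frechet_derivative h (at x) v) S" for v
  proof (rule Suc.IH)
    show "Cr_on n (\<lambda>x. frechet_derivative f (at x) v) S" using Suc.prems(1) by simp
  qed (simp add: eq)
  moreover have "h differentiable (at x)" if "x \<in> S" for x
    using der[OF that] by (rule differentiableI)
  ultimately show ?case by simp
qed

lemma Cr_on_subset: "Cr_on n f T \<Longrightarrow> S \<subseteq> T \<Longrightarrow> Cr_on n f S"
  by (induction n arbitrary: f) (auto intro: continuous_on_subset)

lemma Cr_on_UN:
  assumes "\<And>i. i \<in> I \<Longrightarrow> open (P i)" "\<And>i. i \<in> I \<Longrightarrow> Cr_on n f (P i)"
  shows "Cr_on n f (\<Union>i\<in>I. P i)"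
  using assms(2)
proof (induction n arbitrary: f)
  case 0
  then show ?case using assms(1) by (simp add: continuous_on_open_UN)
qed simp

lemma scalar_shear_has_derivative:
  fixes L :: "real^2 \<Rightarrow> real^2"
  assumes "bounded_linear L" "(g has_real_derivative d) (at (z $ 1))"
  shows "((\<lambda>z. L z + g (z $ 1) *\<^sub>R u + w) has_derivative (\<lambda>v. L v + (d * v $ 1) *\<^sub>R u)) (at z)"
proof -
  have "((\<lambda>z::real^2. z $ 1) has_derivative (\<lambda>v. v $ 1)) (at z)"
    by (rule bounded_linear_imp_has_derivative) (rule bounded_linear_vec_nth)
  from has_derivative_compose[OF this] assms(2)
  have "((\<lambda>z. g (z $ 1)) has_derivative (\<lambda>v. d * v $ 1)) (at z)"
    unfolding has_field_derivative_def by blast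
  moreover have "(L has_derivative L) (at z)"
    using assms(1) by (rule bounded_linear_imp_has_derivative)
  ultimately have "((\<lambda>z. L z + g (z $ 1) *\<^sub>R u + w) has_derivative (\<lambda>v. L v + (d * v $ 1) *\<^sub>R u + 0)) (at z)"
    by (intro has_derivative_add has_derivative_scaleR_left has_derivative_const)
  then show ?thesis by simp
qed

lemma frechet_derivative_scalar_shear:
  fixes L :: "real^2 \<Rightarrow> real^2"
  assumes "bounded_linear L" "Ck (Suc n) g"
  shows "frechet_derivative (\<lambda>z. L z + g (z $ 1) *\<^sub>R u + w) (at z) v
    = L v + (deriv g (z $ 1) * v $ 1) *\<^sub>R u"
  by (rule fun_cong[OF frechet_derivative_at[OF scalar_shear_has_derivative[OF assms(1) Ck_SucD[OF assms(2)]], symmetric]])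

text \<open>All branches have the form L z + g(z_1) u + w. A directional derivative has this form
  again, with linear part 0, a multiple of g' as profile and the constant L v, so the induction on n
  stays inside the family.\<close>

lemma Cr_on_scalar_shear:
  fixes L :: "real^2 \<Rightarrow> real^2"
  assumes "bounded_linear L" "Ck n g"
  shows "Cr_on n (\<lambda>z. L z + g (z $ 1) *\<^sub>R u + w) S"
proof (rule Cr_on_subset[where T = UNIV])
  show "Cr_on n (\<lambda>z. L z + g (z $ 1) *\<^sub>R u + w) UNIV"
    using assms
  proof (induction n arbitrary: L g w)
    case 0
    have "continuous_on UNIV L" using 0 by (simp add: linear_continuous_on)
    moreover have "continuous_on UNIV (\<lambda>z::real^2. g (z $ 1))"
      using 0 by (auto intro: continuous_on_compose2 intro!: continuous_intros)
    ultimately show ?case by (auto intro!: continuous_intros)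
  next
    case (Suc n)
    have "Cr_on n (\<lambda>z::real^2. 0 + ((deriv g (z $ 1) * v $ 1) *\<^sub>R u) + L v) UNIV" for v
      using Suc.prems
      by (intro Suc.IH[of "\<lambda>_. 0" "\<lambda>x. deriv g x * v $ 1"] Ck_mult) auto
    then have "Cr_on n (\<lambda>z::real^2. L v + (deriv g (z $ 1) * v $ 1) *\<^sub>R u) UNIV" for v
      by (simp add: add.commute)
    moreover have "(\<lambda>z. L z + g (z $ 1) *\<^sub>R u + w) differentiable (at z)" for z
      using scalar_shear_has_derivative[OF Suc.prems(1) Ck_SucD[OF Suc.prems(2)]]
      by (meson differentiableI)
    ultimately show ?case by (simp add: frechet_derivative_scalar_shear[OF Suc.prems])
  qed
qed simp

text \<open>The slope \<open>m\<close> may be negative: the two sides of the fold are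
  \<open>br\<close> with opposite slopes.\<close>

definition br :: "real \<Rightarrow> real \<Rightarrow> (real \<Rightarrow> real) \<Rightarrow> real^2 \<Rightarrow> real^2" where
  "br l m g z = vector [l * z $ 1, m * z $ 2 + g (z $ 1)]"

definition sw :: "real \<Rightarrow> real \<Rightarrow> real \<Rightarrow> real^2 \<Rightarrow> real^2" where
  "sw l a b z = vector [l * z $ 2 + a, l * z $ 1 + b]"

lemma bounded_linear_vector2:
  "bounded_linear (\<lambda>z::real^2. vector [a * z $ 1 + b * z $ 2, c * z $ 1 + d * z $ 2] :: real^2)"
  by (intro linear_conv_bounded_linear[THEN iffD1] linearI)
     (auto simp: vec2_eq_iff algebra_simps)

lemma br_shear: "br l m g = (\<lambda>z. vector [l * z $ 1 + 0 * z $ 2, 0 * z $ 1 + m * z $ 2] + g (z $ 1) *\<^sub>R axis 2 1 + 0)"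
  by (auto simp: br_def fun_eq_iff vec2_eq_iff axis_def)

lemma sw_shear: "sw l a b = (\<lambda>z. vector [0 * z $ 1 + l * z $ 2, l * z $ 1 + 0 * z $ 2] + (\<lambda>_. 0) (z $ 1) *\<^sub>R axis 2 1 + vector [a, b])"
  by (auto simp: sw_def fun_eq_iff vec2_eq_iff)

lemma br_Cr: "Ck n g \<Longrightarrow> Cr_on n (br l m g) S"
  unfolding br_shear by (rule Cr_on_scalar_shear[OF bounded_linear_vector2])

lemma sw_Cr: "Cr_on n (sw l a b) S"
  unfolding sw_shear by (rule Cr_on_scalar_shear[OF bounded_linear_vector2 Ck_const])

lemma br_has_derivative:
  assumes "(g has_real_derivative d) (at (z $ 1))"
  shows "(br l m g has_derivative (\<lambda>v. vector [l * v $ 1, m * v $ 2 + d * v $ 1])) (at z)"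
proof -
  have eq: "(\<lambda>v::real^2. vector [l * v $ 1, m * v $ 2 + d * v $ 1] :: real^2) =
    (\<lambda>v. vector [l * v $ 1 + 0 * v $ 2, 0 * v $ 1 + m * v $ 2] + (d * v $ 1) *\<^sub>R axis 2 1)"
    by (auto simp: fun_eq_iff vec2_eq_iff axis_def)
  show ?thesis
    unfolding br_shear eq by (rule scalar_shear_has_derivative[OF bounded_linear_vector2 assms])
qed

lemma sw_has_derivative:
  "(sw l a b has_derivative (\<lambda>v. vector [l * v $ 2, l * v $ 1])) (at z)"
proof -
  have eq: "(\<lambda>v::real^2. vector [l * v $ 2, l * v $ 1] :: real^2) =
    (\<lambda>v. vector [0 * v $ 1 + l * v $ 2, l * v $ 1 + 0 * v $ 2] + (0 * v $ 1) *\<^sub>R axis 2 1)"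
    by (auto simp: fun_eq_iff vec2_eq_iff)
  show ?thesis
    unfolding sw_shear eq
    by (rule scalar_shear_has_derivative[where g = "\<lambda>_. 0", OF bounded_linear_vector2 DERIV_const])
qed

text \<open>The branches are diffeomorphisms of the whole plane, so \<open>UNIV\<close> can serve as
  the neighbourhood of every piece.\<close>

lemma Cr_diffeo_UNIV:
  assumes "\<And>z. h (f z) = z" "\<And>z. f (h z) = z" "Cr_on r f UNIV" "Cr_on r h UNIV"
  shows "Cr_diffeo_onto_image r f UNIV"
proof -
  have surj: "range f = UNIV" using assms(2) by (metis surj_def)
  have inj: "inj f" using assms(1) by (metis injI)
  have "inv_into UNIV f = h" using inj assms(2) by (metis ext inv_f_eq)
  then show ?thesis using surj inj assms unfolding Cr_diffeo_onto_image_def by simp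
qed

lemma br_inverse:
  assumes "l \<noteq> 0" "m \<noteq> 0"
  shows "br (1 / l) (1 / m) (\<lambda>x. - (1 / m) * g ((1 / l) * x)) (br l m g z) = z"
    "br l m g (br (1 / l) (1 / m) (\<lambda>x. - (1 / m) * g ((1 / l) * x)) z) = z"
  using assms by (auto simp: br_def vec2_eq_iff field_simps)

lemma br_inverse_Ck: "Ck n g \<Longrightarrow> Ck n (\<lambda>x. - (1 / m) * g ((1 / l) * x))"
  using Ck_compose[OF _ Ck_mult[OF Ck_const[of n "1 / l"] Ck_id]] by (intro Ck_mult Ck_const)

lemma sw_inverse:
  assumes "l \<noteq> 0"
  shows "sw (1 / l) (- b / l) (- a / l) (sw l a b z) = z"
    "sw l a b (sw (1 / l) (- b / l) (- a / l) z) = z"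
  using assms by (auto simp: sw_def vec2_eq_iff field_simps)

lemma br_diffeo: "Ck r g \<Longrightarrow> l \<noteq> 0 \<Longrightarrow> m \<noteq> 0 \<Longrightarrow> Cr_diffeo_onto_image r (br l m g) UNIV"
  by (rule Cr_diffeo_UNIV[where h = "br (1 / l) (1 / m) (\<lambda>x. - (1 / m) * g ((1 / l) * x))"])
     (assumption | rule br_inverse br_Cr br_inverse_Ck)+

lemma sw_diffeo: "l \<noteq> 0 \<Longrightarrow> Cr_diffeo_onto_image r (sw l a b) UNIV"
  by (rule Cr_diffeo_UNIV[where h = "sw (1 / l) (- b / l) (- a / l)"]) (assumption | rule sw_inverse sw_Cr)+

lemma norm_vector2_ge:
  assumes "l \<ge> 0" "\<bar>a\<bar> \<ge> l * \<bar>v $ 1\<bar>" "\<bar>b\<bar> \<ge> l * \<bar>v $ 2\<bar>"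
  shows "norm (vector [a, b] :: real^2) \<ge> l * norm (v :: real^2)"
proof -
  have "(l * \<bar>v $ 1\<bar>)\<^sup>2 \<le> \<bar>a\<bar>\<^sup>2" "(l * \<bar>v $ 2\<bar>)\<^sup>2 \<le> \<bar>b\<bar>\<^sup>2" using assms by (intro power_mono; simp)+
  then have "l\<^sup>2 * ((v $ 1)\<^sup>2 + (v $ 2)\<^sup>2) \<le> a\<^sup>2 + b\<^sup>2" by (simp add: power_mult_distrib algebra_simps)
  then have "sqrt (l\<^sup>2 * ((v $ 1)\<^sup>2 + (v $ 2)\<^sup>2)) \<le> sqrt (a\<^sup>2 + b\<^sup>2)" by (rule real_sqrt_le_mono)
  moreover have "sqrt (l\<^sup>2 * ((v $ 1)\<^sup>2 + (v $ 2)\<^sup>2)) = l * norm v"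
    using assms(1) by (simp add: norm_vec2 real_sqrt_mult)
  moreover have "norm (vector [a, b] :: real^2) = sqrt (a\<^sup>2 + b\<^sup>2)"
    by (simp add: norm_vec2)
  ultimately show ?thesis by linarith
qed

text \<open>The shear is treated as a perturbation: the diagonal part expands by l and the
  off-diagonal entry g' costs at most \<eta>.\<close>

lemma br_expanding:
  assumes "Ck (Suc n) g" "\<bar>deriv g (z $ 1)\<bar> \<le> \<eta>" "l > 0" "\<bar>m\<bar> \<ge> l"
  shows "norm (frechet_derivative (br l m g) (at z) v) \<ge> (l - \<eta>) * norm v"
proof -
  have eq: "frechet_derivative (br l m g) (at z) v = vector [l * v $ 1, m * v $ 2 + deriv g (z $ 1) * v $ 1]"
    by (rule fun_cong[OF frechet_derivative_at[OF br_has_derivative[OF Ck_SucD[OF assms(1)]], symmetric]])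
  have "l * norm v \<le> norm (vector [l * v $ 1, m * v $ 2] :: real^2)"
    using assms by (intro norm_vector2_ge) (auto simp: abs_mult intro: mult_right_mono)
  also have "(vector [l * v $ 1, m * v $ 2] :: real^2)
      = vector [l * v $ 1, m * v $ 2 + deriv g (z $ 1) * v $ 1] - vector [0, deriv g (z $ 1) * v $ 1]"
    by (simp add: vec2_eq_iff)
  also have "norm \<dots> \<le> norm (vector [l * v $ 1, m * v $ 2 + deriv g (z $ 1) * v $ 1] :: real^2)
      + norm (vector [0, deriv g (z $ 1) * v $ 1] :: real^2)"
    by (rule norm_triangle_ineq4)
  also have "norm (vector [0, deriv g (z $ 1) * v $ 1] :: real^2) = \<bar>deriv g (z $ 1)\<bar> * \<bar>v $ 1\<bar>"
    by (simp add: norm_vec2 abs_mult)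
  also have "\<dots> \<le> \<eta> * norm v"
    using assms(2) by (intro mult_mono component_le_norm_cart) auto
  finally show ?thesis unfolding eq by (simp add: algebra_simps)
qed

lemma sw_expanding:
  assumes "l > 0"
  shows "norm (frechet_derivative (sw l a b) (at z) v) = l * norm v"
proof -
  have eq: "frechet_derivative (sw l a b) (at z) v = vector [l * v $ 2, l * v $ 1]"
    by (rule fun_cong[OF frechet_derivative_at[OF sw_has_derivative, symmetric]])
  have "(l * v $ 2)\<^sup>2 + (l * v $ 1)\<^sup>2 = l\<^sup>2 * ((v $ 1)\<^sup>2 + (v $ 2)\<^sup>2)"
    by (simp add: power_mult_distrib algebra_simps)
  then show ?thesis using assms unfolding eq by (simp add: norm_vec2 real_sqrt_mult)
qed

section \<open>Iterated derivatives and convergence of the branches\<close>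

lemma iter_deriv_scalar_profile:
  assumes "Ck n g" "length vs \<le> n"
  shows "iter_deriv vs (\<lambda>z::real^2. c + (a * g (z $ 1)) *\<^sub>R u) z =
    (if vs = [] then c else 0) + (a * prod_list (map (\<lambda>v. v $ 1) vs) * (deriv ^^ length vs) g (z $ 1)) *\<^sub>R (u :: real^2)"
  using assms
proof (induction vs arbitrary: n g c a)
  case (Cons v vs)
  then obtain m where m: "n = Suc m" by (cases n) auto
  have "Ck (Suc m) (\<lambda>x. a * g x)" using Cons.prems(1) unfolding m by (intro Ck_mult) auto
  moreover have "deriv (\<lambda>x. a * g x) x = a * deriv g x" for x
    using Ck_SucD[OF Cons.prems(1)[unfolded m]] by (intro DERIV_imp_deriv DERIV_cmult)
  ultimately have "frechet_derivative (\<lambda>z::real^2. 0 + (a * g (z $ 1)) *\<^sub>R u + c) (at z) v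
      = 0 + ((a * v $ 1) * deriv g (z $ 1)) *\<^sub>R u" for z
    using frechet_derivative_scalar_shear[of "\<lambda>_. 0" m "\<lambda>x. a * g x" u c z v] by (simp add: mult_ac)
  moreover have "(\<lambda>z::real^2. c + (a * g (z $ 1)) *\<^sub>R u) = (\<lambda>z. 0 + (a * g (z $ 1)) *\<^sub>R u + c)"
    by (simp add: add.commute)
  ultimately have "iter_deriv (v # vs) (\<lambda>z::real^2. c + (a * g (z $ 1)) *\<^sub>R u) z
      = iter_deriv vs (\<lambda>z. 0 + ((a * v $ 1) * deriv g (z $ 1)) *\<^sub>R u) z" by simp
  also have "\<dots> = 0 + ((a * v $ 1) * prod_list (map (\<lambda>v. v $ 1) vs) * (deriv ^^ length vs) (deriv g) (z $ 1)) *\<^sub>R u"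
    using Cons.IH[of m "deriv g" 0 "a * v $ 1"] Cons.prems m by simp
  finally show ?case by (simp add: funpow_swap1 mult_ac)
qed auto

lemma iter_deriv_br:
  assumes "Ck n g" "length vs \<le> n"
  shows "iter_deriv vs (br l m g) z =
    (case vs of [] \<Rightarrow> vector [l * z $ 1, m * z $ 2] | [v] \<Rightarrow> vector [l * v $ 1, m * v $ 2] | _ \<Rightarrow> 0)
    + (prod_list (map (\<lambda>v. v $ 1) vs) * (deriv ^^ length vs) g (z $ 1)) *\<^sub>R axis 2 1"
proof (cases vs)
  case Nil
  then show ?thesis by (simp add: br_def vec2_eq_iff axis_def)
next
  case (Cons v ws)
  then obtain p where n: "n = Suc p" using assms(2) by (cases n) auto
  have "frechet_derivative (br l m g) (at y) v = vector [l * v $ 1, m * v $ 2] + (v $ 1 * deriv g (y $ 1)) *\<^sub>R axis 2 1" for y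
    unfolding br_shear frechet_derivative_scalar_shear[OF bounded_linear_vector2 assms(1)[unfolded n]]
    by (simp add: mult_ac)
  then have "iter_deriv vs (br l m g) z
      = iter_deriv ws (\<lambda>y. vector [l * v $ 1, m * v $ 2] + (v $ 1 * deriv g (y $ 1)) *\<^sub>R axis 2 1) z"
    unfolding Cons by simp
  also have "\<dots> = (if ws = [] then vector [l * v $ 1, m * v $ 2] else 0)
      + (v $ 1 * prod_list (map (\<lambda>v. v $ 1) ws) * (deriv ^^ length ws) (deriv g) (z $ 1)) *\<^sub>R axis 2 1"
    using assms n Cons by (intro iter_deriv_scalar_profile[of p]) auto
  finally show ?thesis unfolding Cons by (cases ws) (simp_all add: funpow_swap1)
qed

lemma deriv_pow_zero: "(deriv ^^ i) (\<lambda>_::real. 0 :: real) = (\<lambda>_. 0)"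
  by (induction i) auto

text \<open>An iterated derivative of \<open>br\<close> splits into a linear part, present in orders
  0 and 1 only and depending on m, and a derivative of g of size at most \<eta>\<sigma>. Boundedness
  of N is for order 0, where the linear part is unbounded on the plane.\<close>

lemma br_Cr_tendsto:
  assumes "bounded N" and g: "\<And>\<sigma>. \<sigma> \<in> {0<..<1} \<Longrightarrow> Ck r (g \<sigma>)"
    and gb: "\<And>\<sigma> i x. \<sigma> \<in> {0<..<1} \<Longrightarrow> i \<le> r \<Longrightarrow> \<bar>(deriv ^^ i) (g \<sigma>) x\<bar> \<le> \<eta> * \<sigma>"
    and m: "(m \<longlongrightarrow> m0) (at_right 0)"
  shows "Cr_tendsto r N (\<lambda>\<sigma>. br l (m \<sigma>) (g \<sigma>)) (br l m0 (\<lambda>_. 0))"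
  unfolding Cr_tendsto_def
proof (intro allI impI)
  fix vs :: "(real^2) list"
  assume vs: "set vs \<subseteq> Basis \<and> length vs \<le> r"
  obtain B where B: "\<And>z. z \<in> N \<Longrightarrow> norm z \<le> B" using assms(1) bounded_iff by blast
  define lin :: "real \<Rightarrow> real^2 \<Rightarrow> real^2" where
    "lin m z = (case vs of [] \<Rightarrow> vector [l * z $ 1, m * z $ 2] | [v] \<Rightarrow> vector [l * v $ 1, m * v $ 2] | _ \<Rightarrow> 0)" for m z
  define p where "p = prod_list (map (\<lambda>v. v $ 1) vs)"
  have one: "\<bar>v $ i\<bar> \<le> 1" if "v \<in> set vs" for v and i :: 2
    using that vs component_le_norm_cart[of v i] norm_Basis[of v] by (metis subsetD)
  have p: "\<bar>p\<bar> \<le> 1" unfolding p_def using one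
  proof (induction vs)
    case (Cons v vs)
    then have "\<bar>v $ 1\<bar> * \<bar>prod_list (map (\<lambda>v. v $ 1) vs)\<bar> \<le> 1 * 1" by (intro mult_mono) auto
    then show ?case by (simp add: abs_mult)
  qed auto
  \<comment> \<open>B + 1 bounds both \<open>z $ 2\<close> on N, for order 0, and the entries of
    basis vectors, for order 1.\<close>
  have linb: "norm (lin m z - lin m' z) \<le> \<bar>m - m'\<bar> * (B + 1)" if "z \<in> N" for m m' z
  proof -
    have eq: "norm (vector [x, m * y] - vector [x, m' * y] :: real^2) = \<bar>m - m'\<bar> * \<bar>y\<bar>" for x y
    proof -
      have "norm (vector [x, m * y] - vector [x, m' * y] :: real^2) = \<bar>m * y - m' * y\<bar>"
        by (simp add: norm_vec2)
      also have "\<dots> = \<bar>(m - m') * y\<bar>" by (simp add: algebra_simps)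
      finally show ?thesis by (simp add: abs_mult)
    qed
    have B0: "0 \<le> B" using B[OF that] norm_ge_zero order_trans by blast
    have z: "\<bar>z $ 2\<bar> \<le> B + 1" using B[OF that] component_le_norm_cart[of z 2] by linarith
    show ?thesis
    proof (cases vs)
      case Nil
      then show ?thesis using z by (simp add: lin_def eq mult_left_mono)
    next
      case (Cons v ws)
      have "\<bar>v $ 2\<bar> \<le> B + 1" using one[of v 2] B0 Cons by simp
      then show ?thesis using B0 Cons by (cases ws) (simp_all add: lin_def eq mult_left_mono)
    qed
  qed
  have diff: "dist (iter_deriv vs (br l (m \<sigma>) (g \<sigma>)) z) (iter_deriv vs (br l m0 (\<lambda>_. 0)) z)
      \<le> \<bar>m \<sigma> - m0\<bar> * (B + 1) + \<eta> * \<sigma>" if "\<sigma> \<in> {0<..<1}" "z \<in> N" for \<sigma> z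
  proof -
    have a: "norm ((p * (deriv ^^ length vs) (g \<sigma>) (z $ 1)) *\<^sub>R axis 2 1 :: real^2) \<le> 1 * (\<eta> * \<sigma>)"
    proof -
      have "\<bar>p\<bar> * \<bar>(deriv ^^ length vs) (g \<sigma>) (z $ 1)\<bar> \<le> 1 * (\<eta> * \<sigma>)"
        using p gb[OF that(1)] vs by (intro mult_mono) auto
      then show ?thesis by (simp add: abs_mult)
    qed
    have "iter_deriv vs (br l (m \<sigma>) (g \<sigma>)) z
        = lin (m \<sigma>) z + (p * (deriv ^^ length vs) (g \<sigma>) (z $ 1)) *\<^sub>R axis 2 1"
      unfolding lin_def p_def using vs by (intro iter_deriv_br[OF g[OF that(1)]]) simp
    moreover have "iter_deriv vs (br l m0 (\<lambda>_. 0)) z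
        = lin m0 z + (p * (deriv ^^ length vs) (\<lambda>_. 0) (z $ 1)) *\<^sub>R axis 2 1"
      unfolding lin_def p_def using vs by (intro iter_deriv_br[OF Ck_const[of r]]) simp
    ultimately have eq: "iter_deriv vs (br l (m \<sigma>) (g \<sigma>)) z - iter_deriv vs (br l m0 (\<lambda>_. 0)) z
        = (lin (m \<sigma>) z - lin m0 z) + (p * (deriv ^^ length vs) (g \<sigma>) (z $ 1)) *\<^sub>R axis 2 1"
      unfolding deriv_pow_zero by simp
    show ?thesis unfolding dist_norm eq
      by (rule order_trans[OF norm_triangle_ineq add_mono[OF linb[OF that(2)] a[unfolded mult_1]]])
  qed
  show "uniform_limit N (\<lambda>\<sigma>. iter_deriv vs (br l (m \<sigma>) (g \<sigma>))) (iter_deriv vs (br l m0 (\<lambda>_. 0))) (at_right 0)"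
  proof (rule uniform_limitI)
    fix e :: real assume e: "e > 0"
    have "((\<lambda>\<sigma>. \<bar>m \<sigma> - m0\<bar> * (B + 1) + \<eta> * \<sigma>) \<longlongrightarrow> \<bar>m0 - m0\<bar> * (B + 1) + \<eta> * 0) (at_right 0)"
      by (intro tendsto_intros m)
    then have "\<forall>\<^sub>F \<sigma> in at_right 0. \<bar>m \<sigma> - m0\<bar> * (B + 1) + \<eta> * \<sigma> < e"
      using e order_tendstoD(2)[of _ 0] by simp
    moreover have "\<forall>\<^sub>F \<sigma> in at_right (0::real). \<sigma> \<in> {0<..<1}"
      by (rule eventually_at_right_real) simp
    ultimately show "\<forall>\<^sub>F \<sigma> in at_right 0. \<forall>z\<in>N. dist (iter_deriv vs (br l (m \<sigma>) (g \<sigma>)) z) (iter_deriv vs (br l m0 (\<lambda>_. 0)) z) < e"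
      by eventually_elim (blast intro: le_less_trans[OF diff])
  qed
qed

section \<open>The piecewise expanding maps\<close>

lemma linepath_vector2:
  fixes a b c d :: real
  shows "linepath (vector [a, b]) (vector [c, d]) t = (vector [a + t * (c - a), b + t * (d - b)] :: real^2)"
  by (simp add: linepath_def vec2_eq_iff algebra_simps)

lemma affine_between:
  fixes a c t :: real
  assumes "a < c"
  shows "a \<le> a + t * (c - a) \<longleftrightarrow> 0 \<le> t" "a + t * (c - a) \<le> c \<longleftrightarrow> t \<le> 1"
    "a < a + t * (c - a) \<longleftrightarrow> 0 < t" "a + t * (c - a) < c \<longleftrightarrow> t < 1"
proof -
  have "a + t * (c - a) - c = (t - 1) * (c - a)" by (simp add: algebra_simps)
  then show "a + t * (c - a) \<le> c \<longleftrightarrow> t \<le> 1" "a + t * (c - a) < c \<longleftrightarrow> t < 1"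
    using assms by (smt (verit) mult_le_0_iff zero_less_mult_iff mult_less_0_iff)+
  show "a \<le> a + t * (c - a) \<longleftrightarrow> 0 \<le> t" "a < a + t * (c - a) \<longleftrightarrow> 0 < t"
    using assms by (auto simp: zero_le_mult_iff zero_less_mult_iff)
qed

lemma horizontal_linepath:
  fixes x0 x1 y :: real
  assumes "x0 < x1"
  shows "path_image (linepath (vector [x0, y]) (vector [x1, y])) = {z::real^2. z $ 2 = y \<and> x0 \<le> z $ 1 \<and> z $ 1 \<le> x1}"
    and "linepath (vector [x0, y]) (vector [x1, y]) ` {0<..<1} \<subseteq> {z::real^2. z $ 2 = y \<and> x0 < z $ 1 \<and> z $ 1 < x1}"
proof -
  show "path_image (linepath (vector [x0, y]) (vector [x1, y])) = {z::real^2. z $ 2 = y \<and> x0 \<le> z $ 1 \<and> z $ 1 \<le> x1}"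
  proof (intro set_eqI iffI)
    fix z :: "real^2" assume "z \<in> path_image (linepath (vector [x0, y]) (vector [x1, y]))"
    then show "z \<in> {z. z $ 2 = y \<and> x0 \<le> z $ 1 \<and> z $ 1 \<le> x1}"
      using affine_between[OF assms] by (auto simp: path_image_def linepath_vector2)
  next
    fix z :: "real^2" assume z: "z \<in> {z. z $ 2 = y \<and> x0 \<le> z $ 1 \<and> z $ 1 \<le> x1}"
    define t where "t = (z $ 1 - x0) / (x1 - x0)"
    have t: "z $ 1 = x0 + t * (x1 - x0)" using assms by (simp add: t_def)
    then have "z = linepath (vector [x0, y]) (vector [x1, y]) t"
      using z by (simp add: linepath_vector2 vec2_eq_iff)
    moreover have "t \<in> {0..1}" using z unfolding mem_Collect_eq t affine_between[OF assms] by simp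
    ultimately show "z \<in> path_image (linepath (vector [x0, y]) (vector [x1, y]))"
      unfolding path_image_def by blast
  qed
  show "linepath (vector [x0, y]) (vector [x1, y]) ` {0<..<1} \<subseteq> {z::real^2. z $ 2 = y \<and> x0 < z $ 1 \<and> z $ 1 < x1}"
    using affine_between[OF assms] by (auto simp: linepath_vector2)
qed

lemma vertical_linepath:
  fixes y0 y1 x :: real
  assumes "y0 < y1"
  shows "path_image (linepath (vector [x, y0]) (vector [x, y1])) = {z::real^2. z $ 1 = x \<and> y0 \<le> z $ 2 \<and> z $ 2 \<le> y1}"
    and "linepath (vector [x, y0]) (vector [x, y1]) ` {0<..<1} \<subseteq> {z::real^2. z $ 1 = x \<and> y0 < z $ 2 \<and> z $ 2 < y1}"
proof -
  show "path_image (linepath (vector [x, y0]) (vector [x, y1])) = {z::real^2. z $ 1 = x \<and> y0 \<le> z $ 2 \<and> z $ 2 \<le> y1}"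
  proof (intro set_eqI iffI)
    fix z :: "real^2" assume "z \<in> path_image (linepath (vector [x, y0]) (vector [x, y1]))"
    then show "z \<in> {z. z $ 1 = x \<and> y0 \<le> z $ 2 \<and> z $ 2 \<le> y1}"
      using affine_between[OF assms] by (auto simp: path_image_def linepath_vector2)
  next
    fix z :: "real^2" assume z: "z \<in> {z. z $ 1 = x \<and> y0 \<le> z $ 2 \<and> z $ 2 \<le> y1}"
    define t where "t = (z $ 2 - y0) / (y1 - y0)"
    have t: "z $ 2 = y0 + t * (y1 - y0)" using assms by (simp add: t_def)
    then have "z = linepath (vector [x, y0]) (vector [x, y1]) t"
      using z by (simp add: linepath_vector2 vec2_eq_iff)
    moreover have "t \<in> {0..1}" using z unfolding mem_Collect_eq t affine_between[OF assms] by simp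
    ultimately show "z \<in> path_image (linepath (vector [x, y0]) (vector [x, y1]))"
      unfolding path_image_def by blast
  qed
  show "linepath (vector [x, y0]) (vector [x, y1]) ` {0<..<1} \<subseteq> {z::real^2. z $ 1 = x \<and> y0 < z $ 2 \<and> z $ 2 < y1}"
    using affine_between[OF assms] by (auto simp: linepath_vector2)
qed

lemma Cr_on_const: "Cr_on n (\<lambda>x. c) S"
  by (induction n arbitrary: c) auto

lemma Cr_on_linepath: "Cr_on n (linepath a (b :: 'a::euclidean_space)) S"
proof (cases n)
  case 0
  then show ?thesis by (simp add: continuous_on_linepath)
next
  case (Suc m)
  have der: "(linepath a b has_derivative (\<lambda>v. v *\<^sub>R (b - a))) (at t)" for t
    using has_vector_derivative_linepath_within[of a b t UNIV] unfolding has_vector_derivative_def .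
  have "frechet_derivative (linepath a b) (at t) = (\<lambda>v. v *\<^sub>R (b - a))" for t
    by (rule frechet_derivative_at[OF der, symmetric])
  then show ?thesis using Suc der by (auto simp: Cr_on_const intro: differentiableI)
qed

lemma simple_regular_linepath:
  "a \<noteq> b \<Longrightarrow> simple_regular_curve r (linepath a (b :: real^2))"
  unfolding simple_regular_curve_def
  using Cr_on_linepath by (auto intro!: exI[of _ UNIV])

text \<open>A connected set larger than \<open>P i\<close> would be separated by \<open>P i\<close>
  and the union of the other sets, which are both open.\<close>

lemma components_of_open_partition:
  assumes "\<And>i. i \<in> I \<Longrightarrow> open (P i)" "\<And>i. i \<in> I \<Longrightarrow> connected (P i)" "\<And>i. i \<in> I \<Longrightarrow> P i \<noteq> {}"
    and "disjoint_family_on P I"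
  shows "bij_betw P I (components (\<Union>i\<in>I. P i))"
proof -
  let ?S = "\<Union>i\<in>I. P i"
  have comp: "P i \<in> components ?S" if i: "i \<in> I" for i
    unfolding in_components_maximal
  proof (intro conjI allI impI)
    fix C assume C: "C \<noteq> {} \<and> P i \<subseteq> C \<and> C \<subseteq> ?S \<and> connected C"
    let ?V = "\<Union>j\<in>I - {i}. P j"
    have dis: "P i \<inter> ?V = {}" using assms(4) i unfolding disjoint_family_on_def by blast
    have "open ?V" using assms(1) by auto
    moreover have "C \<subseteq> P i \<union> ?V" using C by blast
    moreover have "P i \<inter> C \<noteq> {}" using C assms(3)[OF i] by blast
    ultimately have "?V \<inter> C = {}"
      using connectedD[of C "P i" ?V] C assms(1)[OF i] dis by blast
    then show "C = P i" using C \<open>C \<subseteq> P i \<union> ?V\<close> by blast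
  qed (use i assms in auto)
  have "inj_on P I"
    using assms(3,4) unfolding inj_on_def disjoint_family_on_def by (metis Int_absorb)
  moreover have "components ?S \<subseteq> P ` I"
  proof
    fix C assume C: "C \<in> components ?S"
    then obtain x where x: "x \<in> C" using in_components_nonempty by blast
    then obtain i where i: "i \<in> I" "x \<in> P i" using in_components_subset[OF C] by blast
    then have "C = P i" using components_eq[OF C comp[OF i(1)]] x by blast
    then show "C \<in> P ` I" using i by blast
  qed
  ultimately show ?thesis using comp unfolding bij_betw_def by blast
qed

section \<open>The rectangle, its cuts, its pieces and the map\<close>

definition dom0 :: "(real^2) set" where
  "dom0 = box (vector [0, -11/10]) (vector [6/5, 1/2])"

text \<open>The vertical cut x = s is given as two curves that meet on the horizontal cut, because
  distinct curves must have disjoint interiors.\<close>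

definition cut :: "real \<Rightarrow> nat \<Rightarrow> real \<Rightarrow> real^2" where
  "cut s j = [linepath (vector [0, 0]) (vector [6/5, 0]),
     linepath (vector [s, 0]) (vector [s, 1/2]),
     linepath (vector [s, -1/2]) (vector [s, 0]),
     linepath (vector [0, -1/2]) (vector [s, -1/2])] ! j"

text \<open>Zones 0 and 1 are the two sides of the fold and zone 2 is the exit. The L-shaped zone 3
  is never visited by the wandering box; it completes the partition.\<close>

definition zone :: "real \<Rightarrow> nat \<Rightarrow> (real^2) set" where
  "zone s i = [{z. 0 < z $ 1 \<and> z $ 1 < s \<and> 0 < z $ 2 \<and> z $ 2 < 1/2},
     {z. 0 < z $ 1 \<and> z $ 1 < s \<and> -1/2 < z $ 2 \<and> z $ 2 < 0},
     {z. s < z $ 1 \<and> z $ 1 < 6/5 \<and> 0 < z $ 2 \<and> z $ 2 < 1/2},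
     {z. 0 < z $ 1 \<and> z $ 1 < 6/5 \<and> -11/10 < z $ 2 \<and> z $ 2 < 0 \<and> (s < z $ 1 \<or> z $ 2 < -1/2)}] ! i"

definition dom1 :: "real \<Rightarrow> (real^2) set" where
  "dom1 s = (\<Union>i<4. zone s i)"

text \<open>The last case only has to expand and to stay inside the rectangle. Zone 3 has the full
  width 6/5 and cannot be stretched horizontally, so the coordinates are exchanged: its height 11/10
  becomes a width of at most 231/200 < 6/5, and its width a height of at most 63/50 < 8/5.\<close>

definition pw_map :: "real \<Rightarrow> real \<Rightarrow> real \<Rightarrow> (real \<Rightarrow> real) \<Rightarrow> real^2 \<Rightarrow> real^2" where
  "pw_map l m s g z =
    (if z $ 1 < s \<and> -1/2 < z $ 2 then vector [l * z $ 1, g (z $ 1) - m * \<bar>z $ 2\<bar>]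
     else if 0 < z $ 2 then vector [l * z $ 2, l * (z $ 1 - 1)]
     else vector [l * (z $ 2 + 11/10), l * z $ 1 - 11/10])"

definition pw_branch :: "real \<Rightarrow> real \<Rightarrow> (real \<Rightarrow> real) \<Rightarrow> nat \<Rightarrow> real^2 \<Rightarrow> real^2" where
  "pw_branch l m g i = [br l (- m) g, br l m g, sw l 0 (- l), sw l (l * (11/10)) (- 11/10)] ! i"

definition pw_maps_data :: "real \<Rightarrow> real \<Rightarrow> real \<Rightarrow> (real \<Rightarrow> real) \<Rightarrow> pw_data" where
  "pw_maps_data l m s g = \<lparr>num_curves = 4, curve = cut s, num_pieces = 4, piece = zone s,
     nbhd = (\<lambda>_. UNIV), branch = pw_branch l m g\<rparr>"

lemma less_4_cases: "i < (4::nat) \<longleftrightarrow> i = 0 \<or> i = 1 \<or> i = 2 \<or> i = 3"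
  by auto

lemma mem_dom0: "z \<in> dom0 \<longleftrightarrow> 0 < z $ 1 \<and> z $ 1 < 6/5 \<and> -11/10 < z $ 2 \<and> z $ 2 < 1/2"
  by (auto simp: dom0_def mem_box_cart forall_2)

lemma mem_closure_dom0: "z \<in> closure dom0 \<longleftrightarrow> 0 \<le> z $ 1 \<and> z $ 1 \<le> 6/5 \<and> -11/10 \<le> z $ 2 \<and> z $ 2 \<le> 1/2"
proof -
  have "dom0 \<noteq> {}" using mem_dom0[of "vector [1, 0]"] by auto
  then have "closure dom0 = cbox (vector [0, -11/10]) (vector [6/5, 1/2])"
    unfolding dom0_def by (rule closure_box)
  then show ?thesis by (auto simp: mem_box_cart forall_2)
qed

lemma open_dom0: "open dom0" by (simp add: dom0_def open_box)

lemma open_rectangle_box: "box a b \<noteq> {} \<Longrightarrow> open_rectangle (box a b)"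
  unfolding open_rectangle_def
  using orthogonal_transformation_id by (metis image_ident)

lemma open_rectangle_dom0: "open_rectangle dom0"
proof -
  have "dom0 \<noteq> {}" using mem_dom0[of "vector [1, 0]"] by auto
  then show ?thesis unfolding dom0_def by (rule open_rectangle_box)
qed

lemma cut_image:
  assumes "0 < s" "s < 1"
  shows "path_image (cut s 0) = {z. z $ 2 = 0 \<and> 0 \<le> z $ 1 \<and> z $ 1 \<le> 6/5}"
    "path_image (cut s 1) = {z. z $ 1 = s \<and> 0 \<le> z $ 2 \<and> z $ 2 \<le> 1/2}"
    "path_image (cut s 2) = {z. z $ 1 = s \<and> -1/2 \<le> z $ 2 \<and> z $ 2 \<le> 0}"
    "path_image (cut s 3) = {z. z $ 2 = -1/2 \<and> 0 \<le> z $ 1 \<and> z $ 1 \<le> s}"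
  unfolding cut_def
  using assms horizontal_linepath(1)[of 0 "6/5" 0] vertical_linepath(1)[of 0 "1/2" s]
    vertical_linepath(1)[of "-1/2" 0 s] horizontal_linepath(1)[of 0 s "-1/2"]
  by (simp_all add: numeral_eq_Suc)

lemma cut_interior:
  assumes "0 < s" "s < 1"
  shows "cut s 0 ` {0<..<1} \<subseteq> {z. z $ 2 = 0 \<and> 0 < z $ 1 \<and> z $ 1 < 6/5}"
    "cut s 1 ` {0<..<1} \<subseteq> {z. z $ 1 = s \<and> 0 < z $ 2 \<and> z $ 2 < 1/2}"
    "cut s 2 ` {0<..<1} \<subseteq> {z. z $ 1 = s \<and> -1/2 < z $ 2 \<and> z $ 2 < 0}"
    "cut s 3 ` {0<..<1} \<subseteq> {z. z $ 2 = -1/2 \<and> 0 < z $ 1 \<and> z $ 1 < s}"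
  unfolding cut_def
  using assms horizontal_linepath(2)[of 0 "6/5" 0] vertical_linepath(2)[of 0 "1/2" s]
    vertical_linepath(2)[of "-1/2" 0 s] horizontal_linepath(2)[of 0 s "-1/2"]
  by (simp_all add: numeral_eq_Suc)

lemma cut_ends:
  "pathstart (cut s 0) = vector [0, 0]" "pathfinish (cut s 0) = vector [6/5, 0]"
  "pathstart (cut s 1) = vector [s, 0]" "pathfinish (cut s 1) = vector [s, 1/2]"
  "pathstart (cut s 2) = vector [s, -1/2]" "pathfinish (cut s 2) = vector [s, 0]"
  "pathstart (cut s 3) = vector [0, -1/2]" "pathfinish (cut s 3) = vector [s, -1/2]"
  unfolding cut_def by (simp_all add: numeral_eq_Suc)

lemma curve_system_cut:
  assumes s: "0 < s" "s < 1"
  shows "curve_system r dom0 4 (cut s)"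
  unfolding curve_system_def
proof (intro conjI allI impI ballI)
  fix j :: nat assume j: "j < 4"
  show "simple_regular_curve r (cut s j)"
    using j s unfolding less_4_cases cut_def
    by (elim disjE) (auto simp: vec2_eq_iff numeral_eq_Suc intro!: simple_regular_linepath)
  show "path_image (cut s j) \<subseteq> closure dom0"
    using j s unfolding less_4_cases by (elim disjE) (auto simp: cut_image[OF s] mem_closure_dom0 simp del: One_nat_def)
next
  fix i j :: nat assume ij: "i < 4" "j < 4" "i \<noteq> j"
  let ?C = "\<lambda>i. cut s i ` {0<..<1}"
  have dis: "A \<inter> B = {}" if "A \<subseteq> S" "B \<subseteq> T" "S \<inter> T = {}" for A B S T :: "(real^2) set"
    using that by blast
  have "?C 0 \<inter> ?C 1 = {}" "?C 0 \<inter> ?C 2 = {}" "?C 0 \<inter> ?C 3 = {}" "?C 1 \<inter> ?C 2 = {}" "?C 1 \<inter> ?C 3 = {}" "?C 2 \<inter> ?C 3 = {}"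
    subgoal using s by (intro dis[OF cut_interior(1)[OF s] cut_interior(2)[OF s]]) auto
    subgoal using s by (intro dis[OF cut_interior(1)[OF s] cut_interior(3)[OF s]]) auto
    subgoal using s by (intro dis[OF cut_interior(1)[OF s] cut_interior(4)[OF s]]) auto
    subgoal using s by (intro dis[OF cut_interior(2)[OF s] cut_interior(3)[OF s]]) auto
    subgoal using s by (intro dis[OF cut_interior(2)[OF s] cut_interior(4)[OF s]]) auto
    subgoal using s by (intro dis[OF cut_interior(3)[OF s] cut_interior(4)[OF s]]) auto
    done
  then have *: "?C 0 \<inter> ?C 1 = {}" "?C 0 \<inter> ?C 2 = {}" "?C 0 \<inter> ?C 3 = {}" "?C 1 \<inter> ?C 2 = {}" "?C 1 \<inter> ?C 3 = {}" "?C 2 \<inter> ?C 3 = {}"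
    "?C 1 \<inter> ?C 0 = {}" "?C 2 \<inter> ?C 0 = {}" "?C 3 \<inter> ?C 0 = {}" "?C 2 \<inter> ?C 1 = {}" "?C 3 \<inter> ?C 1 = {}" "?C 3 \<inter> ?C 2 = {}"
    by (simp_all only: Int_commute)
  show "?C i \<inter> ?C j = {}"
    using ij unfolding less_4_cases by (elim disjE; hypsubst) (simp_all only: * simp_thms)
next
  fix j z assume j: "j < 4" and z: "z \<in> {pathstart (cut s j), pathfinish (cut s j)}"
    and deg1: "pathstart (cut s j) \<noteq> pathfinish (cut s j) \<and> (\<forall>i<4. i \<noteq> j \<longrightarrow> z \<notin> path_image (cut s i))"
  have fr: "w \<in> frontier dom0" if "w \<in> closure dom0" "w \<notin> dom0" for w
    using that open_dom0 by (simp add: frontier_def interior_open)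
  have d: "z \<notin> path_image (cut s i)" if "i < 4" "j \<noteq> i" for i using deg1 that by blast
  \<comment> \<open>The only end points inside the open rectangle are (s, 0) and (s, -1/2); each
    lies on a second curve, against \<open>deg1\<close>.\<close>
  have nin: "z \<notin> path_image (cut s 0) \<or> j = 0" "z \<notin> path_image (cut s 2) \<or> j = 2" "z \<notin> path_image (cut s 3) \<or> j = 3"
    by (rule disjCI, rule d; simp)+
  from j show "z \<in> frontier dom0"
    unfolding less_4_cases
  proof (elim disjE)
    assume "j = 0"
    then show ?thesis using z s
      by (intro fr) (auto simp: mem_dom0 mem_closure_dom0 cut_ends simp del: One_nat_def)
  next
    assume "j = 1"
    then show ?thesis using z s nin
      by (intro fr) (auto simp: mem_dom0 mem_closure_dom0 cut_ends cut_image[OF s] simp del: One_nat_def)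
  next
    assume "j = 2"
    then show ?thesis using z s nin
      by (auto simp: cut_ends cut_image[OF s] simp del: One_nat_def)
  next
    assume "j = 3"
    then show ?thesis using z s nin
      by (intro fr) (auto simp: mem_dom0 mem_closure_dom0 cut_ends cut_image[OF s] simp del: One_nat_def)
  qed
qed

lemma mem_dom1:
  "z \<in> dom1 s \<longleftrightarrow> z \<in> zone s 0 \<or> z \<in> zone s 1 \<or> z \<in> zone s 2 \<or> z \<in> zone s 3"
  unfolding dom1_def by (auto simp: less_4_cases)

lemma mem_zone:
  "z \<in> zone s 0 \<longleftrightarrow> 0 < z $ 1 \<and> z $ 1 < s \<and> 0 < z $ 2 \<and> z $ 2 < 1/2"
  "z \<in> zone s 1 \<longleftrightarrow> 0 < z $ 1 \<and> z $ 1 < s \<and> -1/2 < z $ 2 \<and> z $ 2 < 0"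
  "z \<in> zone s 2 \<longleftrightarrow> s < z $ 1 \<and> z $ 1 < 6/5 \<and> 0 < z $ 2 \<and> z $ 2 < 1/2"
  "z \<in> zone s 3 \<longleftrightarrow> 0 < z $ 1 \<and> z $ 1 < 6/5 \<and> -11/10 < z $ 2 \<and> z $ 2 < 0 \<and> (s < z $ 1 \<or> z $ 2 < -1/2)"
  by (simp_all add: zone_def numeral_eq_Suc)

lemma dom1_eq:
  assumes s: "0 < s" "s < 1"
  shows "dom1 s = dom0 - (\<Union>j<4. path_image (cut s j))"
proof (rule set_eqI)
  fix z
  have *: "z \<in> (\<Union>j<4. path_image (cut s j)) \<longleftrightarrow> z \<in> path_image (cut s 0) \<or> z \<in> path_image (cut s 1)
      \<or> z \<in> path_image (cut s 2) \<or> z \<in> path_image (cut s 3)"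
    by (auto simp: less_4_cases)
  show "z \<in> dom1 s \<longleftrightarrow> z \<in> dom0 - (\<Union>j<4. path_image (cut s j))"
    unfolding Diff_iff * mem_dom1 mem_zone mem_dom0 cut_image[OF s] mem_Collect_eq
    by (cases "z $ 1" s rule: linorder_cases; cases "z $ 2" "0 :: real" rule: linorder_cases;
        cases "z $ 2" "- 1/2 :: real" rule: linorder_cases; use s in simp)
qed

lemma open_zone: "i < 4 \<Longrightarrow> open (zone s i)"
  unfolding less_4_cases zone_def
  by (elim disjE)
     (simp_all add: numeral_eq_Suc open_Collect_conj open_Collect_disj open_Collect_less continuous_intros)

lemma connected_zone:
  assumes "i < 4" "0 < s" "s < 1"
  shows "connected (zone s i)"
proof -
  have conv: "convex {z::real^2. a < z $ 1 \<and> z $ 1 < b \<and> c < z $ 2 \<and> z $ 2 < d}" for a b c d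
  proof -
    have "{z::real^2. a < z $ 1 \<and> z $ 1 < b \<and> c < z $ 2 \<and> z $ 2 < d} = box (vector [a, c]) (vector [b, d])"
      by (auto simp: mem_box_cart forall_2)
    then show ?thesis by (simp add: convex_box)
  qed
  let ?A = "{z::real^2. 0 < z $ 1 \<and> z $ 1 < 6/5 \<and> -11/10 < z $ 2 \<and> z $ 2 < -1/2}"
  let ?B = "{z::real^2. s < z $ 1 \<and> z $ 1 < 6/5 \<and> -11/10 < z $ 2 \<and> z $ 2 < 0}"
  have "zone s 3 = ?A \<union> ?B"
    using assms by (auto simp: mem_zone)
  moreover have "connected (?A \<union> ?B)"
  proof (rule connected_Un)
    have "vector [11/10, -1] \<in> ?A \<inter> ?B" using assms by simp
    then show "?A \<inter> ?B \<noteq> {}" by blast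
  qed (rule convex_connected[OF conv])+
  ultimately have "connected (zone s 3)" by simp
  moreover have "connected (zone s 0)"
    using convex_connected[OF conv[of 0 s 0 "1/2"]] by (simp only: zone_def nth_Cons_0)
  moreover have "connected (zone s 1)"
    using convex_connected[OF conv[of 0 s "-1/2" 0]] by (simp only: zone_def nth_Cons_0 nth_Cons_Suc One_nat_def)
  moreover have "connected (zone s 2)"
    using convex_connected[OF conv[of s "6/5" 0 "1/2"]]
    by (simp only: zone_def nth_Cons_0 nth_Cons_Suc numeral_2_eq_2)
  ultimately show ?thesis using assms(1) unfolding less_4_cases by metis
qed

lemma zones_partition:
  assumes "0 < s" "s < 1"
  shows "bij_betw (zone s) {..<4} (components (dom1 s))"
  unfolding dom1_def
proof (rule components_of_open_partition)
  fix i :: nat assume i: "i \<in> {..<4}"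
  then show "open (zone s i)" "connected (zone s i)"
    using open_zone connected_zone assms by auto
  have "vector [s / 2, 1/4] \<in> zone s 0" "vector [s / 2, -1/4] \<in> zone s 1"
    "vector [11/10, 1/4] \<in> zone s 2" "vector [11/10, -1/4] \<in> zone s 3"
    using assms by (simp_all add: mem_zone del: One_nat_def)
  then show "zone s i \<noteq> {}" using i by (auto simp: less_4_cases simp del: One_nat_def)
next
  show "disjoint_family_on (zone s) {..<4}"
    unfolding disjoint_family_on_def
  proof (intro ballI impI)
    fix i j :: nat assume "i \<in> {..<4}" "j \<in> {..<4}" "i \<noteq> j"
    then show "zone s i \<inter> zone s j = {}"
      unfolding lessThan_iff less_4_cases
      by (elim disjE) (auto simp: mem_zone simp del: One_nat_def)
  qed
qed

lemma pw_branch_simps: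
  "pw_branch l m g 0 = br l (- m) g" "pw_branch l m g 1 = br l m g"
  "pw_branch l m g 2 = sw l 0 (- l)" "pw_branch l m g 3 = sw l (l * (11/10)) (- 11/10)"
  by (simp_all add: pw_branch_def numeral_eq_Suc)

lemma pw_branch_eq:
  assumes "i < 4" "z \<in> zone s i"
  shows "pw_branch l m g i z = pw_map l m s g z"
  using assms unfolding less_4_cases
  by (elim disjE)
     (auto simp: mem_zone pw_branch_simps pw_map_def br_def sw_def vec2_eq_iff algebra_simps
       simp del: One_nat_def)

lemma pw_branch_Cr: "Ck r g \<Longrightarrow> i < 4 \<Longrightarrow> Cr_on r (pw_branch l m g i) S"
  unfolding less_4_cases pw_branch_def by (elim disjE) (auto simp: numeral_eq_Suc br_Cr sw_Cr)

lemma pw_map_in_dom0: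
  assumes s: "1/2 < s" "s < 1" and lm: "1 < l" "l \<le> 21/20" "l \<le> m" "m \<le> 21/20"
    and g: "\<bar>g (z $ 1)\<bar> \<le> 1/40" and z: "z \<in> dom1 s"
  shows "pw_map l m s g z \<in> dom0"
proof -
  have up: "l * x \<le> 21/20 * x" "m * x \<le> 21/20 * x" if "0 \<le> x" for x
    by (intro mult_right_mono; use that lm in simp)+
  have pos: "0 < l * x" "0 < m * x" if "0 < x" for x using that lm by auto
  have neg: "21/20 * x \<le> l * x" if "x \<le> 0" for x by (intro mult_right_mono_neg; use that lm in simp)
  from z consider "z \<in> zone s 0 \<or> z \<in> zone s 1" | "z \<in> zone s 2" | "z \<in> zone s 3"
    unfolding mem_dom1 by blast
  then show ?thesis
  proof cases
    case 1
    then have zz: "0 < z $ 1" "z $ 1 < s" "0 < \<bar>z $ 2\<bar>" "\<bar>z $ 2\<bar> < 1/2" "-1/2 < z $ 2"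
      by (auto simp: mem_zone simp del: One_nat_def)
    then have eq: "pw_map l m s g z = vector [l * z $ 1, g (z $ 1) - m * \<bar>z $ 2\<bar>]" by (simp add: pw_map_def)
    show ?thesis unfolding mem_dom0 eq vector_2
      using zz up(1)[of "z $ 1"] up(2)[of "\<bar>z $ 2\<bar>"] pos(1)[of "z $ 1"] pos(2)[of "\<bar>z $ 2\<bar>"] g s
      by (intro conjI; linarith)
  next
    case 2
    then have zz: "s < z $ 1" "z $ 1 < 6/5" "0 < z $ 2" "z $ 2 < 1/2" by (simp_all only: mem_zone)
    then have eq: "pw_map l m s g z = vector [l * z $ 2, l * (z $ 1 - 1)]" by (simp add: pw_map_def)
    have "-11/10 < l * (z $ 1 - 1) \<and> l * (z $ 1 - 1) < 1/2"
    proof (cases "1 \<le> z $ 1")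
      case True
      have "l * (z $ 1 - 1) \<le> 21/20 * (z $ 1 - 1)" by (rule up(1)) (use True in simp)
      also have "\<dots> < 1/2" using zz by simp
      moreover have "0 \<le> l * (z $ 1 - 1)" using True lm by simp
      ultimately show ?thesis by simp
    next
      case False
      have "-11/10 < 21/20 * (z $ 1 - 1)" using zz s by simp
      also have "21/20 * (z $ 1 - 1) \<le> l * (z $ 1 - 1)" by (rule neg) (use False in simp)
      moreover have "l * (z $ 1 - 1) \<le> 0" using False lm by (simp add: mult_le_0_iff)
      ultimately show ?thesis by simp
    qed
    then show ?thesis unfolding mem_dom0 eq vector_2
      using zz up(1)[of "z $ 2"] pos(1)[of "z $ 2"] by (intro conjI; linarith)
  next
    case 3
    then have zz: "0 < z $ 1" "z $ 1 < 6/5" "-11/10 < z $ 2" "z $ 2 < 0" "s < z $ 1 \<or> z $ 2 < -1/2"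
      by (simp_all only: mem_zone)
    then have eq: "pw_map l m s g z = vector [l * (z $ 2 + 11/10), l * z $ 1 - 11/10]"
      by (auto simp: pw_map_def)
    have "l * (z $ 2 + 11/10) \<le> 21/20 * (z $ 2 + 11/10)" by (rule up(1)) (use zz in simp)
    also have "\<dots> < 6/5" using zz by simp
    moreover have "l * z $ 1 \<le> 21/20 * z $ 1" by (rule up(1)) (use zz in simp)
    moreover have "0 < l * (z $ 2 + 11/10)" "0 < l * z $ 1" using zz lm by simp_all
    ultimately show ?thesis unfolding mem_dom0 eq vector_2 using zz(2) by simp
  qed
qed

lemma pw_maps_data_expanding:
  assumes s: "1/2 < s" "s < 1" and lm: "1 < l" "l \<le> 21/20" "l \<le> m" "m \<le> 21/20"
    and r: "1 \<le> r" and g: "Ck r g"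
    and gb: "\<And>i x. i \<le> r \<Longrightarrow> \<bar>(deriv ^^ i) g x\<bar> \<le> (l - 1) / 2"
  shows "pw_expanding_with r dom0 (dom1 s) (pw_map l m s g) (pw_maps_data l m s g)"
  unfolding pw_expanding_with_def
proof (intro conjI)
  have s0: "0 < s" using s by simp
  show "curve_system r dom0 (num_curves (pw_maps_data l m s g)) (curve (pw_maps_data l m s g))"
    using curve_system_cut[OF s0 s(2)] by (simp add: pw_maps_data_def)
  show "dom1 s = dom0 - (\<Union>j<num_curves (pw_maps_data l m s g). path_image (curve (pw_maps_data l m s g) j))"
    using dom1_eq[OF s0 s(2)] by (simp add: pw_maps_data_def)
  show "bij_betw (piece (pw_maps_data l m s g)) {..<num_pieces (pw_maps_data l m s g)} (components (dom1 s))"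
    using zones_partition[OF s0 s(2)] by (simp add: pw_maps_data_def)
  have g0: "\<bar>g x\<bar> \<le> 1/40" for x using gb[of 0 x] lm by simp
  show "pw_map l m s g ` dom1 s \<subseteq> dom0"
    using pw_map_in_dom0[where g = g, OF s lm g0] by blast
  show "Cr_on r (pw_map l m s g) (dom1 s)"
    unfolding dom1_def
  proof (rule Cr_on_UN)
    fix i :: nat assume i: "i \<in> {..<4}"
    then show op: "open (zone s i)" by (simp add: open_zone)
    show "Cr_on r (pw_map l m s g) (zone s i)"
      by (rule Cr_on_cong[OF pw_branch_Cr[OF g] op pw_branch_eq]) (use i in auto)
  qed
  obtain p where p: "r = Suc p" using r by (cases r) auto
  have g1: "\<bar>deriv g x\<bar> \<le> (l - 1) / 2" for x using gb[of 1 x] r by simp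
  \<comment> \<open>The expansion constant (l + 1)/2 is l minus the bound (l - 1)/2 on |g'|.\<close>
  have b: "(l + 1) / 2 * norm v \<le> norm (frechet_derivative (br l m' g) (at x) v)" if "\<bar>m'\<bar> \<ge> l" for m' x v
    using br_expanding[OF g[unfolded p] g1 _ that, of v x] lm by (simp add: field_simps)
  have b': "(l + 1) / 2 * norm v \<le> norm (frechet_derivative (sw l a c) (at x) v)" for a c x v
    using sw_expanding[of l a c x v] lm mult_right_mono[of "(l + 1) / 2" l "norm v"] by simp
  show "\<exists>k>1. \<forall>i<num_pieces (pw_maps_data l m s g).
        closure (piece (pw_maps_data l m s g) i) \<subseteq> nbhd (pw_maps_data l m s g) i \<and>
        Cr_diffeo_onto_image r (branch (pw_maps_data l m s g) i) (nbhd (pw_maps_data l m s g) i) \<and>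
        (\<forall>x\<in>piece (pw_maps_data l m s g) i. branch (pw_maps_data l m s g) i x = pw_map l m s g x) \<and>
        (\<forall>x\<in>nbhd (pw_maps_data l m s g) i. \<forall>v. norm (frechet_derivative (branch (pw_maps_data l m s g) i) (at x) v) \<ge> k * norm v)"
  proof (intro exI[of _ "(l + 1) / 2"] conjI allI impI ballI)
    show "(l + 1) / 2 > 1" using lm by simp
    fix i assume "i < num_pieces (pw_maps_data l m s g)"
    then have i: "i < 4" by (simp add: pw_maps_data_def)
    show "closure (piece (pw_maps_data l m s g) i) \<subseteq> nbhd (pw_maps_data l m s g) i"
      by (simp add: pw_maps_data_def)
    show "Cr_diffeo_onto_image r (branch (pw_maps_data l m s g) i) (nbhd (pw_maps_data l m s g) i)"
      using i lm g unfolding less_4_cases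
      by (elim disjE) (auto simp: pw_maps_data_def pw_branch_def numeral_eq_Suc intro!: br_diffeo sw_diffeo)
    show "branch (pw_maps_data l m s g) i x = pw_map l m s g x" if "x \<in> piece (pw_maps_data l m s g) i" for x
      using pw_branch_eq[OF i] that by (simp add: pw_maps_data_def)
    show "(l + 1) / 2 * norm v \<le> norm (frechet_derivative (branch (pw_maps_data l m s g) i) (at x) v)" for x v
      using i lm b[of m v x] b[of "- m" v x] b' unfolding less_4_cases
      by (elim disjE) (simp_all add: pw_maps_data_def pw_branch_def numeral_eq_Suc)
  qed
qed

lemma bounded_zone: "i < 4 \<Longrightarrow> 0 < s \<Longrightarrow> s < 1 \<Longrightarrow> bounded (zone s i)"
proof (rule bounded_subset[of dom0])
  assume a: "i < 4" "0 < s" "s < 1"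
  show "bounded dom0" unfolding dom0_def by (rule bounded_box)
  have "zone s i \<subseteq> dom1 s" unfolding dom1_def using a by auto
  then show "zone s i \<subseteq> dom0" using dom1_eq[OF a(2,3)] by blast
qed

lemma Cr_tendsto_const: "Cr_tendsto r S (\<lambda>\<sigma>. f) f"
  unfolding Cr_tendsto_def by (simp add: uniform_limit_const)

text \<open>Cuts and pieces do not depend on the parameter and all neighbourhoods are the plane, so
  only the two fold branches have to converge, on a ball that contains the closed piece.\<close>

lemma pw_maps_data_tendsto:
  assumes s: "1/2 < s" "s < 1"
    and g: "\<And>\<sigma>. \<sigma> \<in> {0<..<1} \<Longrightarrow> Ck r (g \<sigma>)"
    and gb: "\<And>\<sigma> i x. \<sigma> \<in> {0<..<1} \<Longrightarrow> i \<le> r \<Longrightarrow> \<bar>(deriv ^^ i) (g \<sigma>) x\<bar> \<le> \<eta> * \<sigma>"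
    and m: "(m \<longlongrightarrow> m0) (at_right 0)"
  shows "pw_data_tendsto r (\<lambda>\<sigma>. pw_maps_data l (m \<sigma>) s (g \<sigma>)) (pw_maps_data l m0 s (\<lambda>_. 0))"
proof -
  have "\<exists>N. open N \<and> closure (zone s i) \<subseteq> N \<and>
           Cr_tendsto r N (\<lambda>\<sigma>. pw_branch l (m \<sigma>) (g \<sigma>) i) (pw_branch l m0 (\<lambda>_. 0) i)" if i: "i < 4" for i
  proof -
    have "bounded (closure (zone s i))" using bounded_zone[OF i] s by (intro bounded_closure) auto
    then obtain R where R: "closure (zone s i) \<subseteq> ball 0 R"
      using bounded_subset_ballD by blast
    have m': "((\<lambda>\<sigma>. - m \<sigma>) \<longlongrightarrow> - m0) (at_right 0)" using m by (rule tendsto_minus)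
    have "Cr_tendsto r (ball 0 R) (\<lambda>\<sigma>. pw_branch l (m \<sigma>) (g \<sigma>) i) (pw_branch l m0 (\<lambda>_. 0) i)"
      using i br_Cr_tendsto[OF bounded_ball g gb m] br_Cr_tendsto[OF bounded_ball g gb m']
      unfolding less_4_cases by (elim disjE; simp only: pw_branch_simps Cr_tendsto_const)
    then show ?thesis using R by blast
  qed
  then show ?thesis unfolding pw_data_tendsto_def
    by (auto simp: pw_maps_data_def Cr_tendsto_const intro!: always_eventually)
qed

section \<open>Limit sets of averages\<close>

lemma omega_set_ge:
  assumes "b \<longlonglongrightarrow> \<beta>" "\<And>n. n \<ge> 1 \<Longrightarrow> b n \<le> a n" "u \<in> omega_set a"
  shows "\<beta> \<le> u"
proof (rule ccontr)
  assume "\<not> \<beta> \<le> u"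
  then have e: "(\<beta> - u) / 2 > 0" by simp
  then have "\<forall>\<^sub>F n in sequentially. \<bar>b n - \<beta>\<bar> < (\<beta> - u) / 2"
    using assms(1) unfolding tendsto_iff dist_real_def by blast
  then obtain N where N: "\<And>n. n \<ge> N \<Longrightarrow> \<bar>b n - \<beta>\<bar> < (\<beta> - u) / 2" unfolding eventually_sequentially by blast
  from assms(3) e obtain n where "n > max N 1" "a n \<in> {u - (\<beta> - u) / 2<..<u + (\<beta> - u) / 2}"
    unfolding omega_set_def by blast
  then show False using N[of n] assms(2)[of n] by (auto simp: abs_less_iff field_simps)
qed

lemma omega_set_le:
  assumes "b \<longlonglongrightarrow> \<beta>" "\<And>n. n \<ge> 1 \<Longrightarrow> a n \<le> b n" "u \<in> omega_set a"
  shows "u \<le> \<beta>"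
proof (rule ccontr)
  assume "\<not> u \<le> \<beta>"
  then have e: "(u - \<beta>) / 2 > 0" by simp
  then have "\<forall>\<^sub>F n in sequentially. \<bar>b n - \<beta>\<bar> < (u - \<beta>) / 2"
    using assms(1) unfolding tendsto_iff dist_real_def by blast
  then obtain N where N: "\<And>n. n \<ge> N \<Longrightarrow> \<bar>b n - \<beta>\<bar> < (u - \<beta>) / 2" unfolding eventually_sequentially by blast
  from assms(3) e obtain n where "n > max N 1" "a n \<in> {u - (u - \<beta>) / 2<..<u + (u - \<beta>) / 2}"
    unfolding omega_set_def by blast
  then show False using N[of n] assms(2)[of n] by (auto simp: abs_less_iff field_simps)
qed

text \<open>With increments tending to 0, a sequence that is below c and later above c comes within
  e of c; the first time \<open>t\<close> above c is such a time.\<close>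

lemma omega_set_between:
  assumes inc: "(\<lambda>n. a (Suc n) - a n) \<longlonglongrightarrow> 0"
    and "u \<in> omega_set a" "w \<in> omega_set a" "u < c" "c < w"
  shows "c \<in> omega_set a"
  unfolding omega_set_def
proof (intro CollectI allI impI)
  fix e :: real and n0 :: nat assume e: "e > 0"
  have "\<forall>\<^sub>F n in sequentially. \<bar>a (Suc n) - a n\<bar> < e"
    using tendstoD[OF inc e] by (simp add: dist_real_def)
  then obtain N where N: "\<And>n. n \<ge> N \<Longrightarrow> \<bar>a (Suc n) - a n\<bar> < e"
    unfolding eventually_sequentially by blast
  obtain p where p: "p > max N n0" "a p < c"
  proof -
    from assms(2,4) obtain p where "p > max N n0" "a p \<in> {u - (c - u)<..<u + (c - u)}"
      unfolding omega_set_def mem_Collect_eq using diff_gt_0_iff_gt by blast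
    then show thesis using that by simp
  qed
  obtain q where q: "q > p" "a q > c"
  proof -
    from assms(3,5) obtain q where "q > p" "a q \<in> {w - (w - c)<..<w + (w - c)}"
      unfolding omega_set_def mem_Collect_eq using diff_gt_0_iff_gt by blast
    then show thesis using that by simp
  qed
  define t where "t = (LEAST t. t > p \<and> a t > c)"
  have t: "t > p \<and> a t > c" unfolding t_def by (rule LeastI[of _ q]) (use q in simp)
  obtain t' where t': "t = Suc t'" using t by (cases t) auto
  have "a t' \<le> c"
  proof (cases "t' = p")
    case False
    then have "\<not> a t' > c" using not_less_Least[of t' "\<lambda>t. t > p \<and> a t > c"] t t' unfolding t_def[symmetric] by auto
    then show ?thesis by simp
  qed (use p in simp)
  moreover have "\<bar>a t - a t'\<bar> < e" using N[of t'] t t' p by simp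
  ultimately have "a t \<in> {c - e<..<c + e}" using t e by (auto simp: abs_less_iff)
  moreover have "t > n0" using t p by simp
  ultimately show "\<exists>n>n0. a n \<in> {c - e<..<c + e}" by blast
qed

lemma closed_omega_set: "closed (omega_set a)"
  unfolding closed_sequential_limits
proof (intro allI impI, elim conjE)
  fix x u assume x: "\<forall>n. x n \<in> omega_set a" and lim: "x \<longlonglongrightarrow> u"
  show "u \<in> omega_set a" unfolding omega_set_def
  proof (intro CollectI allI impI)
    fix e :: real and n0 :: nat assume e: "e > 0"
    then have "\<forall>\<^sub>F n in sequentially. \<bar>x n - u\<bar> < e / 2"
      using lim half_gt_zero[OF e] unfolding tendsto_iff dist_real_def by blast
    then obtain n where n: "\<bar>x n - u\<bar> < e / 2" unfolding eventually_sequentially by blast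
    have "x n \<in> omega_set a" using x by blast
    then obtain k where "k > n0" "a k \<in> {x n - e / 2<..<x n + e / 2}"
      using half_gt_zero[OF e] unfolding omega_set_def by blast
    moreover have "x n - u < e / 2" "u - x n < e / 2" using n unfolding abs_less_iff by linarith+
    ultimately show "\<exists>n>n0. a n \<in> {u - e<..<u + e}" by (intro exI[of _ k]) auto
  qed
qed

text \<open>The pairs of values realising the gap converge along a common subsequence, so the limit
  set has two points at distance at least \<epsilon>. It is closed, bounded and contains every point
  between two of its points, hence is an interval.\<close>

lemma omega_set_nontrivial:
  fixes a :: "nat \<Rightarrow> real"
  assumes bd: "\<And>n. \<bar>a n\<bar> \<le> M" and inc: "(\<lambda>n. a (Suc n) - a n) \<longlonglongrightarrow> 0"
    and gap: "\<epsilon> > 0" "\<And>N. \<exists>s>N. \<exists>t>N. a s - a t \<ge> \<epsilon>"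
  shows "nontrivial_closed_interval (omega_set a)"
proof -
  obtain s t where st: "\<And>N::nat. s N > N" "\<And>N. t N > N" "\<And>N. a (s N) - a (t N) \<ge> \<epsilon>" using gap(2) by metis
  have "bounded (range (\<lambda>N. (a (s N), a (t N))))"
  proof (rule bounded_subset)
    show "bounded ({- M..M} \<times> {- M..M})" by (intro bounded_Times) auto
    have "a n \<in> {- M..M}" for n using bd[of n] by (auto simp: abs_le_iff)
    then show "range (\<lambda>N. (a (s N), a (t N))) \<subseteq> {- M..M} \<times> {- M..M}" by auto
  qed
  from bounded_imp_convergent_subsequence[OF this]
  obtain p f where f: "strict_mono f" "((\<lambda>N. (a (s N), a (t N))) \<circ> f) \<longlonglongrightarrow> p" by blast
  have l1: "(\<lambda>n. a (s (f n))) \<longlonglongrightarrow> fst p" and l2: "(\<lambda>n. a (t (f n))) \<longlonglongrightarrow> snd p"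
    using tendsto_fst[OF f(2)] tendsto_snd[OF f(2)] by (simp_all add: o_def)
  have om: "u \<in> omega_set a" if "(\<lambda>n. a (h (f n))) \<longlonglongrightarrow> u" "\<And>N. h N > N" for h u
    unfolding omega_set_def
  proof (intro CollectI allI impI)
    fix e :: real and n0 :: nat assume "e > 0"
    then have "\<forall>\<^sub>F n in sequentially. \<bar>a (h (f n)) - u\<bar> < e"
      using that(1) unfolding tendsto_iff dist_real_def by blast
    then obtain N where N: "\<And>n. n \<ge> N \<Longrightarrow> \<bar>a (h (f n)) - u\<bar> < e" unfolding eventually_sequentially by blast
    let ?n = "max N n0"
    have "h (f ?n) > n0" using that(2)[of "f ?n"] seq_suble[OF f(1), of ?n] by linarith
    then show "\<exists>n>n0. a n \<in> {u - e<..<u + e}"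
      using N[of ?n] by (intro exI[of _ "h (f ?n)"]) (auto simp: abs_less_iff)
  qed
  have p1: "fst p \<in> omega_set a" and p2: "snd p \<in> omega_set a"
    using om[OF l1 st(1)] om[OF l2 st(2)] by auto
  have "\<epsilon> \<le> fst p - snd p"
    using tendsto_diff[OF l1 l2] by (rule LIMSEQ_le_const) (use st(3) in auto)
  then have lt: "snd p < fst p" using gap(1) by simp
  have "u \<in> {- M..M}" if "u \<in> omega_set a" for u
    using omega_set_ge[OF tendsto_const[of "- M"] _ that] omega_set_le[OF tendsto_const[of M] _ that] bd
    by (auto simp: abs_le_iff minus_le_iff)
  then have bdd: "bdd_above (omega_set a)" "bdd_below (omega_set a)"
    unfolding bdd_above_def bdd_below_def by (meson atLeastAtMost_iff)+
  have ne: "omega_set a \<noteq> {}" using p1 by blast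
  let ?x = "Inf (omega_set a)" and ?y = "Sup (omega_set a)"
  have xy: "?x \<in> omega_set a" "?y \<in> omega_set a"
    using closed_contains_Inf[OF ne bdd(2) closed_omega_set] closed_contains_Sup[OF ne bdd(1) closed_omega_set] by auto
  have "?x \<le> snd p" "fst p \<le> ?y" using cInf_lower[OF p2 bdd(2)] cSup_upper[OF p1 bdd(1)] by auto
  then have "?x < ?y" using lt by linarith
  moreover have "omega_set a = {?x..?y}"
  proof (intro equalityI subsetI)
    fix u assume "u \<in> omega_set a"
    then show "u \<in> {?x..?y}" using cInf_lower[OF _ bdd(2)] cSup_upper[OF _ bdd(1)] by auto
  next
    fix u assume u: "u \<in> {?x..?y}"
    then consider "u = ?x" | "u = ?y" | "?x < u" "u < ?y" by fastforce
    then show "u \<in> omega_set a" using xy omega_set_between[OF inc xy] by cases auto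
  qed
  ultimately show ?thesis unfolding nontrivial_closed_interval_def by blast
qed

text \<open>Used with y n the logarithm of the norm of the n-th derivative applied to a vector.
  Consecutive averages differ by (increment - average) / (n + 1), which yields the slow variation
  required by \<open>omega_set_nontrivial\<close>.\<close>

lemma omega_set_average:
  fixes y :: "nat \<Rightarrow> real"
  assumes inc: "\<And>n. \<alpha> \<le> y (Suc n) - y n" "\<And>n. y (Suc n) - y n \<le> \<beta>" and ab: "0 \<le> \<alpha>"
  defines "a \<equiv> \<lambda>n. 1 / real n * y n"
  shows "omega_set a \<subseteq> {\<alpha>..\<beta>}" "(\<lambda>n. a (Suc n) - a n) \<longlonglongrightarrow> 0" "\<exists>M. \<forall>n. \<bar>a n\<bar> \<le> M"
proof -
  have y: "y 0 + real n * \<alpha> \<le> y n" "y n \<le> y 0 + real n * \<beta>" for n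
  proof (induction n)
    case (Suc n)
    { case 1 then show ?case using Suc inc(1)[of n] by (simp add: algebra_simps) }
    { case 2 then show ?case using Suc inc(2)[of n] by (simp add: algebra_simps) }
  qed auto
  have lim: "(\<lambda>n. y 0 * (1 / real n) + c) \<longlonglongrightarrow> c" for c
    using tendsto_add[OF tendsto_mult[OF tendsto_const[of "y 0"] lim_1_over_n] tendsto_const[of c]] by simp
  have lo: "y 0 * (1 / real n) + \<alpha> \<le> a n" and hi: "a n \<le> y 0 * (1 / real n) + \<beta>" if "n \<ge> 1" for n
  proof -
    have eq: "y 0 * (1 / real n) + c = 1 / real n * (y 0 + real n * c)" for c
      using that by (simp add: field_simps)
    show "y 0 * (1 / real n) + \<alpha> \<le> a n" "a n \<le> y 0 * (1 / real n) + \<beta>"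
      unfolding eq a_def using y[of n] by (intro mult_left_mono; simp)+
  qed
  show "omega_set a \<subseteq> {\<alpha>..\<beta>}"
    using omega_set_ge[OF lim[of \<alpha>] lo] omega_set_le[OF lim[of \<beta>] hi] by auto
  have ab': "\<alpha> \<le> \<beta>" using inc[of 0] by linarith
  define M where "M = \<bar>y 0\<bar> + \<beta>"
  have M: "\<bar>a n\<bar> \<le> M" for n
  proof (cases "n \<ge> 1")
    case True
    have "\<bar>y 0 * (1 / real n)\<bar> \<le> \<bar>y 0\<bar> * 1" unfolding abs_mult using True by (intro mult_left_mono) auto
    then show ?thesis using lo[OF True] hi[OF True] ab ab' unfolding M_def by linarith
  next
    case False
    then have "n = 0" by simp
    then show ?thesis using ab ab' by (simp add: a_def M_def)
  qed
  then show "\<exists>M. \<forall>n. \<bar>a n\<bar> \<le> M" by blast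
  show "(\<lambda>n. a (Suc n) - a n) \<longlonglongrightarrow> 0"
  proof (rule Lim_null_comparison)
    show "\<forall>\<^sub>F n in sequentially. norm (a (Suc n) - a n) \<le> (\<beta> + M) * (1 / real (Suc n))"
      using eventually_ge_at_top[of 1]
    proof eventually_elim
      case (elim n)
      have "a (Suc n) - a n = ((y (Suc n) - y n) - a n) * (1 / real (Suc n))"
        using elim by (simp add: a_def field_simps)
      moreover have "\<bar>(y (Suc n) - y n) - a n\<bar> \<le> \<beta> + M"
        using inc[of n] M[of n] ab by linarith
      ultimately show ?case by (simp add: abs_mult divide_right_mono)
    qed
    have "(\<lambda>n. 1 / real (Suc n)) \<longlonglongrightarrow> 0" using LIMSEQ_inverse_real_of_nat by (simp add: inverse_eq_divide)
    from tendsto_mult[OF tendsto_const this] show "(\<lambda>n. (\<beta> + M) * (1 / real (Suc n))) \<longlonglongrightarrow> 0" by simp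
  qed
qed

section \<open>Orbits of boxes\<close>

text \<open>Stay $n$ starts at $x \approx \lambda^{-k_{n+1}}$; $W_{n+1}$ bounds the relative deviation from this
  value. In the unit $\mu^{-j}$ at $x \approx \lambda^{-j}$ the box has half-height \<open>hgt\<close> at the start and
  \<open>exh\<close> at the exit, where its centre has height \<open>esc (n + 1)\<close>. The partial sums $P_j$ of the
  values of $g$ are taken in the same units.\<close>

definition esc :: "real \<Rightarrow> (nat \<Rightarrow> nat) \<Rightarrow> nat \<Rightarrow> real" where
  "esc l k n = 1 / l ^ (k (Suc n) + 1)"

definition hgt :: "real \<Rightarrow> real \<Rightarrow> (nat \<Rightarrow> nat) \<Rightarrow> (nat \<Rightarrow> real) \<Rightarrow> nat \<Rightarrow> real" where
  "hgt l m k W n = m ^ k (Suc n) * l * W n"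

definition exh :: "real \<Rightarrow> real \<Rightarrow> (nat \<Rightarrow> nat) \<Rightarrow> (nat \<Rightarrow> real) \<Rightarrow> nat \<Rightarrow> real" where
  "exh l m k W n = hgt l m k W n * 2 ^ k n / 2 ^ k (Suc n)"

text \<open>\<open>VW\<close> closes the cycle: the half-height left at the exit, divided by the
  exit height, becomes the relative half-width in the next stay. The bounds on \<open>s\<close> put
  the vertical cut between the places used for j = 1 and j = 0. The factor 5 in \<open>k\<close>
  makes the time spent before stay n comparable to k n. \<open>Pb\<close> keeps escaping boxes above
  the lower edge of zone 1.\<close>

locale wandering =
  fixes l m s d :: real and g :: "real \<Rightarrow> real" and k :: "nat \<Rightarrow> nat"
    and W :: "nat \<Rightarrow> real" and P :: "nat \<Rightarrow> real"
  assumes l: "1 < l" "l \<le> 21/20" and m: "l < m" "m \<le> 21/20"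
    and s: "1/2 < s" "s < 1" "s \<le> 1 - d" "(1 + d) / l \<le> s"
    and d: "0 < d" "d \<le> 1/10"
    and g1: "Ck (Suc 0) g"
    and W: "\<And>n. 0 < W n" "\<And>n. W n < d"
    and k: "1 \<le> k 0" "\<And>n. 5 * k n \<le> k (Suc n)"
    and e0: "esc l k 0 \<le> 1/8"
    and e: "\<And>n. esc l k (Suc n) \<le> esc l k n / 4"
    and VW: "\<And>n. exh l m k W n \<le> esc l k (Suc n) * W (Suc (Suc n))"
    and P0: "P 0 = 0"
    and P1: "\<And>j. 1 \<le> j \<Longrightarrow> j \<le> k 0 \<Longrightarrow> P j = esc l k 0"
    and P2: "\<And>n j. k n < j \<Longrightarrow> j \<le> k (Suc n) \<Longrightarrow>
      P j = esc l k (Suc n) + hgt l m k W n * (2 ^ j - 2 ^ k n) / 2 ^ k (Suc n)"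
    and Pb: "\<And>j. P j < 1/2"
    and g: "\<And>j X. 1 \<le> j \<Longrightarrow> \<bar>X - 1\<bar> < d \<Longrightarrow> g (X / l ^ j) = (P j - P (j - 1)) / m ^ (j - 1)"
begin

abbreviation "F \<equiv> pw_map l m s g"
abbreviation "E \<equiv> esc l k"
abbreviation "Q \<equiv> hgt l m k W"
abbreviation "V \<equiv> exh l m k W"

lemma lm0: "0 < l" "0 < m" "1 < m" using l m by auto

lemma k_pos: "1 \<le> k n"
proof (induction n)
  case (Suc n)
  then show ?case using k(2)[of n] by linarith
qed (rule k(1))

lemma k_mono: "i \<le> n \<Longrightarrow> k i \<le> k n"
proof (induction rule: dec_induct)
  case (step n)
  then show ?case using k(2)[of n] by linarith
qed simp

lemma E_pos: "0 < E n" unfolding esc_def using lm0 by simp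

lemma E_antimono: "i \<le> n \<Longrightarrow> E n \<le> E i"
proof (induction rule: dec_induct)
  case (step n)
  then show ?case using e[of n] E_pos[of n] by linarith
qed simp

lemma E_le: "E n \<le> 1/8" using E_antimono[of 0 n] e0 by simp

lemma Q_pos: "0 < Q n" unfolding hgt_def using lm0 W by simp

lemma V_le: "V n \<le> E (Suc n) / 10"
proof -
  have "E (Suc n) * W (Suc (Suc n)) \<le> E (Suc n) * (1/10)"
    using W[of "Suc (Suc n)"] d E_pos[of "Suc n"] by (intro mult_left_mono) auto
  then show ?thesis using VW[of n] by simp
qed

text \<open>Keeps escaping boxes below the cut: the centre E(n+1) - P_j is at most E(n+1) - E(n) <
  0.\<close>

lemma P_ge: "1 \<le> j \<Longrightarrow> j \<le> k n \<Longrightarrow> E n \<le> P j"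
proof (induction n)
  case 0
  then show ?case using P1 by simp
next
  case (Suc n)
  show ?case
  proof (cases "j \<le> k n")
    case True
    then show ?thesis using Suc E_antimono[of n "Suc n"] by simp
  next
    case False
    then have "(2::real) ^ k n \<le> 2 ^ j" by (intro power_increasing) auto
    then have "0 \<le> Q n * (2 ^ j - 2 ^ k n) / 2 ^ k (Suc n)"
      using Q_pos[of n] by simp
    then show ?thesis using P2[of n j] False Suc.prems by simp
  qed
qed

text \<open>In the coordinates $X = \lambda^j x$, $Y = \mu^j y$ at the location $x \approx \lambda^{-j}$
  the map is $(j, X, Y) \mapsto (j - 1, X, P_j - P_{j-1} - |Y|)$: the orbit is folded about
  $Y = 0$ as long as $j > k_n$ and then escapes from the cut.\<close>

definition in_stage :: "nat \<times> nat \<Rightarrow> real^2 \<Rightarrow> bool" where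
  "in_stage = (\<lambda>(n, j) z. j \<le> k (Suc n) \<and> \<bar>l ^ j * z $ 1 - 1\<bar> \<le> W (Suc n) \<and>
     (if k n < j then \<bar>m ^ j * z $ 2\<bar> \<le> Q n * 2 ^ j / 2 ^ k (Suc n)
      else \<bar>m ^ j * z $ 2 - (E (Suc n) - P j)\<bar> \<le> V n))"

definition nxt :: "nat \<times> nat \<Rightarrow> nat \<times> nat" where
  "nxt = (\<lambda>(n, j). if j = 0 then (Suc n, k (Suc (Suc n))) else (n, j - 1))"

lemma le_scaled: "\<bar>y\<bar> \<le> m ^ j * \<bar>y\<bar>"
  using mult_right_mono[of 1 "m ^ j" "\<bar>y\<bar>"] one_le_power[of m j] lm0 by simp

text \<open>In unscaled height the folding bound is l W(n) times (m/2)^(K - j) with K = k(n+1), and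
  m < 2.\<close>

lemma stage_fold_height:
  assumes "in_stage (n, j) z" "k n < j"
  shows "\<bar>z $ 2\<bar> < 1/2"
proof -
  let ?K = "k (Suc n)"
  have j: "j \<le> ?K" and h: "\<bar>m ^ j * z $ 2\<bar> \<le> Q n * 2 ^ j / 2 ^ ?K"
    using assms by (auto simp: in_stage_def)
  have K: "m ^ ?K = m ^ j * m ^ (?K - j)" "(2::real) ^ ?K = 2 ^ j * 2 ^ (?K - j)"
    using j by (simp_all flip: power_add)
  have "m ^ j * \<bar>z $ 2\<bar> \<le> Q n * 2 ^ j / 2 ^ ?K" using h lm0 by (simp add: abs_mult)
  also have "\<dots> = m ^ j * ((m / 2) ^ (?K - j) * (l * W n))"
    unfolding hgt_def K by (simp add: power_divide)
  finally have "\<bar>z $ 2\<bar> \<le> (m / 2) ^ (?K - j) * (l * W n)" using lm0 by simp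
  also have "\<dots> \<le> 1 * (21/20 * (1/10))"
    using m lm0 l W[of n] d by (intro mult_mono power_le_one) auto
  finally show ?thesis by simp
qed

text \<open>During the escape the rescaled height is E(n+1) - P_j up to V(n). It is negative for j
  \<ge> 1, so the box stays in the lower branch, and positive for j = 0 because P_0 = 0, so the box
  leaves through zone 2.\<close>

lemma stage_location:
  assumes "in_stage (n, j) z"
  shows "j \<noteq> 0 \<Longrightarrow> 0 < z $ 1 \<and> z $ 1 < s \<and> \<bar>z $ 2\<bar> < 1/2"
    and "j \<noteq> 0 \<Longrightarrow> j \<le> k n \<Longrightarrow> z $ 2 < 0"
    and "j = 0 \<Longrightarrow> s < z $ 1 \<and> z $ 1 < 6/5 \<and> 0 < z $ 2 \<and> z $ 2 < 1/2"
proof -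
  have j: "j \<le> k (Suc n)" and X: "\<bar>l ^ j * z $ 1 - 1\<bar> \<le> W (Suc n)"
    using assms by (auto simp: in_stage_def)
  have Xd: "\<bar>l ^ j * z $ 1 - 1\<bar> < d" using X W(2)[of "Suc n"] by linarith
  then have "0 < l ^ j * z $ 1" using d by linarith
  then have z1: "0 < z $ 1" using lm0 by (simp add: zero_less_mult_iff)
  have neg: "z $ 2 < 0 \<and> \<bar>z $ 2\<bar> < 1/2" if "j \<noteq> 0" "j \<le> k n"
  proof -
    have Y: "\<bar>m ^ j * z $ 2 - (E (Suc n) - P j)\<bar> \<le> V n"
      using assms that(2) by (auto simp: in_stage_def)
    have "E n \<le> P j" using P_ge[of j n] that by simp
    then have lt: "m ^ j * z $ 2 < 0"
      using Y V_le[of n] e[of n] E_pos[of n] by linarith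
    then have neg: "z $ 2 < 0" using lm0 by (simp add: mult_less_0_iff)
    have "\<bar>m ^ j * z $ 2\<bar> < 1/2" using Y lt V_le[of n] E_pos[of "Suc n"] Pb[of j] by linarith
    moreover have "\<bar>m ^ j * z $ 2\<bar> = m ^ j * \<bar>z $ 2\<bar>" using lm0 by (simp add: abs_mult)
    ultimately show ?thesis using neg le_scaled[of "z $ 2" j] by linarith
  qed
  then show "j \<noteq> 0 \<Longrightarrow> j \<le> k n \<Longrightarrow> z $ 2 < 0" by blast
  show "0 < z $ 1 \<and> z $ 1 < s \<and> \<bar>z $ 2\<bar> < 1/2" if j0: "j \<noteq> 0"
  proof -
    have "l * z $ 1 \<le> l ^ j * z $ 1"
      using z1 l j0 self_le_power[of l j] by (intro mult_right_mono) auto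
    then have "l * z $ 1 < 1 + d" using Xd by linarith
    then have "z $ 1 < (1 + d) / l" using lm0 by (simp add: field_simps)
    then show ?thesis using z1 s(4) neg j0 stage_fold_height[OF assms] by (cases "k n < j") auto
  qed
  show "s < z $ 1 \<and> z $ 1 < 6/5 \<and> 0 < z $ 2 \<and> z $ 2 < 1/2" if j0: "j = 0"
  proof -
    have "\<bar>z $ 2 - E (Suc n)\<bar> \<le> V n" using assms P0 unfolding in_stage_def j0 by simp
    moreover have "\<bar>z $ 1 - 1\<bar> < d" using Xd unfolding j0 by simp
    ultimately show ?thesis
      using V_le[of n] E_pos[of "Suc n"] E_le[of "Suc n"] s(3) d by (auto simp: abs_less_iff)
  qed
qed

lemma F_stage:
  assumes "in_stage (n, j) z"
  shows "j \<noteq> 0 \<Longrightarrow> F z = vector [l * z $ 1, (P j - P (j - 1)) / m ^ (j - 1) - m * \<bar>z $ 2\<bar>]"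
    and "j = 0 \<Longrightarrow> F z = vector [l * z $ 2, l * (z $ 1 - 1)]"
proof -
  assume j: "j \<noteq> 0"
  have "\<bar>l ^ j * z $ 1 - 1\<bar> < d" using assms W(2)[of "Suc n"] by (auto simp: in_stage_def)
  from g[of j, OF _ this] j have "g (z $ 1) = (P j - P (j - 1)) / m ^ (j - 1)" using lm0 by simp
  then show "F z = vector [l * z $ 1, (P j - P (j - 1)) / m ^ (j - 1) - m * \<bar>z $ 2\<bar>]"
    using stage_location(1)[OF assms j] by (auto simp: pw_map_def abs_less_iff)
next
  assume "j = 0"
  from stage_location(3)[OF assms this] show "F z = vector [l * z $ 2, l * (z $ 1 - 1)]"
    by (simp add: pw_map_def)
qed

lemma in_stage_nxt:
  assumes "in_stage (n, j) z"
  shows "in_stage (nxt (n, j)) (F z)"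
proof (cases "j = 0")
  case True
  let ?K = "k (Suc (Suc n))"
  have z: "\<bar>z $ 1 - 1\<bar> \<le> W (Suc n)" "\<bar>z $ 2 - E (Suc n)\<bar> \<le> V n"
    using assms P0 True by (auto simp: in_stage_def)
  \<comment> \<open>The exit height E(n+1) is chosen so that l E(n+1) = l^-K is exactly where the
    next stay starts. The height error turns into the width error there, and the old width error
    into the new height.\<close>
  have EK: "E (Suc n) * (l ^ ?K * l) = 1" using lm0 by (simp add: esc_def)
  have "l ^ ?K * (l * z $ 2) - 1 = (z $ 2 - E (Suc n)) * (l ^ ?K * l)"
    using EK by (simp add: algebra_simps)
  then have "\<bar>l ^ ?K * (l * z $ 2) - 1\<bar> = \<bar>z $ 2 - E (Suc n)\<bar> * (l ^ ?K * l)"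
    using lm0 by (simp add: abs_mult)
  also have "\<dots> \<le> (E (Suc n) * W (Suc (Suc n))) * (l ^ ?K * l)"
    using z(2) VW[of n] lm0 by (intro mult_right_mono) auto
  also have "\<dots> = W (Suc (Suc n)) * (E (Suc n) * (l ^ ?K * l))" by (simp only: mult_ac)
  finally have 1: "\<bar>l ^ ?K * (l * z $ 2) - 1\<bar> \<le> W (Suc (Suc n))" unfolding EK by simp
  have "\<bar>m ^ ?K * (l * (z $ 1 - 1))\<bar> = m ^ ?K * l * \<bar>z $ 1 - 1\<bar>"
    using lm0 by (simp add: abs_mult)
  also have "\<dots> \<le> Q (Suc n)" unfolding hgt_def using z(1) lm0 by (intro mult_left_mono) auto
  finally have 2: "\<bar>m ^ ?K * (l * (z $ 1 - 1))\<bar> \<le> Q (Suc n)" .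
  have "k (Suc n) < ?K" using k(2)[of "Suc n"] k_pos[of "Suc n"] by linarith
  then show ?thesis unfolding nxt_def in_stage_def F_stage(2)[OF assms True]
    using 1 2 True by simp
next
  case False
  then obtain i where i: "j = Suc i" by (cases j) auto
  let ?K = "k (Suc n)"
  let ?Y = "m ^ j * z $ 2"
  have j: "j \<le> ?K" and X: "\<bar>l ^ j * z $ 1 - 1\<bar> \<le> W (Suc n)"
    using assms by (auto simp: in_stage_def)
  have F1: "l ^ i * (F z $ 1) = l ^ j * z $ 1" unfolding F_stage(1)[OF assms False] i by simp
  have "m ^ i * (F z $ 2) = (P j - P i) - m ^ j * \<bar>z $ 2\<bar>"
    unfolding F_stage(1)[OF assms False] using lm0 i by (simp add: field_simps)
  then have F2: "m ^ i * (F z $ 2) = (P j - P i) - \<bar>?Y\<bar>" using lm0 by (simp add: abs_mult)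
  have "if k n < i then \<bar>m ^ i * F z $ 2\<bar> \<le> Q n * 2 ^ i / 2 ^ ?K
      else \<bar>m ^ i * F z $ 2 - (E (Suc n) - P i)\<bar> \<le> V n"
  proof (cases "k n < j")
    case fold: True
    have Y: "\<bar>?Y\<bar> \<le> Q n * 2 ^ j / 2 ^ ?K" using assms fold by (auto simp: in_stage_def)
    show ?thesis
    proof (cases "k n < i")
      case True
      \<comment> \<open>With h the half-height allowed at i, |Y| ranges over [0, 2h]; subtracting it
        from h = P j - P i recentres the folded box on the cut.\<close>
      have "P j - P i = Q n * 2 ^ i / 2 ^ ?K"
        using P2[OF fold j] P2[OF True] j i by (simp add: field_simps)
      moreover have "Q n * 2 ^ j / 2 ^ ?K = 2 * (Q n * 2 ^ i / 2 ^ ?K)" unfolding i by simp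
      ultimately have "\<bar>m ^ i * F z $ 2\<bar> \<le> Q n * 2 ^ i / 2 ^ ?K" using Y unfolding F2 by linarith
      then show ?thesis using True by simp
    next
      case False
      then have kn: "k n = i" using fold i by simp
      \<comment> \<open>Last fold, j = k n + 1: |Y| lies in [0, 2V], so the summand V in P j
        recentres while the rest of P j - P i is the kick off the cut.\<close>
      have "P j = E (Suc n) + V n"
        using P2[OF fold j] unfolding exh_def kn i by simp
      moreover have "Q n * 2 ^ j / 2 ^ ?K = 2 * V n" unfolding exh_def kn i by simp
      ultimately have "\<bar>m ^ i * F z $ 2 - (E (Suc n) - P i)\<bar> \<le> V n" using Y unfolding F2 by linarith
      then show ?thesis using False by simp
    qed
  next
    case esc: False
    have Y: "\<bar>?Y - (E (Suc n) - P j)\<bar> \<le> V n" using assms esc by (auto simp: in_stage_def)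
    \<comment> \<open>Below the cut -|Y| = Y, so the step leaves Y + P_j unchanged.\<close>
    have "z $ 2 < 0" using stage_location(2)[OF assms False] esc by simp
    then have "?Y < 0" using lm0 by (simp add: mult_less_0_iff)
    then have "m ^ i * F z $ 2 - (E (Suc n) - P i) = ?Y - (E (Suc n) - P j)"
      unfolding F2 by simp
    then show ?thesis using Y esc i by simp
  qed
  moreover have "\<bar>l ^ i * F z $ 1 - 1\<bar> \<le> W (Suc n)" using X unfolding F1 .
  ultimately show ?thesis unfolding nxt_def in_stage_def using j i by simp
qed

lemma in_stage_zone:
  assumes "in_stage (n, j) z" "z $ 2 \<noteq> 0"
  shows "z \<in> (if j = 0 then zone s 2 else if 0 < z $ 2 then zone s 0 else zone s 1)"
  using stage_location(1,3)[OF assms(1)] assms(2)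
  by (auto simp: mem_zone abs_less_iff simp del: One_nat_def)

text \<open>Near the orbit \<open>g\<close> is locally constant, so the shear entry vanishes;
  absolute values absorb the sign of the slope, which depends on the side of the cut.\<close>

lemma F_has_derivative:
  assumes st: "in_stage (n, j) z" and z2: "z $ 2 \<noteq> 0"
  shows "\<exists>L. (F has_derivative L) (at z) \<and>
    (\<forall>v. if j = 0 then \<bar>L v $ 1\<bar> = l * \<bar>v $ 2\<bar> \<and> \<bar>L v $ 2\<bar> = l * \<bar>v $ 1\<bar>
         else \<bar>L v $ 1\<bar> = l * \<bar>v $ 1\<bar> \<and> \<bar>L v $ 2\<bar> = m * \<bar>v $ 2\<bar>)"
proof -
  have loc: "(F has_derivative L) (at z)"
    if "(pw_branch l m g i has_derivative L) (at z)" "i < 4" "z \<in> zone s i" for i L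
    by (rule has_derivative_transform_within_open[OF that(1) open_zone[OF that(2)] that(3)])
       (rule pw_branch_eq[OF that(2)])
  show ?thesis
  proof (cases "j = 0")
    case True
    have "(F has_derivative (\<lambda>v. vector [l * v $ 2, l * v $ 1])) (at z)"
      by (rule loc[of 2]) (use in_stage_zone[OF assms] True in \<open>simp_all add: pw_branch_simps sw_has_derivative\<close>)
    then show ?thesis using True lm0 by (intro exI conjI) (auto simp: abs_mult)
  next
    case False
    have "\<bar>l ^ j * z $ 1 - 1\<bar> < d" using st W(2)[of "Suc n"] by (auto simp: in_stage_def)
    moreover have "open {x. \<bar>l ^ j * x - 1\<bar> < d}"
      by (intro open_Collect_less continuous_intros)
    moreover have "(P j - P (j - 1)) / m ^ (j - 1) = g x" if "x \<in> {x. \<bar>l ^ j * x - 1\<bar> < d}" for x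
      using g[of j "l ^ j * x"] that False lm0 by simp
    ultimately have g': "(g has_real_derivative 0) (at (z $ 1))"
      by (intro has_field_derivative_transform_within_open[OF DERIV_const]) auto
    have "(F has_derivative (\<lambda>v. vector [l * v $ 1, (if 0 < z $ 2 then - m else m) * v $ 2 + 0 * v $ 1])) (at z)"
    proof (cases "0 < z $ 2")
      case True
      show ?thesis
        by (rule loc[of 0]) (use br_has_derivative[OF g', of l "- m"] in_stage_zone[OF assms] True False
          in \<open>simp_all add: pw_branch_simps\<close>)
    next
      case neg: False
      have "z \<in> zone s 1" using in_stage_zone[OF assms] neg False by (simp only: if_False)
      moreover have "(pw_branch l m g 1 has_derivative (\<lambda>v. vector [l * v $ 1, m * v $ 2 + 0 * v $ 1])) (at z)"
        unfolding pw_branch_simps by (rule br_has_derivative[OF g'])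
      ultimately show ?thesis using loc[of 1] neg by simp
    qed
    then show ?thesis using False lm0 by (intro exI conjI) (auto simp: abs_mult)
  qed
qed

text \<open>Different j are separated horizontally because 1 + d \<le> l (1 - d). For equal j and n
  < n', stay n' is already escaping at j. The quantity Y + P_j is at least E(n+1) - V(n) in stay n,
  folding or escaping, and at most E(n'+1) + V(n') in stay n', which is smaller since E(n'+1) \<le>
  E(n+1)/4.\<close>

lemma in_stage_inj:
  assumes "in_stage (n, j) z" "in_stage (n', j') z"
  shows "(n, j) = (n', j')"
proof -
  have less: False if a: "in_stage (n, j) z" and b: "in_stage (n', j') z" and jj: "j < j'" for n j n' j'
  proof -
    have "\<bar>l ^ j * z $ 1 - 1\<bar> < d" "\<bar>l ^ j' * z $ 1 - 1\<bar> < d"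
      using a b W(2)[of "Suc n"] W(2)[of "Suc n'"] by (auto simp: in_stage_def)
    then have X: "1 - d < l ^ j * z $ 1" "l ^ j' * z $ 1 < 1 + d" by (auto simp: abs_less_iff)
    then have "0 < l ^ j * z $ 1" using d by linarith
    then have z1: "0 < z $ 1" using lm0 by (simp add: zero_less_mult_iff)
    have "l ^ Suc j * z $ 1 \<le> l ^ j' * z $ 1"
      using jj l z1 by (intro mult_right_mono power_increasing) auto
    moreover have "1 + d \<le> l * (1 - d)" using s(3,4) lm0 by (simp add: pos_divide_le_eq mult.commute) (meson mult_left_mono order_trans less_imp_le)
    moreover have "l * (1 - d) < l * (l ^ j * z $ 1)" using X lm0 by simp
    ultimately show False using X by (simp add: mult.assoc)
  qed
  then have jj: "j = j'" using assms by (metis linorder_neqE_nat)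
  have less_n: False if a: "in_stage (n, j) z" and b: "in_stage (n', j) z" and nn: "n < n'" for n n'
  proof -
    let ?Y = "m ^ j * z $ 2"
    have jn: "j \<le> k (Suc n)" using a by (simp add: in_stage_def)
    then have "j \<le> k n'" using nn k_mono[of "Suc n" n'] by simp
    then have b': "\<bar>?Y - (E (Suc n') - P j)\<bar> \<le> V n'" using b by (simp add: in_stage_def)
    have EE: "E (Suc n') \<le> E (Suc n) / 4"
      using e[of "n'"] E_antimono[of "Suc n" n'] nn by linarith
    have V: "V n' \<le> E (Suc n) / 40" "V n \<le> E (Suc n) / 10" using V_le[of n'] V_le[of n] EE by linarith+
    show False
    proof (cases "k n < j")
      case True
      have Y: "\<bar>?Y\<bar> \<le> Q n * 2 ^ j / 2 ^ k (Suc n)" using a True by (simp add: in_stage_def)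
      have "P j = E (Suc n) + Q n * 2 ^ j / 2 ^ k (Suc n) - V n"
        using P2[OF True jn] unfolding exh_def by (simp add: algebra_simps diff_divide_distrib)
      then show False using Y b' EE V E_pos[of "Suc n"] by linarith
    next
      case False
      then have "\<bar>?Y - (E (Suc n) - P j)\<bar> \<le> V n" using a by (simp add: in_stage_def)
      then show False using b' EE V E_pos[of "Suc n"] by linarith
    qed
  qed
  show ?thesis using less_n assms jj by (metis linorder_neqE_nat)
qed

end

section \<open>The itinerary and the wandering rectangle\<close>

context wandering
begin

primrec stage :: "nat \<Rightarrow> nat \<times> nat" where
  "stage 0 = (0, k (Suc 0))"
| "stage (Suc t) = nxt (stage t)"

definition start :: "nat \<Rightarrow> nat" where
  "start n = (\<Sum>i<n. k (Suc i) + 1)"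

text \<open>The elapsed time can be read off the stage, so no stage occurs twice; with
  \<open>in_stage_inj\<close> this gives disjoint images.\<close>

lemma stage_time: "snd (stage t) \<le> k (Suc (fst (stage t))) \<and>
    start (fst (stage t)) + k (Suc (fst (stage t))) = t + snd (stage t)"
proof (induction t)
  case (Suc t)
  obtain n j where nj: "stage t = (n, j)" by (cases "stage t")
  then have IH: "j \<le> k (Suc n)" "start n + k (Suc n) = t + j" using Suc by simp_all
  show ?case
  proof (cases "j = 0")
    case True
    then show ?thesis using IH by (simp add: nj nxt_def start_def)
  next
    case False
    then show ?thesis using IH by (simp add: nj nxt_def)
  qed
qed (simp add: start_def)

lemma stage_inj:
  assumes "stage t = stage t'"
  shows "t = t'"
  using stage_time[of t] stage_time[of t'] unfolding assms by linarith

lemma stage_in_stay: "stage T = (n, j) \<Longrightarrow> i \<le> j \<Longrightarrow> stage (T + i) = (n, j - i)"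
proof (induction i)
  case (Suc i)
  have "i \<le> j" using Suc.prems(2) by (rule Suc_leD)
  then have "stage (T + Suc i) = nxt (n, j - i)" using Suc.IH[OF Suc.prems(1)] by simp
  moreover have "nxt (n, j - i) = (n, j - Suc i)" using Suc.prems(2) unfolding nxt_def by simp
  ultimately show ?case by (rule trans)
qed simp

lemma stage_start: "stage (start n) = (n, k (Suc n))"
proof (induction n)
  case (Suc n)
  then have "stage (start n + k (Suc n)) = (n, 0)" using stage_in_stay[OF Suc, of "k (Suc n)"] by simp
  then show ?case by (simp add: start_def nxt_def)
qed (simp add: start_def)

text \<open>As stay lengths grow at least by the factor 5, the total time is dominated by the last
  stay.\<close>

lemma start_le: "start n \<le> 4 * k n"
proof (induction n)
  case (Suc n)
  then show ?case using k(2)[of n] k_pos[of "Suc n"] by (simp add: start_def)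
qed (simp add: start_def)

lemma start_ge: "n \<le> start n" "1 \<le> n \<Longrightarrow> k n \<le> start n"
proof -
  show "n \<le> start n" unfolding start_def by (induction n) auto
  assume "1 \<le> n"
  then obtain i where "n = Suc i" by (cases n) auto
  then show "k n \<le> start n" by (simp add: start_def)
qed

text \<open>The interior of the set of points at stage (0, k 1), in unscaled coordinates.\<close>

definition rect :: "(real^2) set" where
  "rect = box (vector [(1 - W 1) / l ^ k 1, - (Q 0 / m ^ k 1)]) (vector [(1 + W 1) / l ^ k 1, Q 0 / m ^ k 1])"

lemma rect_open_rectangle: "open_rectangle rect"
proof -
  have "vector [1 / l ^ k 1, 0] \<in> rect"
    using lm0 W(1)[of 1] Q_pos[of 0] by (auto simp: rect_def mem_box_cart forall_2 divide_strict_right_mono)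
  then show ?thesis unfolding rect_def by (intro open_rectangle_box) auto
qed

lemma rect_in_stage: "z \<in> rect \<Longrightarrow> in_stage (stage 0) z"
proof -
  assume z: "z \<in> rect"
  have lk: "0 < l ^ k 1" "0 < m ^ k 1" using lm0 by simp_all
  have 1: "1 - W 1 < l ^ k 1 * z $ 1" "l ^ k 1 * z $ 1 < 1 + W 1" "- Q 0 < m ^ k 1 * z $ 2" "m ^ k 1 * z $ 2 < Q 0"
    using z lk by (auto simp: rect_def mem_box_cart forall_2 field_simps)
  have "k 0 < k 1" using k(2)[of 0] k(1) by simp
  then show ?thesis using 1 by (auto simp: in_stage_def abs_le_iff)
qed

lemma orbit_in_stage: "z \<in> rect \<Longrightarrow> in_stage (stage t) ((F ^^ t) z)"
proof (induction t)
  case (Suc t)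
  then show ?case using in_stage_nxt[of "fst (stage t)" "snd (stage t)"] by simp
qed (simp add: rect_in_stage del: stage.simps)

lemma rect_subset: "rect \<subseteq> dom0"
proof
  fix z assume "z \<in> rect"
  then have "in_stage (0, k (Suc 0)) z" using rect_in_stage by simp
  from stage_location(1)[OF this] show "z \<in> dom0" using k_pos[of "Suc 0"] s by (auto simp: mem_dom0 abs_less_iff)
qed

lemma rect_wandering: "wandering_domain (dom1 s) F rect"
  unfolding wandering_domain_def
proof (intro conjI allI impI)
  show "open rect" unfolding rect_def by (rule open_box)
  show "connected rect" unfolding rect_def by (intro convex_connected convex_box)
  fix t t' :: nat assume "t \<noteq> t'"
  show "pw_image (dom1 s) F t rect \<inter> pw_image (dom1 s) F t' rect = {}"
  proof (rule ccontr)
    assume "\<not> ?thesis"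
    then obtain x y where "x \<in> rect" "y \<in> rect" "(F ^^ t) x = (F ^^ t') y"
      unfolding pw_image_def by auto
    then have "in_stage (stage t) ((F ^^ t) x)" "in_stage (stage t') ((F ^^ t) x)"
      using orbit_in_stage[of x t] orbit_in_stage[of y t'] by simp_all
    then have "stage t = stage t'"
      using in_stage_inj[of "fst (stage t)" "snd (stage t)" _ "fst (stage t')" "snd (stage t')"] by simp
    then show False using stage_inj \<open>t \<noteq> t'\<close> by blast
  qed
qed

section \<open>Almost every point of the rectangle is regular\<close>

lemma F_branch: "\<exists>i<4. F z = pw_branch l m g i z"
proof -
  have "F z = pw_branch l m g 0 z \<or> F z = pw_branch l m g 1 z \<or> F z = pw_branch l m g 2 z \<or> F z = pw_branch l m g 3 z"
    unfolding pw_branch_simps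
    by (auto simp: pw_map_def br_def sw_def vec2_eq_iff algebra_simps abs_if)
  then show ?thesis unfolding less_4_cases by blast
qed

lemma branch_left_inverse:
  assumes "i < 4"
  shows "\<exists>h. h differentiable_on UNIV \<and> (\<forall>z. h (pw_branch l m g i z) = z)"
proof -
  have br: "\<exists>h. h differentiable_on UNIV \<and> (\<forall>z. h (br l m' g z) = z)" if "m' \<noteq> 0" for m'
  proof (intro exI conjI allI)
    let ?h = "br (1 / l) (1 / m') (\<lambda>x. - (1 / m') * g ((1 / l) * x))"
    have "Cr_on (Suc 0) ?h UNIV" by (intro br_Cr br_inverse_Ck g1)
    then show "?h differentiable_on UNIV" by (simp add: differentiable_on_def differentiable_at_withinI)
    show "?h (br l m' g z) = z" for z using lm0 that by (intro br_inverse) auto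
  qed
  have sw: "\<exists>h. h differentiable_on UNIV \<and> (\<forall>z. h (sw l a b z) = z)" for a b
  proof (intro exI conjI allI)
    let ?h = "sw (1 / l) (- b / l) (- a / l)"
    have "Cr_on (Suc 0) ?h UNIV" by (rule sw_Cr)
    then show "?h differentiable_on UNIV" by (simp add: differentiable_on_def differentiable_at_withinI)
    show "?h (sw l a b z) = z" for z using lm0 by (intro sw_inverse) auto
  qed
  show ?thesis using assms br[of m] br[of "- m"] sw[of 0 "- l"] sw[of "l * (11/10)" "- 11/10"] lm0
    unfolding less_4_cases by (elim disjE; simp only: pw_branch_simps; simp)
qed

text \<open>At every point the map agrees with one of four branches, each with a differentiable left
  inverse on the plane, so the preimage is covered by four differentiable images of Z.\<close>

lemma negligible_vimage_F:
  assumes "negligible Z"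
  shows "negligible {z. F z \<in> Z}"
proof -
  have "negligible {z. pw_branch l m g i z \<in> Z}" if i: "i < 4" for i
  proof -
    obtain h where h: "h differentiable_on UNIV" "\<And>z. h (pw_branch l m g i z) = z"
      using branch_left_inverse[OF i] by blast
    have "negligible (h ` Z)"
      by (rule negligible_differentiable_image_negligible[OF _ assms])
         (use h(1) differentiable_on_subset in auto)
    moreover have "{z. pw_branch l m g i z \<in> Z} \<subseteq> h ` Z"
    proof
      fix z assume "z \<in> {z. pw_branch l m g i z \<in> Z}"
      then show "z \<in> h ` Z" using h(2)[of z] by (metis image_eqI mem_Collect_eq)
    qed
    ultimately show ?thesis by (rule negligible_subset)
  qed
  then have "negligible (\<Union>i<4. {z. pw_branch l m g i z \<in> Z})" by (intro negligible_Union) auto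
  then show ?thesis
  proof (rule negligible_subset)
    show "{z. F z \<in> Z} \<subseteq> (\<Union>i<4. {z. pw_branch l m g i z \<in> Z})"
    proof
      fix z assume "z \<in> {z. F z \<in> Z}"
      then show "z \<in> (\<Union>i<4. {z. pw_branch l m g i z \<in> Z})" using F_branch[of z] by auto
    qed
  qed
qed

lemma negligible_orbit_hits_axis: "negligible {z. (F ^^ t) z $ 2 = 0}"
proof (induction t)
  case 0
  have "negligible {z::real^2. z $ 2 = 0}"
    by (rule negligible_standard_hyperplane_cart)
  then show ?case by simp
next
  case (Suc t)
  have "{z. (F ^^ Suc t) z $ 2 = 0} = {z. F z \<in> {z. (F ^^ t) z $ 2 = 0}}"
    by (simp add: funpow_swap1)
  then show ?case using negligible_vimage_F[OF Suc] by simp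
qed

text \<open>The stages keep the orbit away from all cuts except the horizontal axis, so a point
  whose orbit never meets this axis is regular.\<close>

lemma rect_AE_regular: "AE z in lebesgue. z \<in> rect \<longrightarrow> z \<in> rect \<inter> regular_points (dom1 s) F"
proof (rule AE_I')
  show "(\<Union>t. {z. (F ^^ t) z $ 2 = 0}) \<in> null_sets lebesgue"
    unfolding negligible_iff_null_sets[symmetric]
    by (rule negligible_Union_nat) (rule negligible_orbit_hits_axis)
  have "z \<in> regular_points (dom1 s) F" if z: "z \<in> rect" and nz: "\<And>t. (F ^^ t) z $ 2 \<noteq> 0" for z
    unfolding regular_points_def
  proof (intro CollectI allI)
    fix t
    show "(F ^^ t) z \<in> dom1 s"
      using in_stage_zone[of "fst (stage t)" "snd (stage t)", OF _ nz[of t]] orbit_in_stage[OF z, of t]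
      unfolding mem_dom1 by (auto split: if_splits)
  qed
  then show "{z \<in> space lebesgue. \<not> (z \<in> rect \<longrightarrow> z \<in> rect \<inter> regular_points (dom1 s) F)}
      \<subseteq> (\<Union>t. {z. (F ^^ t) z $ 2 = 0})" by blast
qed

section \<open>Growth of tangent vectors along the orbit\<close>

primrec growth :: "real^2 \<Rightarrow> nat \<Rightarrow> real \<times> real" where
  "growth v 0 = (\<bar>v $ 1\<bar>, \<bar>v $ 2\<bar>)"
| "growth v (Suc t) = (if snd (stage t) = 0 then (l * snd (growth v t), l * fst (growth v t))
     else (l * fst (growth v t), m * snd (growth v t)))"

lemma orbit_derivative:
  assumes z: "z \<in> rect" "z \<in> regular_points (dom1 s) F"
  shows "\<exists>L. ((F ^^ t) has_derivative L) (at z) \<and>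
    (\<forall>v. \<bar>L v $ 1\<bar> = fst (growth v t) \<and> \<bar>L v $ 2\<bar> = snd (growth v t))"
proof (induction t)
  case 0
  show ?case by (intro exI[of _ "\<lambda>v. v"]) (simp add: id_def)
next
  case (Suc t)
  then obtain L where L: "((F ^^ t) has_derivative L) (at z)"
    "\<And>v. \<bar>L v $ 1\<bar> = fst (growth v t) \<and> \<bar>L v $ 2\<bar> = snd (growth v t)" by blast
  have "(F ^^ t) z \<in> dom1 s" using z(2) by (simp add: regular_points_def)
  then have nz: "(F ^^ t) z $ 2 \<noteq> 0" by (auto simp: mem_dom1 mem_zone simp del: One_nat_def)
  have "in_stage (fst (stage t), snd (stage t)) ((F ^^ t) z)" using orbit_in_stage[OF z(1), of t] by simp
  from F_has_derivative[OF this nz] obtain M where M: "(F has_derivative M) (at ((F ^^ t) z))"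
    "\<And>v. if snd (stage t) = 0 then \<bar>M v $ 1\<bar> = l * \<bar>v $ 2\<bar> \<and> \<bar>M v $ 2\<bar> = l * \<bar>v $ 1\<bar>
         else \<bar>M v $ 1\<bar> = l * \<bar>v $ 1\<bar> \<and> \<bar>M v $ 2\<bar> = m * \<bar>v $ 2\<bar>" by blast
  have "((F ^^ Suc t) has_derivative (\<lambda>v. M (L v))) (at z)"
    using has_derivative_compose[OF L(1) M(1)] by (simp add: o_def)
  moreover have "\<bar>M (L v) $ 1\<bar> = fst (growth v (Suc t)) \<and> \<bar>M (L v) $ 2\<bar> = snd (growth v (Suc t))" for v
    using M(2)[of "L v"] L(2)[of v] by (simp split: if_splits)
  ultimately show ?case by blast
qed

definition gnorm :: "real^2 \<Rightarrow> nat \<Rightarrow> real" where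
  "gnorm v t = sqrt ((fst (growth v t))\<^sup>2 + (snd (growth v t))\<^sup>2)"

lemma lyap_seq_gnorm:
  assumes "z \<in> rect" "z \<in> regular_points (dom1 s) F"
  shows "lyap_seq F z v = (\<lambda>t. 1 / real t * ln (gnorm v t))"
proof
  fix t
  obtain L where L: "((F ^^ t) has_derivative L) (at z)"
    "\<And>v. \<bar>L v $ 1\<bar> = fst (growth v t) \<and> \<bar>L v $ 2\<bar> = snd (growth v t)"
    using orbit_derivative[OF assms, of t] by blast
  have "frechet_derivative (F ^^ t) (at z) = L" by (rule frechet_derivative_at[OF L(1), symmetric])
  moreover have "norm (L v) = gnorm v t"
    using L(2)[of v] unfolding norm_vec2 gnorm_def by (metis power2_abs)
  ultimately show "lyap_seq F z v t = 1 / real t * ln (gnorm v t)" by (simp add: lyap_seq_def)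
qed

lemma growth_nonneg: "0 \<le> fst (growth v t) \<and> 0 \<le> snd (growth v t)"
  using lm0 by (induction t) auto

lemma gnorm_step: "l * gnorm v t \<le> gnorm v (Suc t)" "gnorm v (Suc t) \<le> m * gnorm v t"
proof -
  obtain a b where ab: "growth v t = (a, b)" by (cases "growth v t")
  have lm2: "l\<^sup>2 \<le> m\<^sup>2" using lm0 m by (intro power_mono) auto
  have b2: "l\<^sup>2 * b\<^sup>2 \<le> m\<^sup>2 * b\<^sup>2" "l\<^sup>2 * a\<^sup>2 \<le> m\<^sup>2 * a\<^sup>2" using lm2 by (auto intro: mult_right_mono)
  have l': "l * gnorm v t = sqrt (l\<^sup>2 * (a\<^sup>2 + b\<^sup>2))" "m * gnorm v t = sqrt (m\<^sup>2 * (a\<^sup>2 + b\<^sup>2))"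
    using lm0 by (simp_all add: gnorm_def ab real_sqrt_mult)
  show "l * gnorm v t \<le> gnorm v (Suc t)" "gnorm v (Suc t) \<le> m * gnorm v t"
    unfolding l' gnorm_def[of v "Suc t"] using b2
    by (auto simp: ab power_mult_distrib algebra_simps intro!: real_sqrt_le_mono)
qed

lemma gnorm_pos: "v \<noteq> 0 \<Longrightarrow> 0 < gnorm v t"
proof (induction t)
  case 0
  then have "0 < norm v" by simp
  then show ?case by (simp add: gnorm_def norm_vec2)
next
  case (Suc t)
  then have "0 < l * gnorm v t" using lm0 by simp
  then show ?case using gnorm_step(1)[of v t] by linarith
qed

lemma growth_in_stay:
  "i \<le> k (Suc n) \<Longrightarrow> growth v (start n + i) = (l ^ i * fst (growth v (start n)), m ^ i * snd (growth v (start n)))"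
proof (induction i)
  case (Suc i)
  have "stage (start n + i) = (n, k (Suc n) - i)" using stage_in_stay[OF stage_start] Suc.prems by simp
  then show ?case using Suc by simp
qed simp

text \<open>Relative growth of the two components at the start of stay $n$ of the orbit near the
  fixed point; the exit of each stay exchanges the components.\<close>

definition comp1 :: "real^2 \<Rightarrow> nat \<Rightarrow> real" where
  "comp1 v n = fst (growth v (start n)) / l ^ start n"

lemma growth_start_Suc:
  "growth v (start (Suc n)) = (l * (m ^ k (Suc n) * snd (growth v (start n))), l * (l ^ k (Suc n) * fst (growth v (start n))))"
proof -
  have "stage (start n + k (Suc n)) = (n, 0)" using stage_in_stay[OF stage_start, of "k (Suc n)"] by simp
  then show ?thesis using growth_in_stay[of "k (Suc n)" n v] by (simp add: start_def)
qed

text \<open>During the last stay this component was in first place and gained only l per step, as it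
  did in the exchange.\<close>

lemma snd_growth_start: "snd (growth v (start (Suc n))) = l ^ start (Suc n) * comp1 v n"
proof -
  have "start (Suc n) = Suc (k (Suc n) + start n)" by (simp add: start_def)
  then show ?thesis using lm0 unfolding growth_start_Suc by (simp add: comp1_def power_add)
qed

text \<open>A component is in first and second place in alternate stays and gains on l only in
  second place, by m/l per step. Since the components do not mix, the recursion has step
  two.\<close>

lemma comp1_Suc_Suc: "comp1 v (Suc (Suc n)) = (m / l) ^ k (Suc (Suc n)) * comp1 v n"
proof -
  have "start (Suc (Suc n)) = Suc (k (Suc (Suc n)) + start (Suc n))" by (simp add: start_def)
  then show ?thesis
    using lm0 unfolding comp1_def[of v "Suc (Suc n)"] growth_start_Suc[of v "Suc n"] snd_growth_start[of v n]
    by (simp add: power_add power_divide)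
qed

lemma th_gt: "1 < m / l" using m lm0 by simp

text \<open>The recursion yields exponents of the form k(n) + k(n-2) + ..., at most 2 k(n). Its step
  two is the reason for treating n and n + 1 together in the induction.\<close>

lemma comp1_upper: "comp1 v n \<le> (\<bar>v $ 1\<bar> + \<bar>v $ 2\<bar>) * (m / l) ^ (2 * k n)"
proof -
  let ?C = "\<bar>v $ 1\<bar> + \<bar>v $ 2\<bar>" and ?th = "m / l"
  have "comp1 v n \<le> ?C * ?th ^ (2 * k n) \<and> comp1 v (Suc n) \<le> ?C * ?th ^ (2 * k (Suc n))"
  proof (induction n)
    case 0
    have "1 * 1 \<le> (1 + 0) * ?th ^ (2 * k 0)" using one_le_power[of ?th "2 * k 0"] th_gt by simp
    then have "?C * 1 \<le> ?C * ?th ^ (2 * k 0)" by (intro mult_left_mono) auto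
    then have 1: "comp1 v 0 \<le> ?C * ?th ^ (2 * k 0)" by (simp add: comp1_def start_def)
    have "comp1 v (Suc 0) = ?th ^ k (Suc 0) * \<bar>v $ 2\<bar>"
      unfolding comp1_def growth_start_Suc using lm0 by (simp add: start_def power_divide)
    also have "\<dots> \<le> ?th ^ (2 * k (Suc 0)) * ?C"
      using th_gt lm0 by (intro mult_mono power_increasing) auto
    finally show ?case using 1 by (simp add: mult.commute)
  next
    case (Suc n)
    have "comp1 v (Suc (Suc n)) \<le> ?th ^ k (Suc (Suc n)) * (?C * ?th ^ (2 * k n))"
      unfolding comp1_Suc_Suc using Suc th_gt by (intro mult_left_mono) auto
    also have "\<dots> = ?C * ?th ^ (k (Suc (Suc n)) + 2 * k n)" by (simp add: power_add)
    also have "\<dots> \<le> ?C * ?th ^ (2 * k (Suc (Suc n)))"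
      using th_gt k(2)[of n] k(2)[of "Suc n"] by (intro mult_left_mono power_increasing) auto
    finally show ?case using Suc by blast
  qed
  then show ?thesis by blast
qed

text \<open>Only the last factor of the recursion is kept; the earlier ones are at least 1.\<close>

lemma comp1_lower:
  assumes "0 < comp1 v i"
  shows "comp1 v i * (m / l) ^ k (i + 2 * j + 2) \<le> comp1 v (i + 2 * j + 2)"
proof -
  have mono: "comp1 v i \<le> comp1 v (i + 2 * j)" for j
  proof (induction j)
    case (Suc j)
    have "comp1 v (i + 2 * j) * 1 \<le> comp1 v (i + 2 * j) * (m / l) ^ k (Suc (Suc (i + 2 * j)))"
      using Suc assms th_gt by (intro mult_left_mono) (auto intro: one_le_power)
    then show ?case using Suc comp1_Suc_Suc[of v "i + 2 * j"] by (simp add: mult.commute)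
  qed simp
  have "(m / l) ^ k (i + 2 * j + 2) * comp1 v i \<le> (m / l) ^ k (i + 2 * j + 2) * comp1 v (i + 2 * j)"
    using mono[of j] lm0 by (intro mult_left_mono) auto
  then show ?thesis using comp1_Suc_Suc[of v "i + 2 * j"] by (simp add: mult.commute)
qed

end

section \<open>Oscillation of the growth rates\<close>

text \<open>The excess y over the slow rate, accumulated by time T, grows by at most L in the next h
  steps, so its average drops. The constant is (1/4 - 1/8) / (4 * 5), from the numerator y h - T L
  and the denominator T (T + h).\<close>

lemma average_gap:
  fixes \<kappa> T h y L \<eta> :: real
  assumes "1 \<le> \<kappa>" "0 < T" "T \<le> 4 * \<kappa>" "\<kappa> / 2 \<le> h" "h \<le> \<kappa>" "\<kappa> * \<eta> / 2 \<le> y" "32 * L \<le> \<kappa> * \<eta>" "0 \<le> L" "0 < \<eta>"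
  shows "\<eta> / 160 \<le> y / T - (y + L) / (T + h)"
proof -
  have h0: "0 < h" using assms by linarith
  have eq: "y / T - (y + L) / (T + h) = (y * h - T * L) / (T * (T + h))"
    using assms(2) h0 by (simp add: field_simps)
  have "(\<kappa> * \<eta> / 2) * (\<kappa> / 2) \<le> y * h"
    using assms h0 by (intro mult_mono) auto
  moreover have "T * L \<le> 4 * \<kappa> * L" using assms by (intro mult_right_mono) auto
  moreover have "32 * L * \<kappa> \<le> \<kappa> * \<eta> * \<kappa>" using assms by (intro mult_right_mono) auto
  ultimately have num: "\<kappa> * \<kappa> * \<eta> / 8 \<le> y * h - T * L" by (simp add: algebra_simps)
  have den: "T * (T + h) \<le> (4 * \<kappa>) * (5 * \<kappa>)" using assms h0 by (intro mult_mono) auto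
  have pos: "0 < T * (T + h)" using assms h0 by simp
  have "(\<kappa> * \<kappa> * \<eta> / 8) / ((4 * \<kappa>) * (5 * \<kappa>)) \<le> (y * h - T * L) / (T * (T + h))"
  proof (rule frac_le)
    have "0 \<le> \<kappa> * \<kappa> * \<eta> / 8" using assms by simp
    then show "0 \<le> y * h - T * L" using num by linarith
  qed (use num den pos in simp_all)
  moreover have "(\<kappa> * \<kappa> * \<eta> / 8) / ((4 * \<kappa>) * (5 * \<kappa>)) = \<eta> / 160"
    using assms(1) by (simp add: field_simps)
  ultimately show ?thesis unfolding eq by linarith
qed

context wandering
begin

lemma gnorm_bounds: "fst (growth v t) \<le> gnorm v t" "gnorm v t \<le> fst (growth v t) + snd (growth v t)"
  using growth_nonneg[of v t] unfolding gnorm_def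
  by (auto intro: real_le_rsqrt sqrt_sum_squares_le_sum)

lemma k_ge: "n \<le> k n"
proof (induction n)
  case (Suc n)
  then show ?case using k(2)[of n] k_pos[of n] by linarith
qed simp

text \<open>At T = \<open>start n\<close> the first component exceeds l^T by a factor q of order at
  least (m/l)^(k n). In the next h steps it grows by l only and the second component has not yet
  caught up, so the excess of the average over ln l is diluted by a fixed amount.\<close>

lemma average_growth_gap:
  assumes "v \<noteq> 0"
  shows "\<exists>\<epsilon>>0. \<forall>N. \<exists>t>N. \<exists>t'>N. \<epsilon> \<le> 1 / real t * ln (gnorm v t) - 1 / real t' * ln (gnorm v t')"
proof -
  let ?th = "m / l"
  define \<eta> where "\<eta> = ln ?th"
  have \<eta>: "0 < \<eta>" using th_gt by (simp add: \<eta>_def)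
  \<comment> \<open>The index is 0 or 1: the stay that a nonzero component of v starts in first
    place.\<close>
  obtain i where i: "0 < comp1 v i"
  proof (cases "v $ 1 = 0")
    case True
    then have "v $ 2 \<noteq> 0" using assms by (auto simp: vec2_eq_iff)
    then have "0 < comp1 v (Suc 0)" unfolding comp1_def growth_start_Suc using lm0 by (simp add: start_def)
    then show thesis by (rule that)
  next
    case False
    then have "0 < comp1 v 0" unfolding comp1_def by (simp add: start_def)
    then show thesis by (rule that)
  qed
  define c C D where "c = comp1 v i" and "C = \<bar>v $ 1\<bar> + \<bar>v $ 2\<bar>" and "D = 1 + C / c"
  have c: "0 < c" using i by (simp add: c_def)
  have C: "0 \<le> C" by (simp add: C_def)
  have D: "1 \<le> D" using c C by (simp add: D_def)
  have "\<exists>t>N. \<exists>t'>N. \<eta> / 160 \<le> 1 / real t * ln (gnorm v t) - 1 / real t' * ln (gnorm v t')" for N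
  proof -
    \<comment> \<open>Makes ln c and ln D negligible against k n * \<eta> and both times larger than
      N.\<close>
    obtain j :: nat where j: "real N + 2 * \<bar>ln c\<bar> / \<eta> + 32 * ln D / \<eta> < real j" using reals_Archimedean2 by blast
    have nn: "0 \<le> \<bar>ln c\<bar> / \<eta>" "0 \<le> ln D / \<eta>" using \<eta> D by simp_all
    define p where "p = i + 2 * j + 1"
    define n where "n = Suc p"
    have n2: "n = i + 2 * j + 2" by (simp add: n_def p_def)
    define T where "T = start n"
    \<comment> \<open>The second component starts with relative size at most C (m/l)^(2 k p) and
      gains m/l per step, so after h steps it is at most C (m/l)^(k n), which is C/c times a lower
      bound of q.\<close>
    define h where "h = k n - 2 * k p"
    have kp: "5 * k p \<le> k n" unfolding n_def by (rule k(2))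
    have kj: "j \<le> k n" using k_ge[of n] n2 by linarith
    have T: "T \<le> 4 * k n" "k n \<le> T" "n \<le> T"
      using start_le[of n] start_ge[of n] by (auto simp: T_def n_def)
    define q where "q = comp1 v n"
    have q: "c * ?th ^ k n \<le> q" unfolding q_def c_def n2 by (rule comp1_lower[OF i])
    then have q0: "0 < q" using c lm0 by (smt (verit) divide_pos_pos mult_pos_pos zero_less_power)
    have g1: "fst (growth v T) = l ^ T * q" using lm0 by (simp add: T_def q_def comp1_def)
    have g2: "snd (growth v T) = l ^ T * comp1 v p" unfolding T_def n_def by (rule snd_growth_start)
    have "k n \<le> k (Suc n)" by (rule k_mono) simp
    then have "h \<le> k (Suc n)" by (simp add: h_def)
    from growth_in_stay[OF this, of v] have gh: "growth v (T + h) = (l ^ h * (l ^ T * q), m ^ h * (l ^ T * comp1 v p))"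
      unfolding T_def[symmetric] g1 g2 .
    have "?th ^ h * comp1 v p \<le> ?th ^ h * (C * ?th ^ (2 * k p))"
      unfolding C_def using lm0 by (intro mult_left_mono comp1_upper) auto
    also have "\<dots> = C * ?th ^ (h + 2 * k p)" by (simp add: power_add)
    also have "h + 2 * k p = k n" using kp by (simp add: h_def)
    also have "C * ?th ^ k n = (C / c) * (c * ?th ^ k n)" using c by simp
    also have "\<dots> \<le> (C / c) * q" using q C c by (intro mult_left_mono) auto
    finally have sm: "?th ^ h * comp1 v p \<le> (C / c) * q" .
    have "gnorm v (T + h) \<le> l ^ h * (l ^ T * q) + m ^ h * (l ^ T * comp1 v p)"
      using gnorm_bounds(2)[of v "T + h"] unfolding gh by simp
    also have "\<dots> = l ^ (T + h) * (q + ?th ^ h * comp1 v p)"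
      using lm0 by (simp add: power_add power_divide field_simps)
    also have "\<dots> \<le> l ^ (T + h) * (q + (C / c) * q)" using sm lm0 by (intro mult_left_mono) auto
    also have "\<dots> = l ^ (T + h) * (q * D)" by (simp add: D_def algebra_simps)
    finally have up: "gnorm v (T + h) \<le> l ^ (T + h) * (q * D)" .
    have lo: "l ^ T * q \<le> gnorm v T" using gnorm_bounds(1)[of v T] unfolding g1 .
    have "ln (l ^ T * q) \<le> ln (gnorm v T)" using lo q0 lm0 gnorm_pos[OF assms, of T] by simp
    then have ln1: "real T * ln l + ln q \<le> ln (gnorm v T)"
      using lm0 q0 by (simp add: ln_mult_pos ln_realpow)
    have "ln (gnorm v (T + h)) \<le> ln (l ^ (T + h) * (q * D))"
      using up gnorm_pos[OF assms, of "T + h"] by (intro ln_mono) auto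
    then have ln2: "ln (gnorm v (T + h)) \<le> real (T + h) * ln l + (ln q + ln D)"
      using lm0 q0 D by (simp add: ln_mult_pos ln_realpow del: power_Suc)
    have "ln (c * ?th ^ k n) \<le> ln q" using q c lm0 by (intro ln_mono) auto
    then have lq: "ln c + real (k n) * \<eta> \<le> ln q" using c lm0 by (simp add: \<eta>_def ln_mult_pos ln_realpow)
    have kn: "real j \<le> real (k n)" using kj by simp
    have "2 * \<bar>ln c\<bar> / \<eta> \<le> real (k n)" "32 * ln D / \<eta> \<le> real (k n)" using j kn nn by linarith+
    then have k1: "2 * \<bar>ln c\<bar> \<le> real (k n) * \<eta>" "32 * ln D \<le> real (k n) * \<eta>"
      using \<eta> by (simp_all add: pos_divide_le_eq)
    have gap: "\<eta> / 160 \<le> ln q / real T - (ln q + ln D) / (real T + real h)"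
    proof (rule average_gap[of "real (k n)"])
      show "1 \<le> real (k n)" using k_pos[of n] by simp
      show "0 < real T" using T k_pos[of n] by simp
      show "real T \<le> 4 * real (k n)" using T by simp
      show "real (k n) / 2 \<le> real h" "real h \<le> real (k n)" using kp by (auto simp: h_def of_nat_diff)
      show "real (k n) * \<eta> / 2 \<le> ln q" using lq k1 by linarith
      show "32 * ln D \<le> real (k n) * \<eta>" by (rule k1)
      show "0 \<le> ln D" using D by simp
    qed (rule \<eta>)
    have T0: "0 < real T" using T k_pos[of n] by simp
    have "ln l + ln q / real T = (1 / real T) * (real T * ln l + ln q)" using T0 by (simp add: field_simps)
    also have "\<dots> \<le> 1 / real T * ln (gnorm v T)" using ln1 T0 by (intro mult_left_mono) auto
    finally have a1: "ln l + ln q / real T \<le> 1 / real T * ln (gnorm v T)" .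
    have "1 / real (T + h) * ln (gnorm v (T + h)) \<le> (1 / real (T + h)) * (real (T + h) * ln l + (ln q + ln D))"
      using ln2 by (intro mult_left_mono) auto
    also have "\<dots> = ln l + (ln q + ln D) / (real T + real h)" using T0 by (simp add: field_simps)
    finally have a2: "1 / real (T + h) * ln (gnorm v (T + h)) \<le> ln l + (ln q + ln D) / (real T + real h)" .
    have "N < T"
    proof -
      have "real N < real j" using j nn by linarith
      then show ?thesis using T n2 by simp
    qed
    moreover have "\<eta> / 160 \<le> 1 / real T * ln (gnorm v T) - 1 / real (T + h) * ln (gnorm v (T + h))"
      using a1 a2 gap by linarith
    ultimately show ?thesis using trans_less_add1[of N T h] by blast
  qed
  then show ?thesis using \<eta> by (intro exI[of _ "\<eta> / 160"]) auto
qed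

lemma rect_lyapunov:
  assumes "z \<in> rect" "z \<in> regular_points (dom1 s) F" "v \<noteq> 0"
  shows "nontrivial_closed_interval (omega_set (lyap_seq F z v))"
    and "omega_set (lyap_seq F z v) \<subseteq> {ln l..ln m}"
proof -
  let ?y = "\<lambda>t. ln (gnorm v t)"
  have pos: "0 < gnorm v t" for t using gnorm_pos[OF assms(3)] .
  have inc: "ln l \<le> ?y (Suc t) - ?y t" "?y (Suc t) - ?y t \<le> ln m" for t
  proof -
    have "ln (l * gnorm v t) \<le> ?y (Suc t)" using gnorm_step(1)[of v t] pos lm0 by (intro ln_mono) auto
    moreover have "?y (Suc t) \<le> ln (m * gnorm v t)" using gnorm_step(2)[of v t] pos lm0 by (intro ln_mono) auto
    ultimately show "ln l \<le> ?y (Suc t) - ?y t" "?y (Suc t) - ?y t \<le> ln m"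
      using pos[of t] lm0 by (simp_all add: ln_mult_pos)
  qed
  have l0: "0 \<le> ln l" using l by simp
  note av = omega_set_average[of "ln l" ?y "ln m", OF inc l0]
  show "omega_set (lyap_seq F z v) \<subseteq> {ln l..ln m}"
    unfolding lyap_seq_gnorm[OF assms(1,2)] by (rule av(1))
  obtain M where M: "\<And>t. \<bar>1 / real t * ?y t\<bar> \<le> M" using av(3) by blast
  obtain \<epsilon> where \<epsilon>: "\<epsilon> > 0" "\<And>N. \<exists>t>N. \<exists>t'>N. \<epsilon> \<le> 1 / real t * ?y t - 1 / real t' * ?y t'"
    using average_growth_gap[OF assms(3)] by blast
  show "nontrivial_closed_interval (omega_set (lyap_seq F z v))"
    unfolding lyap_seq_gnorm[OF assms(1,2)] by (rule omega_set_nontrivial[OF M av(2) \<epsilon>])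
qed

end

section \<open>Choice of the parameters\<close>

definition profile :: "(nat \<Rightarrow> nat) \<Rightarrow> (nat \<Rightarrow> real) \<Rightarrow> (nat \<Rightarrow> real) \<Rightarrow> nat \<Rightarrow> real" where
  "profile k E Q j = (if j = 0 then 0 else if j \<le> k 0 then E 0 else
     (let n = (LEAST n. j \<le> k (Suc n)) in E (Suc n) + Q n * (2 ^ j - 2 ^ k n) / 2 ^ k (Suc n)))"

lemma profile_block:
  fixes k :: "nat \<Rightarrow> nat"
  assumes "mono k" "k n < j" "j \<le> k (Suc n)"
  shows "profile k E Q j = E (Suc n) + Q n * (2 ^ j - 2 ^ k n) / 2 ^ k (Suc n)"
proof -
  have "(LEAST i. j \<le> k (Suc i)) = n"
  proof (rule Least_equality)
    fix i assume i: "j \<le> k (Suc i)"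
    show "n \<le> i"
    proof (rule ccontr)
      assume "\<not> n \<le> i"
      then have "k (Suc i) \<le> k n" using assms(1) by (auto simp: mono_def)
      then show False using i assms(2) by simp
    qed
  qed (rule assms(3))
  moreover have "\<not> j \<le> k 0" using assms(1,2) monoD[OF assms(1), of 0 n] by simp
  ultimately show ?thesis using assms(2) unfolding profile_def by simp
qed

lemma block_cases:
  fixes k :: "nat \<Rightarrow> nat"
  assumes "\<And>n. n \<le> k n" "k 0 < j"
  obtains n where "k n < j" "j \<le> k (Suc n)"
proof -
  let ?n = "LEAST n. j \<le> k n"
  have n: "j \<le> k ?n" by (rule LeastI[of _ j]) (rule assms(1))
  have "?n \<noteq> 0" using n assms(2) by (metis not_less)
  then obtain i where i: "?n = Suc i" using not0_implies_Suc by blast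
  have "\<not> j \<le> k i" using not_less_Least[of i "\<lambda>n. j \<le> k n"] i by simp
  then show thesis using that[of i] n i by simp
qed

text \<open>Stay lengths grow by the factor $2r+3$ so that the kick sending the orbit from one
  stay to the next fits into a $C^r$ function; the expansion rate is so weak that folding beats the
  growth accumulated over two stays.\<close>

lemma wandering_exists:
  fixes l m d \<epsilon> :: real and r :: nat
  defines "K \<equiv> 2 * r + 3" and "R \<equiv> 2 * r + 5"
  defines "M \<equiv> 2 * K + 2 + K ^ 2 + R * K ^ 3"
  assumes r: "1 \<le> r" and l: "1 < l" "l ^ M \<le> 2" "l \<le> 51/50" and m: "l < m" "m \<le> l ^ 2"
    and d: "d = (l - 1) / 8"
    and psi: "Ck r \<psi>" "\<And>t. \<bar>t - 1\<bar> \<le> d \<Longrightarrow> \<psi> t = 1" "\<And>t. \<bar>t - 1\<bar> \<ge> 2 * d \<Longrightarrow> \<psi> t = 0"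
    and B: "\<And>i t. i \<le> r \<Longrightarrow> \<bar>(deriv ^^ i) \<psi> t\<bar> \<le> B"
    and eps: "0 < \<epsilon>" "\<epsilon> < d" "\<epsilon> \<le> 1/32"
  shows "\<exists>g k W P. wandering l m (1 - 2 * d) d g k W P \<and> Ck r g \<and>
    (\<forall>i\<le>r. \<forall>x. \<bar>(deriv ^^ i) g x\<bar> \<le> 4 * \<epsilon> * B * (\<Sum>j. (1 / l) ^ j))"
proof -
  have l0: "0 < l" and m0: "0 < m" "1 < m" using l m by auto
  define u where "u = 1 / l"
  have u: "0 < u" "u < 1" "u * l = 1" using l by (auto simp: u_def)
  have um: "u ^ a \<le> u ^ b" if "b \<le> a" for a b using u that by (intro power_decreasing) auto
  have eu: "\<epsilon> * u ^ a \<le> \<epsilon> * u ^ b" if "b \<le> a" for a b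
    using um[OF that] eps by simp
  have K5: "5 \<le> K" using r by (simp add: K_def)
  obtain N where N: "8 / \<epsilon> < l ^ N" using real_arch_pow[OF l(1)] by blast
  have N0: "N \<noteq> 0"
  proof
    assume "N = 0"
    then have "8 < \<epsilon>" using N eps by (simp add: pos_divide_less_eq)
    then show False using eps by simp
  qed
  have uN: "u ^ N \<le> \<epsilon> / 8"
  proof -
    have "u ^ N * (8 / \<epsilon>) \<le> u ^ N * l ^ N" using N u by (intro mult_left_mono) auto
    also have "\<dots> = 1" by (simp add: u flip: power_mult_distrib)
    finally show ?thesis using eps by (simp add: field_simps)
  qed
  define k where "k n = N * K ^ n" for n
  have kS: "k (Suc n) = K * k n" for n by (simp add: k_def)
  have k0: "1 \<le> k 0" "N \<le> k n" for n using N0 K5 by (auto simp: k_def)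
  have k1: "1 \<le> k n" for n using k0(2)[of n] N0 by linarith
  have k5: "5 * k n \<le> k (Suc n)" for n unfolding kS using K5 by (intro mult_right_mono) auto
  have kmono: "mono k"
  proof (rule incseq_SucI)
    show "k n \<le> k (Suc n)" for n using k5[of n] by linarith
  qed
  have kn: "n \<le> k n" for n
  proof (induction n)
    case (Suc n)
    then show ?case using k5[of n] k1[of n] by linarith
  qed simp
  \<comment> \<open>Of the exponent R = 2r + 5, three units are spent in \<open>Qle\<close> on m^k *
    l \<le> l^(3k); the other 2r + 2 provide the decay of the corrections.\<close>
  define W where "W n = \<epsilon> * u ^ (R * k (Suc n))" for n
  define E where "E = esc l k"
  define Q where "Q = hgt l m k W"
  define P where "P = profile k E Q"
  have E: "E n = u ^ (k (Suc n) + 1)" for n by (simp add: E_def esc_def u_def power_one_over)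
  have Epos: "0 < E n" for n using u by (simp add: E)
  have Wpos: "0 < W n" "W n \<le> \<epsilon>" for n
    using u eps power_le_one[of u] by (auto simp: W_def mult_le_cancel_left2)
  have Qpos: "0 < Q n" for n using l0 m0 Wpos by (simp add: Q_def hgt_def)
  have Qle: "Q n \<le> \<epsilon> * u ^ ((2 * r + 2) * k (Suc n))" for n
  proof -
    let ?k = "k (Suc n)"
    have "m ^ ?k \<le> (l ^ 2) ^ ?k" using m m0 by (intro power_mono) auto
    then have "m ^ ?k * l \<le> (l ^ 2) ^ ?k * l ^ ?k"
      using l k1[of "Suc n"] self_le_power[of l ?k] by (intro mult_mono) auto
    also have "\<dots> = l ^ (3 * ?k)" by (simp add: power_mult power_add flip: power_mult_distrib)
      (simp add: power3_eq_cube power2_eq_square)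
    finally have "Q n \<le> l ^ (3 * ?k) * W n" unfolding Q_def hgt_def using Wpos(1)[of n] by (intro mult_right_mono) auto
    also have "R * ?k = (2 * r + 2) * ?k + 3 * ?k" by (simp add: R_def algebra_simps)
    then have "l ^ (3 * ?k) * W n = \<epsilon> * u ^ ((2 * r + 2) * ?k) * (u * l) ^ (3 * ?k)"
      unfolding W_def by (simp only: power_add power_mult_distrib mult_ac)
    finally show ?thesis unfolding u(3) by simp
  qed
  \<comment> \<open>Here K = (2r + 2) + 1 is used: the extra summand k n yields u^N and with it the
    factor \<epsilon>.\<close>
  have El: "E n \<le> \<epsilon> * u ^ ((2 * r + 2) * k n)" for n
  proof -
    have "N + (2 * r + 2) * k n \<le> k (Suc n) + 1" using k0(2)[of n] by (simp add: kS K_def algebra_simps)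
    then have "E n \<le> u ^ N * u ^ ((2 * r + 2) * k n)" unfolding E power_add[symmetric] by (rule um)
    also have "\<dots> \<le> \<epsilon> * u ^ ((2 * r + 2) * k n)" using uN eps u by (intro mult_right_mono) auto
    finally show ?thesis .
  qed
  have Q2: "Q n \<le> \<epsilon>" for n
    using order_trans[OF Qle[of n], of \<epsilon>] eps u power_le_one[of u "(2 * r + 2) * k (Suc n)"] by simp
  have eS: "E (Suc n) \<le> E n / 4" for n
  proof -
    have "N + (k (Suc n) + 1) \<le> k (Suc (Suc n)) + 1"
      using k0(2)[of n] k5[of n] k5[of "Suc n"] by linarith
    then have "E (Suc n) \<le> u ^ N * E n" unfolding E power_add[symmetric] by (rule um)
    also have "\<dots> \<le> (1/4) * E n" using uN eps Epos[of n] by (intro mult_right_mono) auto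
    finally show ?thesis by simp
  qed
  have e0: "E 0 \<le> 1/8"
  proof -
    have "E 0 \<le> u ^ N" unfolding E using k0(2)[of "Suc 0"] by (intro um) simp
    then show ?thesis using uN eps by linarith
  qed
  have Ele: "E n \<le> 1/8" for n
  proof (induction n)
    case (Suc n)
    then show ?case using eS[of n] Epos[of n] by linarith
  qed (rule e0)
  have P1: "P j = E 0" if "1 \<le> j" "j \<le> k 0" for j using that by (simp add: P_def profile_def)
  have P2: "P j = E (Suc n) + Q n * (2 ^ j - 2 ^ k n) / 2 ^ k (Suc n)" if "k n < j" "j \<le> k (Suc n)" for n j
    unfolding P_def by (rule profile_block[OF kmono that])
  have P0: "P 0 = 0" by (simp add: P_def profile_def)
  have frac: "0 \<le> Q n * (2 ^ j - 2 ^ k n) / 2 ^ k (Suc n) \<and> Q n * (2 ^ j - 2 ^ k n) / 2 ^ k (Suc n) \<le> Q n"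
    if "k n < j" "j \<le> k (Suc n)" for n j
  proof -
    have "(2::real) ^ k n \<le> 2 ^ j" "(2::real) ^ j \<le> 2 ^ k (Suc n)" using that by (auto intro: power_increasing)
    moreover have "(0::real) < 2 ^ k n" by simp
    ultimately have "(0::real) \<le> 2 ^ j - 2 ^ k n" "(2::real) ^ j - 2 ^ k n \<le> 2 ^ k (Suc n)" by linarith+
    then show ?thesis using Qpos[of n] by (simp add: pos_divide_le_eq)
  qed
  have Pb: "0 \<le> P j \<and> P j < 1/2" for j
  proof (cases "j = 0 \<or> j \<le> k 0")
    case True
    then show ?thesis using P0 P1[of j] e0 Epos[of 0] by (cases "j = 0") auto
  next
    case False
    then obtain n where "k n < j" "j \<le> k (Suc n)" using block_cases[of k j] kn by auto
    then show ?thesis using P2 frac[of n j] Ele[of "Suc n"] Epos[of "Suc n"] Q2[of n] eps by simp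
  qed
  have Pk: "P (k n) \<le> 2 * \<epsilon> * u ^ ((2 * r + 2) * k n)" for n
  proof (cases n)
    case 0
    then show ?thesis using P1[of "k 0"] k0(1) El[of 0] Epos[of 0] by simp
  next
    case (Suc i)
    have "k i < k n" unfolding Suc using k5[of i] k1[of i] by linarith
    then have "P (k n) \<le> E n + Q i" using P2[of i "k n"] frac[of i "k n"] Suc by simp
    then show ?thesis using Qle[of i] El[of n] Suc by simp
  qed
  define b where "b j = (if j = 0 then 0 else (P j - P (j - 1)) / m ^ (j - 1))" for j
  \<comment> \<open>In the initial block only j = 1 carries a jump. Within a folding range jumps are
    at most Q n. At j = k n + 1 both P j and P (k n) are small, and j \<le> 2 k n turns the exponent
    (2r + 2) k n into (r + 1) j.\<close>
  have bb: "\<bar>b j\<bar> \<le> (4 * \<epsilon>) * (1 / l) ^ (Suc r * j)" for j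
  proof (cases "j = 0")
    case True
    then show ?thesis using eps by (simp add: b_def)
  next
    case False
    have "\<bar>P j - P (j - 1)\<bar> \<le> 4 * \<epsilon> * u ^ (Suc r * j)"
    proof (cases "j \<le> k 0")
      case True
      have "P j - P (j - 1) = (if j = 1 then E 0 else 0)"
        using True False P0 P1[of j] P1[of "j - 1"] by auto
      moreover have "E 0 \<le> 4 * \<epsilon> * u ^ (Suc r * 1)"
      proof -
        have "Suc r * 1 \<le> (2 * r + 2) * k 0" using k0(1) by (intro mult_mono) auto
        then have "\<epsilon> * u ^ ((2 * r + 2) * k 0) \<le> \<epsilon> * u ^ (Suc r * 1)" by (rule eu)
        moreover have "0 \<le> \<epsilon> * u ^ (Suc r * 1)" using eps u by simp
        ultimately show ?thesis using El[of 0] by linarith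
      qed
      ultimately show ?thesis using Epos[of 0] eps u by auto
    next
      case False
      then obtain n where n: "k n < j" "j \<le> k (Suc n)" using block_cases[of k j] kn by auto
      have Qj: "Q n \<le> \<epsilon> * u ^ (Suc r * j)"
      proof -
        have "Suc r * j \<le> (2 * r + 2) * k (Suc n)" using n(2) by (intro mult_mono) auto
        then have "\<epsilon> * u ^ ((2 * r + 2) * k (Suc n)) \<le> \<epsilon> * u ^ (Suc r * j)" by (rule eu)
        then show ?thesis using Qle[of n] by linarith
      qed
      have ej: "0 \<le> \<epsilon> * u ^ (Suc r * j)" using eps u by simp
      show ?thesis
      proof (cases "k n < j - 1")
        case True
        have "P j - P (j - 1) = Q n * (2 ^ j - 2 ^ (j - 1)) / 2 ^ k (Suc n)"
        proof -
          have "j - 1 \<le> k (Suc n)" using n by linarith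
          then show ?thesis unfolding P2[OF n] P2[OF True \<open>j - 1 \<le> k (Suc n)\<close>]
            by (simp add: algebra_simps diff_divide_distrib)
        qed
        also have "(2::real) ^ j - 2 ^ (j - 1) = 2 ^ (j - 1)" using n by (cases j) auto
        finally have eq: "P j - P (j - 1) = Q n * 2 ^ (j - 1) / 2 ^ k (Suc n)" .
        have "(2::real) ^ (j - 1) \<le> 2 ^ k (Suc n)" using n by (intro power_increasing) auto
        then have "\<bar>P j - P (j - 1)\<bar> \<le> Q n" unfolding eq using Qpos[of n] by (simp add: pos_divide_le_eq)
        then show ?thesis using Qj ej by linarith
      next
        case False
        then have j: "j - 1 = k n" "j = k n + 1" using n by auto
        have "Suc r * j \<le> (2 * r + 2) * k n"
        proof -
          have "Suc r * j \<le> Suc r * (2 * k n)" using j k1[of n] by (intro mult_left_mono) auto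
          then show ?thesis by (simp add: algebra_simps)
        qed
        then have "\<epsilon> * u ^ ((2 * r + 2) * k n) \<le> \<epsilon> * u ^ (Suc r * j)" by (rule eu)
        then have 1: "P (k n) \<le> 2 * (\<epsilon> * u ^ (Suc r * j))" "E n \<le> \<epsilon> * u ^ (Suc r * j)"
          using Pk[of n] El[of n] by linarith+
        have "P j \<le> E (Suc n) + Q n" using P2[OF n] frac[OF n] by simp
        then have "P j \<le> 2 * (\<epsilon> * u ^ (Suc r * j))" using eS[of n] Epos[of n] 1 Qj by linarith
        then show ?thesis using 1 Pb[of j] Pb[of "k n"] ej unfolding j(1) by linarith
      qed
    qed
    moreover have "1 \<le> m ^ (j - 1)" using m0 by (intro one_le_power) simp
    ultimately have "\<bar>P j - P (j - 1)\<bar> / m ^ (j - 1) \<le> (4 * \<epsilon> * u ^ (Suc r * j)) / 1"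
      by (intro frac_le) auto
    then show ?thesis using False m0 by (simp add: b_def u_def)
  qed
  define g where "g x = (\<Sum>j. b j * \<psi> (l ^ j * x))" for x
  have gC: "Ck r g" and gB: "\<And>i x. i \<le> r \<Longrightarrow> \<bar>(deriv ^^ i) g x\<bar> \<le> 4 * \<epsilon> * B * (\<Sum>j. (1 / l) ^ j)"
    unfolding g_def using Ck_bump_series[OF psi(1) B l(1) bb] by auto
  have d0: "0 < d" "d \<le> 1/400" using d l by auto
  have ld: "l = 1 + 8 * d" using d by simp
  have dd: "d * d \<le> d * (1/400)" using d0 by (intro mult_left_mono) auto
  \<comment> \<open>The factor l = 1 + 8d carries values near 1 beyond 1 + 2d, and its inverse
    carries them below 1 - 2d, where \<psi> vanishes. Near l^-j only the j-th bump survives.\<close>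
  have ineq1: "1 + 2 * d \<le> l * (1 - d)" and ineq2: "1 + d \<le> (1 - 2 * d) * l"
    unfolding ld using dd d0 by (simp_all add: algebra_simps)
  have plat: "g (X / l ^ j) = (P j - P (j - 1)) / m ^ (j - 1)" if j: "1 \<le> j" and X: "\<bar>X - 1\<bar> < d" for j X
  proof -
    have zero: "\<psi> (l ^ i * (X / l ^ j)) = 0" if ij: "i \<noteq> j" for i
    proof (rule psi(3))
      have X': "1 - d < X" "X < 1 + d" using X by (auto simp: abs_less_iff)
      show "2 * d \<le> \<bar>l ^ i * (X / l ^ j) - 1\<bar>"
      proof (cases "j < i")
        case True
        then have "l ^ i = l ^ (i - j) * l ^ j" by (simp flip: power_add)
        then have eq: "l ^ i * (X / l ^ j) = l ^ (i - j) * X" using l0 by simp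
        have "l \<le> l ^ (i - j)" using l True by (intro self_le_power) auto
        then have "l * (1 - d) \<le> l ^ (i - j) * X" using X' d0 l0 by (intro mult_mono) auto
        then show ?thesis using ineq1 unfolding eq by linarith
      next
        case False
        then have "l ^ j = l ^ (j - i) * l ^ i" by (simp flip: power_add)
        then have eq: "l ^ i * (X / l ^ j) = X / l ^ (j - i)" using l0 by simp
        have "l \<le> l ^ (j - i)" using l False ij by (intro self_le_power) auto
        then have "(1 - 2 * d) * l \<le> (1 - 2 * d) * l ^ (j - i)" using d0 by (intro mult_left_mono) auto
        then have "X \<le> (1 - 2 * d) * l ^ (j - i)" using X' ineq2 by linarith
        then have "X / l ^ (j - i) \<le> 1 - 2 * d" using l0 by (simp add: pos_divide_le_eq)
        then show ?thesis unfolding eq by linarith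
      qed
    qed
    have one: "\<psi> (l ^ j * (X / l ^ j)) = 1" using psi(2)[of X] X l0 by simp
    have "g (X / l ^ j) = (\<Sum>i\<in>{j}. b i * \<psi> (l ^ i * (X / l ^ j)))"
      unfolding g_def by (rule suminf_finite) (use zero in auto)
    also have "\<dots> = b j" using one by simp
    finally show ?thesis using j by (simp add: b_def)
  qed
  have VW: "exh l m k W n \<le> E (Suc n) * W (Suc (Suc n))" for n
  proof -
    let ?k = "k n"
    have kk: "k (Suc n) = K * ?k" "k (Suc (Suc n)) = K * K * ?k" "k (Suc (Suc (Suc n))) = K * K * K * ?k"
      by (simp_all add: kS)
    have "m ^ (K * ?k) \<le> (l ^ 2) ^ (K * ?k)" using m m0 by (intro power_mono) auto
    moreover have "W n \<le> \<epsilon>" by (rule Wpos)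
    ultimately have "Q n \<le> (l ^ 2) ^ (K * ?k) * l * \<epsilon>"
      unfolding Q_def hgt_def kk using l0 m0 Wpos(1)[of n] by (intro mult_mono) auto
    also have "\<dots> = \<epsilon> * l ^ (2 * (K * ?k) + 1)" by (simp add: power_mult)
    finally have Q': "Q n \<le> \<epsilon> * l ^ (2 * (K * ?k) + 1)" .
    \<comment> \<open>The origin of M: it collects the exponents of l in the bound of Q n and in the
      inverse of E(n+1) W(n+2); the two single units are absorbed by 2 k n.\<close>
    have ex: "2 * (K * ?k) + 1 + (K * K * ?k + 1 + R * (K * K * K * ?k)) \<le> M * ?k"
    proof -
      have "M * ?k = 2 * (K * ?k) + 2 * ?k + K * K * ?k + R * (K * K * K * ?k)"
        by (simp add: M_def power2_eq_square power3_eq_cube algebra_simps)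
      then show ?thesis using k1[of n] by linarith
    qed
    have "l ^ (2 * (K * ?k) + 1) * l ^ (K * K * ?k + 1 + R * (K * K * K * ?k)) \<le> l ^ (M * ?k)"
      unfolding power_add[symmetric] using l ex by (intro power_increasing) auto
    also have "\<dots> = (l ^ M) ^ ?k" by (simp add: power_mult)
    also have "\<dots> \<le> 2 ^ ?k" using l by (intro power_mono) auto
    finally have pw: "l ^ (2 * (K * ?k) + 1) * l ^ (K * K * ?k + 1 + R * (K * K * K * ?k)) \<le> 2 ^ ?k" .
    define a where "a = K * K * ?k + 1 + R * (K * K * K * ?k)"
    have "l ^ a * u ^ a = (l * u) ^ a" by (rule power_mult_distrib[symmetric])
    also have "\<dots> = 1" using u(3) by (simp add: mult.commute)
    finally have "l ^ (2 * (K * ?k) + 1) = l ^ (2 * (K * ?k) + 1) * l ^ a * u ^ a"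
      by (simp only: mult.assoc mult_1_right)
    also have "\<dots> \<le> 2 ^ ?k * u ^ a" using pw u unfolding a_def[symmetric] by (intro mult_right_mono) auto
    finally have "\<epsilon> * l ^ (2 * (K * ?k) + 1) \<le> \<epsilon> * (2 ^ ?k * u ^ a)" using eps by (intro mult_left_mono) auto
    with Q' have "Q n \<le> \<epsilon> * (2 ^ ?k * u ^ a)" by (rule order_trans)
    then have "exh l m k W n \<le> \<epsilon> * (2 ^ ?k * u ^ a) * 2 ^ ?k / 2 ^ k (Suc n)"
      unfolding exh_def Q_def by (intro divide_right_mono mult_right_mono) auto
    also have "\<dots> = (\<epsilon> * u ^ a) * (2 ^ (?k + ?k) / 2 ^ k (Suc n))"
      by (simp only: power_add) simp
    also have "\<dots> \<le> (\<epsilon> * u ^ a) * 1"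
    proof (rule mult_left_mono)
      \<comment> \<open>One factor 2^(k n) has paid for the powers of l, the other comes from
        \<open>exh\<close>; the folds still provide more than both.\<close>
      have "(2::real) ^ (?k + ?k) \<le> 2 ^ k (Suc n)" using k5[of n] by (intro power_increasing) auto
      then show "(2::real) ^ (?k + ?k) / 2 ^ k (Suc n) \<le> 1" by simp
    qed (use eps u in simp)
    also have "\<dots> = E (Suc n) * W (Suc (Suc n))"
      unfolding E W_def kk a_def by (simp add: power_add)
    finally show ?thesis .
  qed
  have "wandering l m (1 - 2 * d) d g k W P"
  proof
    show "l \<le> 21/20" using l by simp
    have "l * l \<le> (51/50) * (51/50)" using l by (intro mult_mono) auto
    then show "m \<le> 21/20" using m by (simp add: power2_eq_square)
    show "(1 + d) / l \<le> 1 - 2 * d" using ineq2 l0 by (simp add: pos_divide_le_eq)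
    show "Ck (Suc 0) g" by (rule Ck_mono[OF gC]) (use r in simp)
    show "W n < d" for n using Wpos(2)[of n] eps by linarith
    show "P j < 1/2" for j using Pb[of j] by simp
    show "exh l m k W n \<le> esc l k (Suc n) * W (Suc (Suc n))" for n using VW by (simp add: E_def)
    show "P j = esc l k (Suc n) + hgt l m k W n * (2 ^ j - 2 ^ k n) / 2 ^ k (Suc n)"
      if "k n < j" "j \<le> k (Suc n)" for n j using P2[OF that] by (simp add: E_def Q_def)
  qed (use l m d0 Wpos k0 k5 e0 eS P0 P1 plat in \<open>simp_all add: E_def\<close>)
  then show ?thesis using gC gB by blast
qed

section \<open>Assembly of the family and its limit map\<close>

lemma (in wandering) rect_lyapunov_bounds:
  assumes "z \<in> rect" "z \<in> regular_points (dom1 s) F" "v \<noteq> 0"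
  shows "ln l \<le> Inf (omega_set (lyap_seq F z v))" "Inf (omega_set (lyap_seq F z v)) \<le> ln m"
    and "ln l \<le> Sup (omega_set (lyap_seq F z v))" "Sup (omega_set (lyap_seq F z v)) \<le> ln m"
proof -
  obtain a b where ab: "a < b" "omega_set (lyap_seq F z v) = {a..b}"
    using rect_lyapunov(1)[OF assms] unfolding nontrivial_closed_interval_def by blast
  have "{a..b} \<subseteq> {ln l..ln m}" using rect_lyapunov(2)[OF assms] unfolding ab(2) .
  then have "ln l \<le> a" "b \<le> ln m" using ab(1) by auto
  moreover have "Inf {a..b} = a" "Sup {a..b} = b" using ab(1) by simp_all
  ultimately show "ln l \<le> Inf (omega_set (lyap_seq F z v))" "Inf (omega_set (lyap_seq F z v)) \<le> ln m"
    "ln l \<le> Sup (omega_set (lyap_seq F z v))" "Sup (omega_set (lyap_seq F z v)) \<le> ln m"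
    unfolding ab(2) using ab(1) by auto
qed

text \<open>Shows that the limit map is not a member of the family: comparing two heights at x = 1/2
  eliminates g(1/2) and leaves the slope.\<close>

lemma pw_map_slope_inj:
  assumes "1/2 < s" "restrict (pw_map l m s g) (dom1 s) = restrict (pw_map l m' s (\<lambda>_. 0)) (dom1 s)"
  shows "m = m'"
proof -
  have eq: "g (1/2) - m * y = - m' * y" if "0 < y" "y < 1/2" for y
  proof -
    have "vector [1/2, y] \<in> dom1 s" using that assms(1) by (simp add: mem_dom1 mem_zone)
    then have "pw_map l m s g (vector [1/2, y]) = pw_map l m' s (\<lambda>_. 0) (vector [1/2, y])"
      using fun_cong[OF assms(2), of "vector [1/2, y]"] by simp
    then show ?thesis using that assms(1) by (simp add: pw_map_def vec2_eq_iff)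
  qed
  show ?thesis using eq[of "1/5"] eq[of "2/5"] by simp
qed

theorem theoremA:
  fixes r :: nat
  assumes "1 \<le> r"
  shows "\<exists>(D :: (real^2) set) (X :: real \<Rightarrow> (real^2) set) (F :: real \<Rightarrow> real^2 \<Rightarrow> real^2)
           (X0 :: (real^2) set) (F0 :: real^2 \<Rightarrow> real^2) (\<rho> :: real).
    open_rectangle D \<and>
    (\<forall>\<sigma>\<in>{0<..<1}. pw_expanding r D (X \<sigma>) (F \<sigma>)) \<and>
    pw_expanding r D X0 F0 \<and>
    pw_Cr_converges r D X F X0 F0 \<and>
    (\<forall>\<sigma>\<in>{0<..<1}. (X \<sigma>, restrict (F \<sigma>) (X \<sigma>)) \<noteq> (X0, restrict F0 X0)) \<and>
    0 < \<rho> \<and>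
    (\<exists>(R :: real \<Rightarrow> (real^2) set) (G :: real \<Rightarrow> (real^2) set).
      (\<forall>\<sigma>\<in>{0<..<1}.
        open_rectangle (R \<sigma>) \<and> R \<sigma> \<subseteq> D \<and> wandering_domain (X \<sigma>) (F \<sigma>) (R \<sigma>) \<and>
        G \<sigma> \<subseteq> R \<sigma> \<inter> regular_points (X \<sigma>) (F \<sigma>) \<and>
        (AE x in lebesgue. x \<in> R \<sigma> \<longrightarrow> x \<in> G \<sigma>) \<and>
        (\<forall>x\<in>G \<sigma>. \<forall>v. v \<noteq> 0 \<longrightarrow>
          nontrivial_closed_interval (omega_set (lyap_seq (F \<sigma>) x v)) \<and>
          \<rho> \<le> Inf (omega_set (lyap_seq (F \<sigma>) x v)))) \<and>
      (\<forall>(x :: real \<Rightarrow> real^2) (v :: real \<Rightarrow> real^2).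
        (\<forall>\<sigma>\<in>{0<..<1}. x \<sigma> \<in> G \<sigma> \<and> v \<sigma> \<noteq> 0) \<longrightarrow>
        (\<exists>c. ((\<lambda>\<sigma>. Inf (omega_set (lyap_seq (F \<sigma>) (x \<sigma>) (v \<sigma>)))) \<longlongrightarrow> c) (at_right 0) \<and>
             ((\<lambda>\<sigma>. Sup (omega_set (lyap_seq (F \<sigma>) (x \<sigma>) (v \<sigma>)))) \<longlongrightarrow> c) (at_right 0))))"
proof -
  define K where "K = 2 * r + 3"
  define M where "M = 2 * K + 2 + K ^ 2 + (2 * r + 5) * K ^ 3"
  \<comment> \<open>With 51 factors Bernoulli's inequality gives (51/50)^M > 2, which forces l \<le>
    51/50.\<close>
  have M: "51 \<le> M"
  proof -
    have "5 ^ 3 \<le> K ^ 3" using assms by (intro power_mono) (auto simp: K_def)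
    then have "1 * 5 ^ 3 \<le> (2 * r + 5) * K ^ 3" by (intro mult_mono) auto
    then show ?thesis by (simp add: M_def)
  qed
  define l where "l = root M 2"
  have lM: "l ^ M = 2" using M by (simp add: l_def)
  have l1: "1 < l" using M by (simp add: l_def)
  have l2: "l \<le> 51/50"
  proof (rule ccontr)
    assume "\<not> ?thesis"
    then have "(51/50) ^ M < l ^ M" using M by (intro power_strict_mono) auto
    moreover have "1 + real M * (1/50) \<le> (1 + 1/50) ^ M" by (rule Bernoulli_inequality) simp
    ultimately show False using M unfolding lM by simp
  qed
  define d s where "d = (l - 1) / 8" and "s = 1 - 2 * d"
  have d: "0 < d" and s: "1/2 < s" "s < 1" using l1 l2 by (simp_all add: d_def s_def)
  obtain \<psi> where psi: "Ck r \<psi>" "\<And>t. \<bar>t - 1\<bar> \<le> d \<Longrightarrow> \<psi> t = 1" "\<And>t. \<bar>t - 1\<bar> \<ge> 2 * d \<Longrightarrow> \<psi> t = 0"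
    using Ck_plateau[OF d, of r] by metis
  have support: "\<psi> t = 0" if "t \<notin> {1 - 2 * d..1 + 2 * d}" for t
    using that by (intro psi(3)) auto
  obtain B where B: "B > 0" "\<And>i t. i \<le> r \<Longrightarrow> \<bar>(deriv ^^ i) \<psi> t\<bar> \<le> B"
    using Ck_compact_support_bounded[OF psi(1) support] by blast
  define S where "S = (\<Sum>j. (1 / l) ^ j)"
  have "summable (\<lambda>j. (1 / l) ^ j)" using l1 by (intro summable_geometric) auto
  then have S: "0 < S" unfolding S_def using l1 by (intro suminf_pos) auto
  define \<eta> where "\<eta> = (l - 1) / 2"
  have \<eta>: "0 < \<eta>" using l1 by (simp add: \<eta>_def)
  \<comment> \<open>The slope exceeds l, so each limit interval is nontrivial, and tends to l, so
    both end points are squeezed to ln l.\<close>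
  define m where "m \<sigma> = l powr (1 + \<sigma>)" for \<sigma>
  have m: "l < m \<sigma>" "m \<sigma> \<le> l ^ 2" "m \<sigma> \<le> 21/20" if "\<sigma> \<in> {0<..<1}" for \<sigma>
  proof -
    have "l powr 1 < m \<sigma>" unfolding m_def using that l1 by (intro powr_less_mono) auto
    then show "l < m \<sigma>" using l1 by simp
    have "m \<sigma> \<le> l powr 2" unfolding m_def using that l1 by (intro powr_mono) auto
    then show le: "m \<sigma> \<le> l ^ 2" using l1 by simp
    have "l * l \<le> (51/50) * (51/50)" using l1 l2 by (intro mult_mono) auto
    then show "m \<sigma> \<le> 21/20" using le by (simp add: power2_eq_square)
  qed
  have "\<exists>g k W P. wandering l (m \<sigma>) s d g k W P \<and> Ck r g \<and> (\<forall>i\<le>r. \<forall>x. \<bar>(deriv ^^ i) g x\<bar> \<le> \<eta> * \<sigma>)"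
    if \<sigma>: "\<sigma> \<in> {0<..<1}" for \<sigma>
  proof -
    \<comment> \<open>The first entry bounds g and its derivatives by \<eta>\<sigma>, which serves
      both expansion and convergence; the others are the size conditions of
      \<open>wandering_exists\<close>.\<close>
    define \<epsilon> where "\<epsilon> = min (\<eta> * \<sigma> / (4 * B * S)) (min (d / 2) (1/32))"
    have eps: "0 < \<epsilon>" "\<epsilon> < d" "\<epsilon> \<le> 1/32" using \<eta> \<sigma> B(1) S d by (auto simp: \<epsilon>_def)
    have "\<epsilon> \<le> \<eta> * \<sigma> / (4 * B * S)" by (simp add: \<epsilon>_def)
    then have small: "4 * \<epsilon> * B * S \<le> \<eta> * \<sigma>" using B(1) S by (simp add: pos_le_divide_eq mult_ac)
    obtain g k W P where g: "wandering l (m \<sigma>) (1 - 2 * d) d g k W P" "Ck r g"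
      "\<And>i x. i \<le> r \<Longrightarrow> \<bar>(deriv ^^ i) g x\<bar> \<le> 4 * \<epsilon> * B * S"
      using wandering_exists[OF assms l1 _ l2 m(1,2)[OF \<sigma>] d_def psi B(2) eps] lM
      unfolding M_def K_def S_def by auto
    then have "\<forall>i\<le>r. \<forall>x. \<bar>(deriv ^^ i) g x\<bar> \<le> \<eta> * \<sigma>" using small by (meson order_trans)
    then show ?thesis using g(1,2) unfolding s_def by blast
  qed
  then obtain g k W P where w: "\<And>\<sigma>. \<sigma> \<in> {0<..<1} \<Longrightarrow> wandering l (m \<sigma>) s d (g \<sigma>) (k \<sigma>) (W \<sigma>) (P \<sigma>)"
    and gC: "\<And>\<sigma>. \<sigma> \<in> {0<..<1} \<Longrightarrow> Ck r (g \<sigma>)"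
    and gb: "\<And>\<sigma> i x. \<sigma> \<in> {0<..<1} \<Longrightarrow> i \<le> r \<Longrightarrow> \<bar>(deriv ^^ i) (g \<sigma>) x\<bar> \<le> \<eta> * \<sigma>"
    by metis
  define F where "F \<sigma> = pw_map l (m \<sigma>) s (g \<sigma>)" for \<sigma>
  define F0 where "F0 = pw_map l l s (\<lambda>_. 0)"
  define R where "R \<sigma> = wandering.rect l (m \<sigma>) (k \<sigma>) (W \<sigma>)" for \<sigma>
  define G where "G \<sigma> = R \<sigma> \<inter> regular_points (dom1 s) (F \<sigma>)" for \<sigma>
  have l3: "l \<le> 21/20" using l2 by simp
  have data: "pw_expanding_with r dom0 (dom1 s) (F \<sigma>) (pw_maps_data l (m \<sigma>) s (g \<sigma>))" if \<sigma>: "\<sigma> \<in> {0<..<1}" for \<sigma>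
    unfolding F_def
  proof (rule pw_maps_data_expanding[OF s l1 l3 _ m(3)[OF \<sigma>] assms gC[OF \<sigma>]])
    show "l \<le> m \<sigma>" using m(1)[OF \<sigma>] by simp
    have "\<eta> * \<sigma> \<le> (l - 1) / 2" using \<sigma> \<eta> by (simp add: \<eta>_def mult_left_le)
    then show "\<bar>(deriv ^^ i) (g \<sigma>) x\<bar> \<le> (l - 1) / 2" if "i \<le> r" for i x
      using gb[OF \<sigma> that, of x] by linarith
  qed
  have data0: "pw_expanding_with r dom0 (dom1 s) F0 (pw_maps_data l l s (\<lambda>_. 0))"
    unfolding F0_def
    by (rule pw_maps_data_expanding[OF s l1 l3 order_refl l3 assms Ck_const]) (use l1 in \<open>simp add: deriv_pow_zero\<close>)
  have mlim: "(m \<longlongrightarrow> l) (at_right 0)"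
  proof -
    have "((\<lambda>\<sigma>. l powr (1 + \<sigma>)) \<longlongrightarrow> l powr (1 + 0)) (at_right 0)"
      using l1 by (intro tendsto_intros) auto
    then show ?thesis using l1 by (simp add: m_def[abs_def])
  qed
  have tend: "pw_data_tendsto r (\<lambda>\<sigma>. pw_maps_data l (m \<sigma>) s (g \<sigma>)) (pw_maps_data l l s (\<lambda>_. 0))"
    by (rule pw_maps_data_tendsto[OF s gC gb mlim])
  have conv: "pw_Cr_converges r dom0 (\<lambda>_. dom1 s) F (dom1 s) F0"
    unfolding pw_Cr_converges_def
    by (intro exI[of _ "\<lambda>\<sigma>. pw_maps_data l (m \<sigma>) s (g \<sigma>)"] exI[of _ "pw_maps_data l l s (\<lambda>_. 0)"]
        conjI ballI data data0 tend)
  have differ: "(dom1 s, restrict (F \<sigma>) (dom1 s)) \<noteq> (dom1 s, restrict F0 (dom1 s))" if "\<sigma> \<in> {0<..<1}" for \<sigma>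
    using pw_map_slope_inj[OF s(1), of l "m \<sigma>" "g \<sigma>" l] m(1)[OF that] by (auto simp: F_def F0_def)
  have lyap: "nontrivial_closed_interval (omega_set (lyap_seq (F \<sigma>) x v))"
    "ln l \<le> Inf (omega_set (lyap_seq (F \<sigma>) x v))" "Inf (omega_set (lyap_seq (F \<sigma>) x v)) \<le> ln (m \<sigma>)"
    "ln l \<le> Sup (omega_set (lyap_seq (F \<sigma>) x v))" "Sup (omega_set (lyap_seq (F \<sigma>) x v)) \<le> ln (m \<sigma>)"
    if \<sigma>: "\<sigma> \<in> {0<..<1}" and x: "x \<in> G \<sigma>" and v: "v \<noteq> 0" for \<sigma> x v
  proof -
    have x': "x \<in> wandering.rect l (m \<sigma>) (k \<sigma>) (W \<sigma>)" "x \<in> regular_points (dom1 s) (pw_map l (m \<sigma>) s (g \<sigma>))"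
      using x by (simp_all add: G_def R_def F_def)
    note lyap = wandering.rect_lyapunov(1)[OF w[OF \<sigma>] x' v] wandering.rect_lyapunov_bounds[OF w[OF \<sigma>] x' v]
    show "nontrivial_closed_interval (omega_set (lyap_seq (F \<sigma>) x v))"
      "ln l \<le> Inf (omega_set (lyap_seq (F \<sigma>) x v))" "Inf (omega_set (lyap_seq (F \<sigma>) x v)) \<le> ln (m \<sigma>)"
      "ln l \<le> Sup (omega_set (lyap_seq (F \<sigma>) x v))" "Sup (omega_set (lyap_seq (F \<sigma>) x v)) \<le> ln (m \<sigma>)"
      unfolding F_def by (fact lyap)+
  qed
  have rectangles: "open_rectangle (R \<sigma>) \<and> R \<sigma> \<subseteq> dom0 \<and> wandering_domain (dom1 s) (F \<sigma>) (R \<sigma>) \<and>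
        G \<sigma> \<subseteq> R \<sigma> \<inter> regular_points (dom1 s) (F \<sigma>) \<and>
        (AE x in lebesgue. x \<in> R \<sigma> \<longrightarrow> x \<in> G \<sigma>) \<and>
        (\<forall>x\<in>G \<sigma>. \<forall>v. v \<noteq> 0 \<longrightarrow>
          nontrivial_closed_interval (omega_set (lyap_seq (F \<sigma>) x v)) \<and>
          ln l \<le> Inf (omega_set (lyap_seq (F \<sigma>) x v)))" if \<sigma>: "\<sigma> \<in> {0<..<1}" for \<sigma>
  proof (intro conjI ballI allI impI)
    note w' = w[OF \<sigma>]
    show "open_rectangle (R \<sigma>)" unfolding R_def by (rule wandering.rect_open_rectangle[OF w'])
    show "R \<sigma> \<subseteq> dom0" unfolding R_def by (rule wandering.rect_subset[OF w'])
    show "wandering_domain (dom1 s) (F \<sigma>) (R \<sigma>)" unfolding R_def F_def by (rule wandering.rect_wandering[OF w'])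
    show "G \<sigma> \<subseteq> R \<sigma> \<inter> regular_points (dom1 s) (F \<sigma>)" by (simp add: G_def)
    show "AE x in lebesgue. x \<in> R \<sigma> \<longrightarrow> x \<in> G \<sigma>"
      unfolding G_def R_def F_def by (rule wandering.rect_AE_regular[OF w'])
  qed (use lyap[OF \<sigma>] in blast)+
  have limits: "\<exists>c. ((\<lambda>\<sigma>. Inf (omega_set (lyap_seq (F \<sigma>) (x \<sigma>) (v \<sigma>)))) \<longlongrightarrow> c) (at_right 0) \<and>
             ((\<lambda>\<sigma>. Sup (omega_set (lyap_seq (F \<sigma>) (x \<sigma>) (v \<sigma>)))) \<longlongrightarrow> c) (at_right 0)"
    if xv: "\<forall>\<sigma>\<in>{0<..<1}. x \<sigma> \<in> G \<sigma> \<and> v \<sigma> \<noteq> 0" for x v :: "real \<Rightarrow> real^2"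
  proof (intro exI conjI)
    have ev: "\<forall>\<^sub>F \<sigma> in at_right (0::real). \<sigma> \<in> {0<..<1}" by (rule eventually_at_right_real) simp
    have lim: "((\<lambda>\<sigma>. ln (m \<sigma>)) \<longlongrightarrow> ln l) (at_right 0)" using mlim l1 by (intro tendsto_ln) auto
    have lims: "(f \<longlongrightarrow> ln l) (at_right 0)"
      if "\<And>\<sigma>. \<sigma> \<in> {0<..<1} \<Longrightarrow> ln l \<le> f \<sigma> \<and> f \<sigma> \<le> ln (m \<sigma>)" for f :: "real \<Rightarrow> real"
      by (rule tendsto_sandwich[OF _ _ tendsto_const lim]; rule eventually_mono[OF ev]; use that in blast)
    show "((\<lambda>\<sigma>. Inf (omega_set (lyap_seq (F \<sigma>) (x \<sigma>) (v \<sigma>)))) \<longlongrightarrow> ln l) (at_right 0)"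
      by (rule lims) (use lyap(2,3) xv in blast)
    show "((\<lambda>\<sigma>. Sup (omega_set (lyap_seq (F \<sigma>) (x \<sigma>) (v \<sigma>)))) \<longlongrightarrow> ln l) (at_right 0)"
      by (rule lims) (use lyap(4,5) xv in blast)
  qed
  have expanding: "\<forall>\<sigma>\<in>{0<..<1}. pw_expanding r dom0 (dom1 s) (F \<sigma>)" "pw_expanding r dom0 (dom1 s) F0"
    unfolding pw_expanding_def using data data0 by blast+
  show ?thesis
  proof (rule exI[of _ dom0], rule exI[of _ "\<lambda>_. dom1 s"], rule exI[of _ F], rule exI[of _ "dom1 s"],
      rule exI[of _ F0], rule exI[of _ "ln l"], intro conjI)
    show "0 < ln l" using l1 by simp
    show "\<exists>R G. (\<forall>\<sigma>\<in>{0<..<1}. open_rectangle (R \<sigma>) \<and> R \<sigma> \<subseteq> dom0 \<and> wandering_domain (dom1 s) (F \<sigma>) (R \<sigma>) \<and>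
        G \<sigma> \<subseteq> R \<sigma> \<inter> regular_points (dom1 s) (F \<sigma>) \<and>
        (AE x in lebesgue. x \<in> R \<sigma> \<longrightarrow> x \<in> G \<sigma>) \<and>
        (\<forall>x\<in>G \<sigma>. \<forall>v. v \<noteq> 0 \<longrightarrow>
          nontrivial_closed_interval (omega_set (lyap_seq (F \<sigma>) x v)) \<and>
          ln l \<le> Inf (omega_set (lyap_seq (F \<sigma>) x v)))) \<and>
      (\<forall>(x :: real \<Rightarrow> real^2) (v :: real \<Rightarrow> real^2).
        (\<forall>\<sigma>\<in>{0<..<1}. x \<sigma> \<in> G \<sigma> \<and> v \<sigma> \<noteq> 0) \<longrightarrow>
        (\<exists>c. ((\<lambda>\<sigma>. Inf (omega_set (lyap_seq (F \<sigma>) (x \<sigma>) (v \<sigma>)))) \<longlongrightarrow> c) (at_right 0) \<and>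
             ((\<lambda>\<sigma>. Sup (omega_set (lyap_seq (F \<sigma>) (x \<sigma>) (v \<sigma>)))) \<longlongrightarrow> c) (at_right 0)))"
    proof (rule exI[of _ R], rule exI[of _ G], rule conjI)
      show "\<forall>\<sigma>\<in>{0<..<1}. open_rectangle (R \<sigma>) \<and> R \<sigma> \<subseteq> dom0 \<and> wandering_domain (dom1 s) (F \<sigma>) (R \<sigma>) \<and>
        G \<sigma> \<subseteq> R \<sigma> \<inter> regular_points (dom1 s) (F \<sigma>) \<and>
        (AE x in lebesgue. x \<in> R \<sigma> \<longrightarrow> x \<in> G \<sigma>) \<and>
        (\<forall>x\<in>G \<sigma>. \<forall>v. v \<noteq> 0 \<longrightarrow>
          nontrivial_closed_interval (omega_set (lyap_seq (F \<sigma>) x v)) \<and>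
          ln l \<le> Inf (omega_set (lyap_seq (F \<sigma>) x v)))"
        by (rule ballI) (rule rectangles)
    qed (rule allI, rule allI, rule impI, rule limits)
    show "\<forall>\<sigma>\<in>{0<..<1}. (dom1 s, restrict (F \<sigma>) (dom1 s)) \<noteq> (dom1 s, restrict F0 (dom1 s))"
      by (rule ballI) (rule differ)
  qed (rule open_rectangle_dom0 expanding conv)+
qed

end
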